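(* Let $k,s\in\mathbb{N}$, $p_1>0,\dots,p_k>0$ with $p_1+\dots+p_k=1$. Let $(Y_{1t},\dots,Y_{kt})$, $t=1,2,\dots$, be independent random vectors, each $Mn(s;p_1,\dots,p_k)$ distributed, and let $N$ be a non-negative integer-valued random variable independent of them. Put $X_{lN}=I_{\{N>0\}}\sum_{t=1}^NY_{lt}$, $l=1,\dots,k$, and denote the distribution of $(X_{1N},\dots,X_{kN})$ by $C\,N\,Mn(\vec a_N;s,p_1,\dots,p_k)$. Then the following hold (indices $i,j\in\{1,\dots,k\}$, with $i\ne j$ where both index coordinates). 1. $G_{X_{1N},\dots,X_{kN}}(z_1,\dots,z_k)=G_{sN}(p_1z_1+\dots+p_kz_k)$. 2. For $x_1,\dots,x_k=0,1,\dots$ such that $x_1+\dots+x_k$ is a multiple of $s$, $$P(X_{1N}=x_1,\dots,X_{kN}=x_k)=\binom{x_1+\dots+x_k}{x_1,\dots,x_k}p_1^{x_1}\cdots p_k^{x_k}\,P(Ns=x_1+\dots+x_k),$$ and $P(X_{1N}=0,\dots,X_{kN}=0)=P(N=0)$. 3. For all $r=1,\dots,k$ and any subset of coordinates $X_{i_1N},\dots,X_{i_rN}$, $$G_{X_{i_1N},\dots,X_{i_rN}}(z_{i_1},\dots,z_{i_r})=G_{sN}\big(p_{i_1}z_{i_1}+\dots+p_{i_r}z_{i_r}+1-(p_{i_1}+\dots+p_{i_r})\big),$$ $$P(X_{i_1N}=x_{i_1},\dots,X_{i_rN}=x_{i_r})=\frac{p_{i_1}^{x_{i_1}}\cdots p_{i_r}^{x_{i_r}}}{x_{i_1}!\cdots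 x_{i_r}!}\sum_{m=0}^\infty\frac{(m+x_{i_1}+\dots+x_{i_r})!}{m!}\big(1-(p_{i_1}+\dots+p_{i_r})\big)^mP(sN=m+x_{i_1}+\dots+x_{i_r}),$$ $$(X_{i_1N},\dots,X_{i_rN},Ns-(X_{i_1N}+\dots+X_{i_rN}))\sim C\,N\,Mn(\vec a_N;s,p_{i_1},\dots,p_{i_r},1-(p_{i_1}+\dots+p_{i_r})).$$ 4. For all $i=1,\dots,k$ and $m=0,1,\dots$, $$P(X_{iN}=m)=\frac{p_i^m}{m!}\sum_{j=0}^\infty\frac{(j+m)!}{j!}(1-p_i)^jP(sN=j+m)=\begin{cases}G_{sN}(1-p_i),&m=0,\\ \sum_{n=1}^\infty\binom{ns}{m}p_i^m(1-p_i)^{ns-m}P(N=n),&m=1,2,\dots\end{cases}$$ If $EN<\infty$, then $EX_{iN}=sp_i\,EN$. If $E(N^2)<\infty$, then $Var\,X_{iN}=sp_i[sp_i\,Var\,N+(1-p_i)EN]$ and $FI\,X_{iN}=1+p_i(s\,FI\,N-1)$. 5. $$P(X_{iN}=x_i\mid X_{jN}=x_j)=\frac{p_i^{x_i}}{x_i!}\,\frac{\sum_{m=0}^\infty\frac{(m+x_i+x_j)!}{m!}(1-(p_i+p_j))^mP(sN=m+x_i+x_j)}{\sum_{m=0}^\infty\frac{(x_j+m)!}{m!}(1-p_j)^mP(sN=x_j+m)},$$ $$G_{X_{iN}}(z_i\mid X_{jN}=x_j)=\frac{\sum_{m=0}^\infty\frac{(x_j+m)!}{m!}(p_iz_i+1-p_i-p_j)^mP(sN=x_j+m)}{\sum_{m=0}^\infty\frac{(x_j+m)!}{m!}(1-p_j)^mP(sN=x_j+m)},$$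 $$E(X_{iN}\mid X_{jN}=x_j)=p_i\frac{\sum_{m=0}^\infty\frac{(x_j+m+1)!}{m!}(1-p_j)^mP(sN=x_j+m+1)}{\sum_{m=0}^\infty\frac{(x_j+m)!}{m!}(1-p_j)^mP(sN=x_j+m)},$$ $$cov(X_{iN},X_{jN})=sp_ip_j[-EN+s\,Var\,N],$$ $$cor(X_{iN},X_{jN})=\frac{\sqrt{p_ip_j}\,(s\,Var\,N-EN)}{\sqrt{[sp_i\,Var\,N+EN(1-p_i)][sp_j\,Var\,N+EN(1-p_j)]}}=\sqrt{\frac{(FI\,X_{iN}-1)(FI\,X_{jN}-1)}{FI\,X_{iN}\,FI\,X_{jN}}}.$$ 6. If the following expectation exists, then $$E(X_{iN}\mid X_{jN}=x_j)=\frac{p_i}{p_j}(x_j+1)\frac{P(X_{jN}=x_j+1)}{P(X_{jN}=x_j)}.$$ 7. $G_{X_{1N}+\dots+X_{kN}}(z)=G_{sN}(z)$ and $P(X_{1N}+\dots+X_{kN}=m)=P(sN=m)$. 8. For $j=1,2,\dots$ and $i=1,\dots,k$, the conditional distribution of $X_{iN}$ given $X_{1N}+\dots+X_{kN}=j$ is $Bi(j;p_i)$.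
   Context: A random vector $(\xi_1,\dots,\xi_k)$ is multinomially distributed, $(\xi_1,\dots,\xi_k)\sim Mn(n;p_1,\dots,p_k)$ with $n\in\mathbb N$, $p_i>0$, $p_1+\dots+p_k=1$, if $P(\xi_1=i_1,\dots,\xi_k=i_k)=\binom{n}{i_1,\dots,i_k}p_1^{i_1}\cdots p_k^{i_k}$ for non-negative integers $i_1+\dots+i_k=n$, where $\binom{n}{i_1,\dots,i_k}=\frac{n!}{i_1!\cdots i_k!}$. $Bi(n;p)$ is the binomial distribution with $n$ trials and success probability $p$. In general, $C\,N\,Mn(\vec a_N;s,q_1,\dots,q_d)$ denotes the distribution of the random sum, over $N$ i.i.d. $Mn(s;q_1,\dots,q_d)$ vectors independent of $N$ (equal to the zero vector if $N=0$), where $\vec a_N$ is the vector of parameters of the distribution of $N$. In item 3 with $r=k$ the last probability parameter is $0$; the multinomial law is then understood by the same formula with $0^0=1$. The p.g.f. of a non-negative integer random vector is $G_{\xi_1,\dots,\xi_r}(z_1,\dots,z_r)=E(z_1^{\xi_1}\cdots z_r^{\xi_r})$; in particular $G_{sN}(z)=E(z^{sN})$; and $G_\xi(z\mid A)=E(z^\xi\mid A)$. $FI\,X=Var\,X/EX$ is the Fisher index of dispersion; $cor$ is the correlation coefficient. Conventions: $0^0=1$; $\binom{a}{b}=0$ for $b>a$, and terms with such a factor are zero. Each formula is asserted whenever the quantities in it are defined (conditioning events of positive probability, denominators nonzero, p.g.f.s existing at the argument, moments finite).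
   Formalization: In item 5 the last equality, cor equal to the square root of the Fisher-index expression, is false when s Var N < EN (then cor is negative); it is proved as printed when s Var N ≥ EN and with a minus sign before the root when s Var N < EN. *)

theory Defs
  imports "HOL-Probability.Probability"
begin

text \<open>
  Vectors with non-negative integer entries indexed by \<open>1, \<dots>, d\<close> are represented as extensional
  functions on \<open>{1..d}\<close>. There are countably many of them, so they carry the discrete
  sigma-algebra.
\<close>

definition nat_vectors :: "nat \<Rightarrow> (nat \<Rightarrow> nat) set" where
  "nat_vectors d = ({1..d} \<rightarrow>\<^sub>E UNIV)"

definition multinomial_coeff :: "'i set \<Rightarrow> ('i \<Rightarrow> nat) \<Rightarrow> real" where
  "multinomial_coeff I x = fact (\<Sum>l\<in>I. x l) / (\<Prod>l\<in>I. fact (x l))"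

text \<open>
  The law \<open>Mn(n; q 1, \<dots>, q d)\<close>. Zero probability parameters are allowed, with \<open>0 ^ 0 = 1\<close>.
\<close>

definition multinomial :: "nat \<Rightarrow> nat \<Rightarrow> (nat \<Rightarrow> real) \<Rightarrow> (nat \<Rightarrow> nat) measure" where
  "multinomial n d q = point_measure (nat_vectors d)
     (\<lambda>x. if (\<Sum>l=1..d. x l) = n
          then ennreal (multinomial_coeff {1..d} x * (\<Prod>l=1..d. q l ^ x l)) else 0)"

text \<open>
  The law \<open>C N Mn(a; s, q 1, \<dots>, q d)\<close> of the sum of \<open>N\<close> i.i.d. multinomial vectors independent of
  \<open>N\<close>. The law \<open>\<nu>\<close> of \<open>N\<close> plays the role of its parameter vector \<open>a\<close>; the summands and \<open>N\<close> are
  realised on the canonical product space.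
\<close>

definition compound_multinomial ::
  "nat measure \<Rightarrow> nat \<Rightarrow> nat \<Rightarrow> (nat \<Rightarrow> real) \<Rightarrow> (nat \<Rightarrow> nat) measure" where
  "compound_multinomial \<nu> s d q =
     distr (\<nu> \<Otimes>\<^sub>M (\<Pi>\<^sub>M t\<in>{1..}. multinomial s d q)) (count_space (nat_vectors d))
       (\<lambda>(n, y). \<lambda>l\<in>{1..d}. \<Sum>t=1..n. y t l)"

text \<open>
  Independence of two random variables with values in spaces of different types; the library
  constant \<open>indep_var\<close> requires both target spaces to have the same type.
\<close>

definition indep_rvs ::
  "'a measure \<Rightarrow> 'b measure \<Rightarrow> ('a \<Rightarrow> 'b) \<Rightarrow> 'c measure \<Rightarrow> ('a \<Rightarrow> 'c) \<Rightarrow> bool" where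
  "indep_rvs M S \<xi> T \<eta> \<longleftrightarrow> \<xi> \<in> measurable M S \<and> \<eta> \<in> measurable M T \<and>
     prob_space.indep_set M {\<xi> -` A \<inter> space M |A. A \<in> sets S} {\<eta> -` B \<inter> space M |B. B \<in> sets T}"

text \<open>
  Probability generating functions. They are meaningful only at arguments where the integrand is
  integrable. The conditional version \<open>E(z ^ \<xi> | A)\<close> is obtained by
  instantiating the measure to \<open>uniform_measure M A\<close>.
\<close>

definition pgf :: "'a measure \<Rightarrow> ('a \<Rightarrow> nat) \<Rightarrow> real \<Rightarrow> real" where
  "pgf M \<xi> z = (\<integral>\<omega>. z ^ \<xi> \<omega> \<partial>M)"

definition joint_pgf ::
  "'a measure \<Rightarrow> 'i set \<Rightarrow> ('i \<Rightarrow> 'a \<Rightarrow> nat) \<Rightarrow> ('i \<Rightarrow> real) \<Rightarrow> real" where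
  "joint_pgf M I \<xi> z = (\<integral>\<omega>. (\<Prod>l\<in>I. z l ^ \<xi> l \<omega>) \<partial>M)"

definition pgf_exists :: "'a measure \<Rightarrow> ('a \<Rightarrow> nat) \<Rightarrow> real \<Rightarrow> bool" where
  "pgf_exists M \<xi> z \<longleftrightarrow> integrable M (\<lambda>\<omega>. z ^ \<xi> \<omega>)"

definition joint_pgf_exists ::
  "'a measure \<Rightarrow> 'i set \<Rightarrow> ('i \<Rightarrow> 'a \<Rightarrow> nat) \<Rightarrow> ('i \<Rightarrow> real) \<Rightarrow> bool" where
  "joint_pgf_exists M I \<xi> z \<longleftrightarrow> integrable M (\<lambda>\<omega>. \<Prod>l\<in>I. z l ^ \<xi> l \<omega>)"

abbreviation mean :: "'a measure \<Rightarrow> ('a \<Rightarrow> nat) \<Rightarrow> real" where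
  "mean M \<xi> \<equiv> prob_space.expectation M (\<lambda>\<omega>. real (\<xi> \<omega>))"

abbreviation var :: "'a measure \<Rightarrow> ('a \<Rightarrow> nat) \<Rightarrow> real" where
  "var M \<xi> \<equiv> prob_space.variance M (\<lambda>\<omega>. real (\<xi> \<omega>))"

definition cov :: "'a measure \<Rightarrow> ('a \<Rightarrow> nat) \<Rightarrow> ('a \<Rightarrow> nat) \<Rightarrow> real" where
  "cov M \<xi> \<eta> = (\<integral>\<omega>. (real (\<xi> \<omega>) - mean M \<xi>) * (real (\<eta> \<omega>) - mean M \<eta>) \<partial>M)"

definition cor :: "'a measure \<Rightarrow> ('a \<Rightarrow> nat) \<Rightarrow> ('a \<Rightarrow> nat) \<Rightarrow> real" where
  "cor M \<xi> \<eta> = cov M \<xi> \<eta> / sqrt (var M \<xi> * var M \<eta>)"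

definition fisher_index :: "'a measure \<Rightarrow> ('a \<Rightarrow> nat) \<Rightarrow> real" where
  "fisher_index M \<xi> = var M \<xi> / mean M \<xi>"

end

theory Submission
  imports Defs
begin

text \<open>
  An \<open>Mn(s; p)\<close> vector counts the letters of a word of \<open>s\<close> letters drawn independently with
  probabilities \<open>p\<close>. Adding \<open>N\<close> independent such vectors amounts to concatenating \<open>N\<close> independent
  words, so \<open>X\<close> counts the letters of one word with independent letters and the random length
  \<open>L = s N\<close>, where the letters are independent of the length. This single fact carries the whole theorem. The
  locale \<open>counts_of_random_word\<close> states it as an identity for joint probabilities, and
  \<open>random_multinomial_sum_law\<close> establishes it by passing to the canonical product space, on which
  \<open>nn_integral_multinomial_sum\<close> integrates out one summand after the other.

  What remains is to compute with words of a fixed length and then to sum over the values of \<open>L\<close>.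
  For words, drawing the first letter gives recursions in the length, from which two identities
  follow by induction. \<open>expectation_letter_counts\<close> evaluates the expectation of a product of letter
  weights on the event that some letters have prescribed counts; it contains the
  multinomial formula, the generating function \<open>(p 1 * z 1 + \<dots> + p k * z k) ^ n\<close> and their
  mixture needed for conditional generating functions. \<open>expectation_size_bias\<close> removes one
  occurrence of a letter and gives the first and second moments, also on the event that another
  count is prescribed.

  The sum over the length is \<open>expectation_by_length\<close>: the integral of \<open>f(X)\<close> equals the integral
  of \<open>e(L)\<close>, where \<open>e n\<close> is the expectation of \<open>f\<close> for words of length \<open>n\<close>, and it equals the series
  of the \<open>e n\<close> weighted by \<open>P(L = n)\<close>. Integrability passes from \<open>f(X)\<close> to \<open>e(L)\<close>,
  because averaging over a fibre of \<open>L\<close> cannot increase the integral of the absolute value; so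
  the generating function of the length exists wherever that of the counts does. Prescribing counts with sum \<open>S\<close> kills the terms with \<open>n < S\<close>, and
  reindexing by the remaining length \<open>m = n - S\<close> produces the series in the theorem.
\<close>

section \<open>Letter counts of a word with independent letters\<close>

text \<open>
  The sum over all words of length \<open>n\<close> in which each letter \<open>l\<close> of \<open>A\<close> occurs \<open>a l\<close> times, where a
  letter \<open>l\<close> of \<open>A\<close> contributes the factor \<open>u l\<close> and the remaining letters together contribute
  \<open>r\<close> per position. The weights need not be probabilities: generating functions put \<open>p l * z l\<close> for \<open>u l\<close>.
\<close>

definition count_weight :: "'i set \<Rightarrow> ('i \<Rightarrow> real) \<Rightarrow> real \<Rightarrow> nat \<Rightarrow> ('i \<Rightarrow> nat) \<Rightarrow> real" where
  "count_weight A u r n a = (if (\<Sum>l\<in>A. a l) \<le> n then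
     fact n / ((\<Prod>l\<in>A. fact (a l)) * fact (n - (\<Sum>l\<in>A. a l))) * (\<Prod>l\<in>A. u l ^ a l) *
     r ^ (n - (\<Sum>l\<in>A. a l)) else 0)"

text \<open>
  Double counting of words of length \<open>n + 1\<close> with one marked position. In this lemma the mark is
  at a letter \<open>l\<close> in \<open>A\<close>, for which a word offers \<open>a l\<close> positions; in the next one it is at a letter outside \<open>A\<close>.
  Conversely, the marked letter is inserted at one of \<open>n + 1\<close> positions of a word of length \<open>n\<close>.
\<close>

lemma count_weight_decr:
  assumes A: "finite A" "l \<in> A" and S: "(\<Sum>l\<in>A. a l) \<le> Suc n" and pos: "a l > 0"
  shows "real (Suc n) * (u l * count_weight A u r n (a(l := a l - 1))) =
    real (a l) * count_weight A u r (Suc n) a"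
proof -
  obtain b where b: "a l = Suc b" using pos gr0_conv_Suc by blast
  let ?S = "\<Sum>l\<in>A - {l}. a l" and ?F = "\<Prod>l\<in>A - {l}. fact (a l) :: real"
  let ?U = "\<Prod>l\<in>A - {l}. u l ^ a l"
  have F0: "?F \<noteq> 0" by (simp add: A)
  have sums: "(\<Sum>m\<in>A. a m) = Suc b + ?S" "(\<Sum>m\<in>A. (a(l := b)) m) = b + ?S"
    using A b by (simp_all add: sum.remove)
  have facts: "(\<Prod>m\<in>A. fact (a m)) = fact (Suc b) * ?F"
      "(\<Prod>m\<in>A. fact ((a(l := b)) m)) = fact b * ?F"
    using A b by (simp_all add: prod.remove)
  have pows: "(\<Prod>m\<in>A. u m ^ a m) = u l ^ Suc b * ?U"
      "(\<Prod>m\<in>A. u m ^ (a(l := b)) m) = u l ^ b * ?U"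
    using A b by (simp_all add: prod.remove)
  have le: "b + ?S \<le> n" and sub: "Suc n - (Suc b + ?S) = n - (b + ?S)"
    using S sums by simp_all
  have "real (Suc n) * (u l * count_weight A u r n (a(l := b))) =
      real (Suc n) * (u l * (fact n / (fact b * ?F * fact (n - (b + ?S))) * (u l ^ b * ?U) * r ^ (n - (b + ?S))))"
    using le unfolding count_weight_def sums facts pows by simp
  also have "\<dots> = real (Suc b) * (fact (Suc n) / (fact (Suc b) * ?F * fact (n - (b + ?S))) *
      (u l ^ Suc b * ?U) * r ^ (n - (b + ?S)))"
    using F0 by (simp add: divide_simps del: of_nat_Suc)
  also have "\<dots> = real (a l) * count_weight A u r (Suc n) a"
    using le sub b unfolding count_weight_def sums facts pows by simp
  finally show ?thesis using b by simp
qed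

lemma count_weight_other:
  assumes "(\<Sum>l\<in>A. a l) \<le> Suc n"
  shows "real (Suc n) * (r * count_weight A u r n a) =
    real (Suc n - (\<Sum>l\<in>A. a l)) * count_weight A u r (Suc n) a"
proof (cases "(\<Sum>l\<in>A. a l) \<le> n")
  case True
  then obtain m where "n = (\<Sum>l\<in>A. a l) + m" using le_Suc_ex by blast
  then show ?thesis
    by (simp add: count_weight_def Suc_diff_le divide_simps del: of_nat_Suc)
next
  case False
  then show ?thesis using assms by (simp add: count_weight_def)
qed

text \<open>
  The Pascal rule for multinomial coefficients: the first letter either lies outside \<open>A\<close> or is
  some \<open>l\<close> in \<open>A\<close> whose prescribed count is then lowered by one. In the two preceding
  lemmas the numbers of positions for the mark add up to \<open>n + 1\<close>, which then cancels.
\<close>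

lemma count_weight_Suc:
  assumes A: "finite A"
  shows "count_weight A u r (Suc n) a = r * count_weight A u r n a +
    (\<Sum>l\<in>A. if a l > 0 then u l * count_weight A u r n (a(l := a l - 1)) else 0)"
    (is "_ = ?rhs")
proof (cases "(\<Sum>l\<in>A. a l) \<le> Suc n")
  case True
  have "real (Suc n) * ?rhs = real (Suc n - (\<Sum>l\<in>A. a l)) * count_weight A u r (Suc n) a +
      (\<Sum>l\<in>A. real (Suc n) * (if a l > 0 then u l * count_weight A u r n (a(l := a l - 1)) else 0))"
    using count_weight_other[OF True] by (simp add: distrib_left sum_distrib_left del: of_nat_Suc)
  also have "(\<Sum>l\<in>A. real (Suc n) * (if a l > 0 then u l * count_weight A u r n (a(l := a l - 1)) else 0))
      = (\<Sum>l\<in>A. real (a l) * count_weight A u r (Suc n) a)"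
    using count_weight_decr[OF A _ True] by (intro sum.cong refl) (auto simp del: of_nat_Suc)
  also have "\<dots> = real (\<Sum>l\<in>A. a l) * count_weight A u r (Suc n) a"
    by (simp add: sum_distrib_right)
  finally have "real (Suc n) * ?rhs = real (Suc n) * count_weight A u r (Suc n) a"
    using True by (simp add: of_nat_diff algebra_simps del: of_nat_Suc of_nat_sum)
  then show ?thesis by (simp del: of_nat_Suc)
next
  case False
  have "count_weight A u r n (a(l := a l - 1)) = 0" if "l \<in> A" "a l > 0" for l
  proof -
    have "(\<Sum>m\<in>A. a m) = a l + (\<Sum>m\<in>A - {l}. a m)"
         "(\<Sum>m\<in>A. (a(l := a l - 1)) m) = a l - 1 + (\<Sum>m\<in>A - {l}. a m)"
      using A that by (simp_all add: sum.remove)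
    then show ?thesis using False that by (simp add: count_weight_def)
  qed
  then have "(\<Sum>l\<in>A. if a l > 0 then u l * count_weight A u r n (a(l := a l - 1)) else 0) = 0"
    by (intro sum.neutral) auto
  then show ?thesis using False by (simp add: count_weight_def)
qed

lemma count_weight_full:
  "count_weight A u 0 n a =
    (if (\<Sum>l\<in>A. a l) = n then fact n / (\<Prod>l\<in>A. fact (a l)) * (\<Prod>l\<in>A. u l ^ a l) else 0)"
  by (auto simp: count_weight_def)

lemma count_weight_single:
  "count_weight {i} u r n (\<lambda>_. m) = real (n choose m) * u i ^ m * r ^ (n - m)"
  by (auto simp: count_weight_def binomial_fact)

lemma finite_set_replicate_pmf:
  assumes "finite (set_pmf c)"
  shows "finite (set_pmf (replicate_pmf n c))"
  using assms by (simp add: set_replicate_pmf finite_lists_length_eq lists_eq_set)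

lemma expectation_replicate_pmf_Suc:
  fixes g :: "'i list \<Rightarrow> real"
  assumes "finite I" "set_pmf c \<subseteq> I"
  shows "measure_pmf.expectation (replicate_pmf (Suc n) c) g =
    (\<Sum>l\<in>I. pmf c l * measure_pmf.expectation (replicate_pmf n c) (\<lambda>w. g (l # w)))"
proof -
  have "finite (set_pmf c)" using assms(2,1) by (rule finite_subset)
  then have "finite (set_pmf (replicate_pmf n c))" by (rule finite_set_replicate_pmf)
  then show ?thesis using assms
    by (simp add: pmf_expectation_bind[of I] map_pmf_def[symmetric])
qed

text \<open>
  Drawing the first letter gives the same recursion for both sides. The factor \<open>\<zeta>\<close> covers three uses
  at once: \<open>\<zeta> = 1\<close> gives probabilities, \<open>A = {}\<close> gives generating functions, and
  the general case gives generating functions on an event that prescribes counts.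
\<close>

lemma expectation_letter_counts:
  fixes \<zeta> :: "'i \<Rightarrow> real"
  assumes I: "finite I" "set_pmf c \<subseteq> I" "A \<subseteq> I"
  shows "measure_pmf.expectation (replicate_pmf n c)
      (\<lambda>w. prod_list (map \<zeta> w) * of_bool (\<forall>l\<in>A. count_list w l = a l)) =
    count_weight A (\<lambda>l. pmf c l * \<zeta> l) (\<Sum>l\<in>I - A. pmf c l * \<zeta> l) n a"
proof -
  define P where "P a = (\<lambda>w. prod_list (map \<zeta> w) * of_bool (\<forall>l\<in>A. count_list w l = a l))" for a
  define E :: "nat \<Rightarrow> ('i list \<Rightarrow> real) \<Rightarrow> real" where
    "E n = measure_pmf.expectation (replicate_pmf n c)" for n
  define W where "W = count_weight A (\<lambda>l. pmf c l * \<zeta> l) (\<Sum>l\<in>I - A. pmf c l * \<zeta> l)"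
  have A: "finite A" using I(3,1) by (rule finite_subset)
  have E_scale: "E n (\<lambda>w. r * g w) = r * E n g" for n r g
    by (simp add: E_def)
  have P_out: "P a (l # w) = \<zeta> l * P a w" if "l \<notin> A" for a l w
  proof -
    have "(\<forall>m\<in>A. count_list (l # w) m = a m) \<longleftrightarrow> (\<forall>m\<in>A. count_list w m = a m)"
      using that by (intro ball_cong refl) auto
    then show ?thesis by (simp add: P_def del: count_list.simps)
  qed
  have P_in: "P a (l # w) = (if a l > 0 then \<zeta> l * P (a(l := a l - 1)) w else 0)" if "l \<in> A" for a l w
  proof (cases "a l > 0")
    case True
    have "(\<forall>m\<in>A. count_list (l # w) m = a m) \<longleftrightarrow>
        (\<forall>m\<in>A. count_list w m = (a(l := a l - 1)) m)"
      using that True by (intro ball_cong refl) auto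
    then show ?thesis using True by (simp add: P_def del: count_list.simps fun_upd_apply)
  next
    case False
    have "count_list (l # w) l \<noteq> a l" using False by simp
    then have "\<not> (\<forall>m\<in>A. count_list (l # w) m = a m)"
      using that by blast
    then show ?thesis using False by (simp add: P_def del: count_list.simps)
  qed
  have "E n (P a) = W n a"
  proof (induction n arbitrary: a)
    case 0
    show ?case
    proof (cases "\<forall>l\<in>A. a l = 0")
      case True
      then show ?thesis by (simp add: E_def P_def W_def count_weight_def)
    next
      case False
      then obtain l where "l \<in> A" "0 \<noteq> a l" by auto
      then have "\<not> (\<forall>l\<in>A. 0 = a l)" by blast
      then show ?thesis using False A by (simp add: E_def P_def W_def count_weight_def)
    qed
  next
    case (Suc n)
    have "E (Suc n) (P a) = (\<Sum>l\<in>I. pmf c l * E n (\<lambda>w. P a (l # w)))"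
      unfolding E_def using I(1,2) by (rule expectation_replicate_pmf_Suc)
    also have "\<dots> = (\<Sum>l\<in>I - A. pmf c l * E n (\<lambda>w. P a (l # w))) +
        (\<Sum>l\<in>A. pmf c l * E n (\<lambda>w. P a (l # w)))"
      using I(3,1) by (rule sum.subset_diff)
    also have "(\<Sum>l\<in>I - A. pmf c l * E n (\<lambda>w. P a (l # w))) = (\<Sum>l\<in>I - A. pmf c l * \<zeta> l) * W n a"
      unfolding sum_distrib_right
    proof (intro sum.cong refl)
      fix l assume "l \<in> I - A"
      then have "E n (\<lambda>w. P a (l # w)) = \<zeta> l * E n (P a)"
        by (simp add: P_out E_scale)
      then show "pmf c l * E n (\<lambda>w. P a (l # w)) = pmf c l * \<zeta> l * W n a"
        by (simp add: Suc.IH)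
    qed
    also have "(\<Sum>l\<in>A. pmf c l * E n (\<lambda>w. P a (l # w))) =
        (\<Sum>l\<in>A. if a l > 0 then pmf c l * \<zeta> l * W n (a(l := a l - 1)) else 0)"
    proof (intro sum.cong refl)
      fix l assume l: "l \<in> A"
      show "pmf c l * E n (\<lambda>w. P a (l # w)) =
          (if a l > 0 then pmf c l * \<zeta> l * W n (a(l := a l - 1)) else 0)"
      proof (cases "a l > 0")
        case True
        then have "E n (\<lambda>w. P a (l # w)) = \<zeta> l * E n (P (a(l := a l - 1)))"
          using l by (simp add: P_in E_scale)
        then show ?thesis using True by (simp add: Suc.IH del: fun_upd_apply)
      next
        case False
        then show ?thesis using l by (simp add: P_in E_def)
      qed
    qed
    finally show ?case unfolding W_def count_weight_Suc[OF A] .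
  qed
  then show ?thesis by (simp add: E_def P_def W_def)
qed

text \<open>
  Size biasing: \<open>count_list w i\<close> sums over the positions holding \<open>i\<close>. By exchangeability each of the
  \<open>n\<close> positions contributes \<open>pmf c i\<close> times the expectation in which that position is fixed to be
  \<open>i\<close> and the other \<open>n - 1\<close> letters are random. For \<open>n = 0\<close> both sides vanish, so truncated
  subtraction does no harm.
\<close>

lemma expectation_size_bias:
  fixes g :: "('i \<Rightarrow> nat) \<Rightarrow> real"
  assumes I: "finite I" "set_pmf c \<subseteq> I" and i: "i \<in> I"
  shows "measure_pmf.expectation (replicate_pmf n c) (\<lambda>w. real (count_list w i) * g (count_list w)) =
    real n * pmf c i * measure_pmf.expectation (replicate_pmf (n - 1) c)
      (\<lambda>w. g ((count_list w)(i := Suc (count_list w i))))"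
proof (induction n arbitrary: g)
  case 0
  show ?case by simp
next
  case (Suc n)
  let ?E = "\<lambda>n. measure_pmf.expectation (replicate_pmf n c)"
  let ?inc = "\<lambda>l (x :: 'i \<Rightarrow> nat). x(l := Suc (x l))"
  have fin: "finite (set_pmf (replicate_pmf m c))" for m
    using finite_set_replicate_pmf I finite_subset by metis
  note int = integrable_measure_pmf_finite[OF fin]
  have cnt: "count_list (l # w) = ?inc l (count_list w)" for l w
    by auto
  have step: "?E n (\<lambda>w. real (count_list (l # w) i) * g (count_list (l # w))) =
      of_bool (l = i) * ?E n (\<lambda>w. g (?inc i (count_list w))) +
      real n * pmf c i * ?E (n - 1) (\<lambda>w. g (?inc l (?inc i (count_list w))))" for l
  proof -
    have "?E n (\<lambda>w. real (count_list (l # w) i) * g (count_list (l # w))) =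
        ?E n (\<lambda>w. of_bool (l = i) * g (?inc i (count_list w)) +
          real (count_list w i) * g (?inc l (count_list w)))"
      unfolding cnt by (intro Bochner_Integration.integral_cong refl) (simp add: algebra_simps)
    also have "\<dots> = of_bool (l = i) * ?E n (\<lambda>w. g (?inc i (count_list w))) +
        ?E n (\<lambda>w. real (count_list w i) * g (?inc l (count_list w)))"
      by (subst Bochner_Integration.integral_add) (simp_all add: int)
    also have "?E n (\<lambda>w. real (count_list w i) * g (?inc l (count_list w))) =
        real n * pmf c i * ?E (n - 1) (\<lambda>w. g (?inc l (?inc i (count_list w))))"
      by (rule Suc)
    finally show ?thesis .
  qed
  \<comment> \<open>The first letter l and the letter i fixed at another position commute; prepending l to the n - 1 remaining letters makes a random word of length n.\<close>
  have last: "real n * (\<Sum>l\<in>I. pmf c l * ?E (n - 1) (\<lambda>w. g (?inc l (?inc i (count_list w))))) =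
      real n * ?E n (\<lambda>w. g (?inc i (count_list w)))"
  proof (cases n)
    case (Suc m)
    have "(?inc l (?inc i (count_list w))) = ?inc i (count_list (l # w))" for l w
      by auto
    then show ?thesis
      unfolding Suc by (subst expectation_replicate_pmf_Suc[OF I]) simp
  qed simp
  have "?E (Suc n) (\<lambda>w. real (count_list w i) * g (count_list w)) =
      (\<Sum>l\<in>I. pmf c l * ?E n (\<lambda>w. real (count_list (l # w) i) * g (count_list (l # w))))"
    by (rule expectation_replicate_pmf_Suc[OF I])
  also have "\<dots> = (\<Sum>l\<in>I. pmf c l * (of_bool (l = i) * ?E n (\<lambda>w. g (?inc i (count_list w))))) +
      (\<Sum>l\<in>I. pmf c l * (real n * pmf c i * ?E (n - 1) (\<lambda>w. g (?inc l (?inc i (count_list w))))))"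
    unfolding step by (simp add: distrib_left sum.distrib)
  also have "(\<Sum>l\<in>I. pmf c l * (of_bool (l = i) * ?E n (\<lambda>w. g (?inc i (count_list w))))) =
      pmf c i * ?E n (\<lambda>w. g (?inc i (count_list w)))"
    using I i by (simp add: of_bool_def if_distrib if_distribR cong: if_cong)
  also have "(\<Sum>l\<in>I. pmf c l * (real n * pmf c i * ?E (n - 1) (\<lambda>w. g (?inc l (?inc i (count_list w)))))) =
      pmf c i * (real n * (\<Sum>l\<in>I. pmf c l * ?E (n - 1) (\<lambda>w. g (?inc l (?inc i (count_list w))))))"
    unfolding sum_distrib_left by (intro sum.cong refl) (simp add: mult_ac)
  also note last
  finally show ?case
    by (simp only: distrib_right distrib_left of_nat_Suc mult_1 mult_ac diff_Suc_1)
qed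

lemma prod_power_count_list:
  assumes "finite A"
  shows "(\<Prod>l\<in>A. z l ^ count_list w l) = prod_list (map (\<lambda>l. if l \<in> A then z l else 1) w)"
proof (induction w)
  case (Cons x w)
  have "(\<Prod>l\<in>A. z l ^ count_list (x # w) l) = (\<Prod>l\<in>A. (if l = x then z x else 1) * z l ^ count_list w l)"
    by (intro prod.cong) auto
  then show ?case using assms Cons by (simp add: prod.distrib)
qed simp

section \<open>Sums of multinomial vectors\<close>

lemma exists_pmf_finite_support:
  fixes q :: "'i \<Rightarrow> real"
  assumes "finite I" "\<And>l. l \<in> I \<Longrightarrow> 0 \<le> q l" "(\<Sum>l\<in>I. q l) = 1"
  obtains c where "\<And>l. l \<in> I \<Longrightarrow> pmf c l = q l" "set_pmf c \<subseteq> I"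
proof
  let ?f = "\<lambda>l. if l \<in> I then q l else 0"
  have "(\<integral>\<^sup>+l. ennreal (?f l) \<partial>count_space UNIV) = (\<Sum>l\<in>I. ennreal (?f l))"
    using assms(1) by (intro nn_integral_count_space') auto
  also have "\<dots> = 1" using assms by (simp add: sum_ennreal)
  finally have pmf: "pmf (embed_pmf ?f) l = ?f l" for l
    using assms(2) by (intro pmf_embed_pmf) auto
  then show "pmf (embed_pmf ?f) l = q l" if "l \<in> I" for l
    using that by simp
  show "set_pmf (embed_pmf ?f) \<subseteq> I"
    by (auto simp: set_pmf_eq pmf split: if_splits)
qed

lemma prob_letter_counts:
  assumes "finite I" "set_pmf c \<subseteq> I" "A \<subseteq> I"
  shows "measure_pmf.prob (replicate_pmf n c) {w. \<forall>l\<in>A. count_list w l = a l} =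
    count_weight A (pmf c) (1 - (\<Sum>l\<in>A. pmf c l)) n a"
proof -
  have "measure_pmf.prob (replicate_pmf n c) {w. \<forall>l\<in>A. count_list w l = a l} =
      measure_pmf.expectation (replicate_pmf n c) (indicator {w. \<forall>l\<in>A. count_list w l = a l})"
    by simp
  also have "\<dots> = measure_pmf.expectation (replicate_pmf n c)
      (\<lambda>w. prod_list (map (\<lambda>_. 1) w) * of_bool (\<forall>l\<in>A. count_list w l = a l))"
    by (intro Bochner_Integration.integral_cong refl) (auto simp: indicator_def map_replicate_const)
  also have "\<dots> = count_weight A (\<lambda>l. pmf c l * 1) (\<Sum>l\<in>I - A. pmf c l * 1) n a"
    using assms by (rule expectation_letter_counts)
  also have "(\<Sum>l\<in>I - A. pmf c l * 1) = 1 - (\<Sum>l\<in>A. pmf c l)"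
    using assms by (simp add: sum_diff sum_pmf_eq_1)
  finally show ?thesis by simp
qed

lemma countable_nat_vectors: "countable (nat_vectors d)"
  unfolding nat_vectors_def by (intro countable_PiE) auto

text \<open>
  The bridge from the density that defines the multinomial law to words.
\<close>

lemma multinomial_eq_distr_replicate_pmf:
  assumes c: "\<And>l. l \<in> {1..d} \<Longrightarrow> pmf c l = q l" "set_pmf c \<subseteq> {1..d}"
  shows "multinomial n d q = distr (measure_pmf (replicate_pmf n c)) (count_space (nat_vectors d))
    (\<lambda>w. \<lambda>l\<in>{1..d}. count_list w l)" (is "_ = ?R")
proof (rule measure_eqI_countable[OF _ _ countable_nat_vectors])
  show "sets (multinomial n d q) = Pow (nat_vectors d)"
    by (simp add: multinomial_def sets_point_measure)
  show "sets ?R = Pow (nat_vectors d)" by simp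
  fix x assume x: "x \<in> nat_vectors d"
  have one: "(\<Sum>l=1..d. pmf c l) = 1"
    using c(2) by (intro sum_pmf_eq_1) auto
  have "(\<lambda>w. \<lambda>l\<in>{1..d}. count_list w l) -` {x} = {w. \<forall>l\<in>{1..d}. count_list w l = x l}"
    using x by (auto simp: nat_vectors_def fun_eq_iff PiE_def extensional_def restrict_def)
  then have "emeasure ?R {x} =
      ennreal (measure_pmf.prob (replicate_pmf n c) {w. \<forall>l\<in>{1..d}. count_list w l = x l})"
    using x by (subst emeasure_distr) (auto simp: nat_vectors_def measure_pmf.emeasure_eq_measure)
  also have "measure_pmf.prob (replicate_pmf n c) {w. \<forall>l\<in>{1..d}. count_list w l = x l} =
      count_weight {1..d} (pmf c) 0 n x"
    unfolding prob_letter_counts[OF finite_atLeastAtMost c(2) order_refl] one by simp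
  also have "ennreal \<dots> = emeasure (multinomial n d q) {x}"
    unfolding multinomial_def using x
    by (subst emeasure_point_measure_finite2)
       (auto simp: count_weight_full multinomial_coeff_def c(1) intro!: arg_cong[where f=ennreal])
  finally show "emeasure (multinomial n d q) {x} = emeasure ?R {x}" ..
qed

lemma prob_space_multinomial:
  assumes c: "\<And>l. l \<in> {1..d} \<Longrightarrow> pmf c l = q l" "set_pmf c \<subseteq> {1..d}"
  shows "prob_space (multinomial n d q)"
proof -
  have "prob_space (distr (measure_pmf (replicate_pmf n c)) (count_space (nat_vectors d))
      (\<lambda>w. \<lambda>l\<in>{1..d}. count_list w l))"
    by (intro measure_pmf.prob_space_distr) (auto simp: nat_vectors_def)
  moreover have "multinomial n d q = distr (measure_pmf (replicate_pmf n c)) (count_space (nat_vectors d))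
      (\<lambda>w. \<lambda>l\<in>{1..d}. count_list w l)"
    using c by (rule multinomial_eq_distr_replicate_pmf)
  ultimately show ?thesis by simp
qed

lemma measurable_sum_nat [measurable (raw)]:
  fixes f :: "'i \<Rightarrow> 'a \<Rightarrow> nat"
  assumes "\<And>i. i \<in> T \<Longrightarrow> f i \<in> measurable M (count_space UNIV)"
  shows "(\<lambda>x. \<Sum>i\<in>T. f i x) \<in> measurable M (count_space UNIV)"
  using assms
proof (induction T rule: infinite_finite_induct)
  case (insert i T)
  then have [measurable]: "f i \<in> measurable M (count_space UNIV)"
    "(\<lambda>x. \<Sum>i\<in>T. f i x) \<in> measurable M (count_space UNIV)" by auto
  show ?case using insert(1,2) by simp
qed simp_all

lemma sets_multinomial [measurable_cong]: "sets (multinomial n d q) = sets (count_space (nat_vectors d))"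
  by (simp add: multinomial_def sets_point_measure_count_space)

lemma measurable_vector_component:
  assumes "t \<in> J"
  shows "(\<lambda>y. y t l) \<in> measurable (\<Pi>\<^sub>M t\<in>J. multinomial s d q) (count_space UNIV)"
proof -
  have "(\<lambda>v. v l) \<in> measurable (multinomial s d q) (count_space UNIV)"
    by (subst measurable_cong_sets[OF sets_multinomial refl]) simp
  from measurable_compose[OF measurable_component_singleton[OF assms] this]
  show ?thesis .
qed

text \<open>
  The target is countable, so it suffices to measure the fibres, each of which prescribes finitely
  many coordinates.
\<close>

lemma measurable_vector_sum:
  assumes "{1..m} \<subseteq> J"
  shows "(\<lambda>y. \<lambda>l\<in>{1..d}. \<Sum>t=1..m. y t l) \<in>
    measurable (\<Pi>\<^sub>M t\<in>J. multinomial s d q) (count_space (nat_vectors d))"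
  unfolding measurable_count_space_eq_countable[OF countable_nat_vectors]
proof safe
  let ?M = "\<Pi>\<^sub>M t\<in>J. multinomial s d q"
  fix a assume a: "a \<in> nat_vectors d"
  have [measurable]: "(\<lambda>y. \<Sum>t=1..m. y t l) \<in> measurable ?M (count_space UNIV)" for l
    using assms by (intro measurable_sum_nat measurable_vector_component) auto
  have "(\<lambda>y. \<lambda>l\<in>{1..d}. \<Sum>t=1..m. y t l) -` {a} \<inter> space ?M =
      {y \<in> space ?M. \<forall>l\<in>{1..d}. (\<Sum>t=1..m. y t l) = a l}"
    using a by (auto simp: nat_vectors_def fun_eq_iff PiE_def extensional_def restrict_def)
  also have "\<dots> \<in> sets ?M" by measurable
  finally show "(\<lambda>y. \<lambda>l\<in>{1..d}. \<Sum>t=1..m. y t l) -` {a} \<inter> space ?M \<in> sets ?M" .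
qed (auto simp: nat_vectors_def)

text \<open>
  Adding count vectors is concatenating words. Integrating out the last summand appends \<open>s\<close>
  independent letters to a word of length \<open>m * s\<close>. Stating the identity for all nonnegative \<open>f\<close>
  lets the induction hypothesis absorb the inner integral.
\<close>

lemma nn_integral_multinomial_sum:
  assumes c: "\<And>l. l \<in> {1..d} \<Longrightarrow> pmf c l = q l" "set_pmf c \<subseteq> {1..d}"
  shows "(\<integral>\<^sup>+y. f (\<lambda>l\<in>{1..d}. \<Sum>t=1..m. y t l) \<partial>(\<Pi>\<^sub>M t\<in>{1..m}. multinomial s d q)) =
    (\<integral>\<^sup>+w. f (\<lambda>l\<in>{1..d}. count_list w l) \<partial>replicate_pmf (m * s) c)"
proof (induction m arbitrary: f)
  case 0
  show ?case by (simp add: PiM_empty nn_integral_count_space_finite cong: if_cong)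
next
  case (Suc m)
  have eq: "multinomial s d q = distr (measure_pmf (replicate_pmf s c)) (count_space (nat_vectors d))
      (\<lambda>w. \<lambda>l\<in>{1..d}. count_list w l)"
    using c by (rule multinomial_eq_distr_replicate_pmf)
  have meas: "(\<lambda>w. \<lambda>l\<in>{1..d}. count_list w l) \<in>
      measurable (measure_pmf (replicate_pmf s c)) (count_space (nat_vectors d))"
    by (auto simp: nat_vectors_def)
  have "prob_space (multinomial s d q)"
    using c by (rule prob_space_multinomial)
  then interpret product_prob_space "\<lambda>_. multinomial s d q" "{1..m}"
    by (simp add: product_prob_space_def product_sigma_finite_def product_prob_space_axioms_def
        prob_space_imp_sigma_finite)
  have fin: "{1..Suc m} = insert (Suc m) {1..m}" by auto
  have "(\<integral>\<^sup>+y. f (\<lambda>l\<in>{1..d}. \<Sum>t=1..Suc m. y t l) \<partial>(\<Pi>\<^sub>M t\<in>{1..Suc m}. multinomial s d q)) =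
      (\<integral>\<^sup>+x. \<integral>\<^sup>+b. f (\<lambda>l\<in>{1..d}. \<Sum>t=1..Suc m. (x(Suc m := b)) t l) \<partial>multinomial s d q
        \<partial>(\<Pi>\<^sub>M t\<in>{1..m}. multinomial s d q))"
    unfolding fin
  proof (rule product_nn_integral_insert)
    have "(\<lambda>y. \<lambda>l\<in>{1..d}. \<Sum>t=1..Suc m. y t l) \<in>
        measurable (\<Pi>\<^sub>M t\<in>{1..Suc m}. multinomial s d q) (count_space (nat_vectors d))"
      by (rule measurable_vector_sum) simp
    from measurable_compose[OF this, of f borel]
    show "(\<lambda>y. f (\<lambda>l\<in>{1..d}. \<Sum>t\<in>insert (Suc m) {1..m}. y t l)) \<in>
        borel_measurable (\<Pi>\<^sub>M t\<in>insert (Suc m) {1..m}. multinomial s d q)"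
      unfolding fin by simp
  qed auto
  also have "\<dots> = (\<integral>\<^sup>+x. (\<lambda>v. \<integral>\<^sup>+b. f (\<lambda>l\<in>{1..d}. v l + b l) \<partial>multinomial s d q)
      (\<lambda>l\<in>{1..d}. \<Sum>t=1..m. x t l) \<partial>(\<Pi>\<^sub>M t\<in>{1..m}. multinomial s d q))"
    by (intro nn_integral_cong arg_cong[where f=f]) (auto simp: fun_eq_iff restrict_def intro!: sum.cong)
  also have "\<dots> = (\<integral>\<^sup>+w. (\<lambda>v. \<integral>\<^sup>+b. f (\<lambda>l\<in>{1..d}. v l + b l) \<partial>multinomial s d q)
      (\<lambda>l\<in>{1..d}. count_list w l) \<partial>replicate_pmf (m * s) c)"
    by (rule Suc.IH)
  also have "\<dots> = (\<integral>\<^sup>+w. \<integral>\<^sup>+u. f (\<lambda>l\<in>{1..d}. count_list (w @ u) l) \<partial>replicate_pmf s c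
      \<partial>replicate_pmf (m * s) c)"
    unfolding eq using meas
    by (intro nn_integral_cong) (simp add: nn_integral_distr cong: restrict_cong)
  also have "\<dots> = (\<integral>\<^sup>+w. f (\<lambda>l\<in>{1..d}. count_list w l) \<partial>replicate_pmf (m * s + s) c)"
    by (simp add: replicate_pmf_distrib del: count_list_append)
  finally show ?case by (simp only: mult_Suc add.commute)
qed

section \<open>Letter counts of a word of random length\<close>

text \<open>
  The vector \<open>X\<close> behaves like the letter counts of a word with independent letters and length \<open>L\<close>,
  letters and length being independent. This is a property of the joint law of \<open>L\<close> and the counts;
  it refers to words only through their distribution, not through a random word on \<open>M\<close>. The counts are restricted to \<open>I\<close> to be values in a
  countable set.
\<close>

locale counts_of_random_word = prob_space M for M :: "'a measure" +
  fixes L :: "'a \<Rightarrow> nat" and I :: "nat set" and c :: "nat pmf" and X :: "nat \<Rightarrow> 'a \<Rightarrow> nat"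
  assumes finite_letters: "finite I" and letters: "set_pmf c \<subseteq> I"
    and L_measurable [measurable]: "L \<in> measurable M (count_space UNIV)"
    and X_measurable: "\<And>l. l \<in> I \<Longrightarrow> X l \<in> measurable M (count_space UNIV)"
    and law: "\<And>n B. \<P>(\<omega> in M. L \<omega> = n \<and> (\<lambda>l\<in>I. X l \<omega>) \<in> B) =
      \<P>(\<omega> in M. L \<omega> = n) * measure_pmf.prob (replicate_pmf n c) {w. (\<lambda>l\<in>I. count_list w l) \<in> B}"

text \<open>
  On the canonical space the event \<open>s * n = m\<close> fixes the number of summands, so the event that
  prescribes the length and the vector is a rectangle and its probability is a product.
\<close>

lemma compound_multinomial_law:
  fixes d s :: nat and q :: "nat \<Rightarrow> real"
  assumes s: "s \<ge> 1" and c: "\<And>l. l \<in> {1..d} \<Longrightarrow> pmf c l = q l" "set_pmf c \<subseteq> {1..d}"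
    and \<nu>: "prob_space \<nu>" "sets \<nu> = UNIV"
  shows "counts_of_random_word (\<nu> \<Otimes>\<^sub>M (\<Pi>\<^sub>M t\<in>{1..}. multinomial s d q)) (\<lambda>(n, y). s * n) {1..d} c
    (\<lambda>l (n, y). \<Sum>t=1..n. y t l)"
proof -
  let ?\<mu> = "multinomial s d q"
  let ?Q = "\<Pi>\<^sub>M t\<in>{1::nat..}. ?\<mu>"
  have sets_\<nu> [measurable_cong]: "sets \<nu> = sets (count_space UNIV)" using \<nu>(2) by simp
  have space_\<nu>: "space \<nu> = UNIV" using sets_eq_imp_space_eq[OF sets_\<nu>] by simp
  interpret N: prob_space \<nu> by fact
  have "prob_space ?\<mu>"
    using c by (rule prob_space_multinomial)
  then interpret Q: product_prob_space "\<lambda>_. ?\<mu>" "{1::nat..}"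
    by (simp add: product_prob_space_def product_sigma_finite_def product_prob_space_axioms_def
        prob_space_imp_sigma_finite)
  have measure_times: "measure (\<nu> \<Otimes>\<^sub>M ?Q) (A \<times> B) = measure \<nu> A * measure ?Q B"
    if "A \<in> sets \<nu>" "B \<in> sets ?Q" for A B
    unfolding measure_def Q.P.emeasure_pair_measure_Times[OF that] by (rule enn2real_mult)
  interpret NQ: pair_prob_space \<nu> ?Q ..
  have sum_law: "emeasure ?Q {y \<in> space ?Q. (\<lambda>l\<in>{1..d}. \<Sum>t=1..m. y t l) \<in> B} =
      emeasure (replicate_pmf (m * s) c) {w. (\<lambda>l\<in>{1..d}. count_list w l) \<in> B}" for m B
  proof -
    let ?Qm = "\<Pi>\<^sub>M t\<in>{1..m}. ?\<mu>"
    let ?S = "\<lambda>y. \<lambda>l\<in>{1..d}. \<Sum>t=1..m. y t l"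
    have m: "(\<lambda>y. indicator B (?S y) :: ennreal) \<in> borel_measurable (PiM J (\<lambda>_. ?\<mu>))" if "{1..m} \<subseteq> J" for J
      by (rule measurable_compose[OF measurable_vector_sum[OF that]]) simp
    have S: "{y \<in> space ?Q. ?S y \<in> B} \<in> sets ?Q"
    proof -
      have "?S -` (B \<inter> nat_vectors d) \<inter> space ?Q \<in> sets ?Q"
        by (intro measurable_sets[OF measurable_vector_sum]) auto
      also have "?S -` (B \<inter> nat_vectors d) \<inter> space ?Q = {y \<in> space ?Q. ?S y \<in> B}"
        by (auto simp: nat_vectors_def)
      finally show ?thesis .
    qed
    have "emeasure ?Q {y \<in> space ?Q. ?S y \<in> B} = (\<integral>\<^sup>+y. indicator B (?S y) \<partial>?Q)"
      unfolding nn_integral_indicator[OF S, symmetric]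
      by (intro nn_integral_cong) (auto simp: indicator_def)
    also have "\<dots> = (\<integral>\<^sup>+y. indicator B (?S (restrict y {1..m})) \<partial>?Q)"
      by (intro nn_integral_cong arg_cong[where f="indicator B"]) (auto simp: fun_eq_iff restrict_def)
    also have "\<dots> = (\<integral>\<^sup>+y. indicator B (?S y) \<partial>distr ?Q ?Qm (\<lambda>y. restrict y {1..m}))"
    proof (rule nn_integral_distr[symmetric])
      show "(\<lambda>y. restrict y {1..m}) \<in> measurable ?Q ?Qm"
        by (rule measurable_restrict_subset) auto
      show "(\<lambda>y. indicator B (?S y) :: ennreal) \<in>
          borel_measurable (distr ?Q ?Qm (\<lambda>y. restrict y {1..m}))"
        unfolding measurable_distr_eq1 by (rule m) simp
    qed
    also have "distr ?Q ?Qm (\<lambda>y. restrict y {1..m}) = ?Qm"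
      by (rule Q.distr_PiM_restrict_finite) auto
    also have "(\<integral>\<^sup>+y. indicator B (?S y) \<partial>?Qm) =
        (\<integral>\<^sup>+w. indicator B (\<lambda>l\<in>{1..d}. count_list w l) \<partial>replicate_pmf (m * s) c)"
      using c by (rule nn_integral_multinomial_sum)
    also have "\<dots> = (\<integral>\<^sup>+w. indicator {w. (\<lambda>l\<in>{1..d}. count_list w l) \<in> B} w \<partial>replicate_pmf (m * s) c)"
      by (intro nn_integral_cong) (auto simp: indicator_def)
    also have "\<dots> = emeasure (replicate_pmf (m * s) c) {w. (\<lambda>l\<in>{1..d}. count_list w l) \<in> B}"
      by (rule nn_integral_indicator) simp
    finally show ?thesis .
  qed
  show ?thesis
  proof (unfold_locales; (intro finite_atLeastAtMost c(2))?)
    show "(\<lambda>(n, y). s * n) \<in> measurable (\<nu> \<Otimes>\<^sub>M ?Q) (count_space UNIV)"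
      by measurable
    show "(\<lambda>(n, y). \<Sum>t=1..n. y t l) \<in> measurable (\<nu> \<Otimes>\<^sub>M ?Q) (count_space UNIV)" for l
    proof -
      have "(\<lambda>x. (\<Sum>t=1..m. snd x t l)) \<in> measurable (\<nu> \<Otimes>\<^sub>M ?Q) (count_space UNIV)" for m
        by (intro measurable_sum_nat measurable_compose[OF measurable_snd measurable_vector_component]) auto
      then have "(\<lambda>x. (\<lambda>m x. \<Sum>t=1..m. snd x t l) (fst x) x) \<in> measurable (\<nu> \<Otimes>\<^sub>M ?Q) (count_space UNIV)"
        by (rule measurable_compose_countable) measurable
      then show ?thesis by (simp add: case_prod_beta)
    qed
    fix n :: nat and B :: "(nat \<Rightarrow> nat) set"
    \<comment> \<open>A length that is not a multiple of s has probability 0 on both sides.\<close>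
    have fib: "(s * n' = n) \<longleftrightarrow> n' = n div s \<and> s dvd n" for n' using s by auto
    let ?Sn = "\<lambda>y. \<lambda>l\<in>{1..d}. \<Sum>t=1..n div s. y t l"
    have "{x \<in> space (\<nu> \<Otimes>\<^sub>M ?Q). (case x of (n, y) \<Rightarrow> s * n) = n \<and>
          (\<lambda>l\<in>{1..d}. case x of (n, y) \<Rightarrow> \<Sum>t=1..n. y t l) \<in> B} =
        {n'. s * n' = n} \<times> {y \<in> space ?Q. ?Sn y \<in> B}"
      using s by (auto simp: space_pair_measure space_\<nu> fib cong: restrict_cong)
    moreover have "{x \<in> space (\<nu> \<Otimes>\<^sub>M ?Q). (case x of (n, y) \<Rightarrow> s * n) = n} = {n'. s * n' = n} \<times> space ?Q"
      by (auto simp: space_pair_measure space_\<nu>)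
    moreover have "measure (\<nu> \<Otimes>\<^sub>M ?Q) ({n'. s * n' = n} \<times> {y \<in> space ?Q. ?Sn y \<in> B}) =
        measure \<nu> {n'. s * n' = n} * measure ?Q {y \<in> space ?Q. ?Sn y \<in> B}"
    proof (rule measure_times)
      have "?Sn -` (B \<inter> nat_vectors d) \<inter> space ?Q \<in> sets ?Q"
        by (intro measurable_sets[OF measurable_vector_sum]) auto
      also have "?Sn -` (B \<inter> nat_vectors d) \<inter> space ?Q = {y \<in> space ?Q. ?Sn y \<in> B}"
        by (auto simp: nat_vectors_def)
      finally show "{y \<in> space ?Q. ?Sn y \<in> B} \<in> sets ?Q" .
    qed (simp add: \<nu>(2))
    moreover have "measure (\<nu> \<Otimes>\<^sub>M ?Q) ({n'. s * n' = n} \<times> space ?Q) = measure \<nu> {n'. s * n' = n}"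
      using measure_times[of "{n'. s * n' = n}" "space ?Q"] by (simp add: \<nu>(2) Q.P.prob_space del: One_nat_def)
    moreover have "measure \<nu> {n'. s * n' = n} * measure ?Q {y \<in> space ?Q. ?Sn y \<in> B} =
        measure \<nu> {n'. s * n' = n} * measure_pmf.prob (replicate_pmf n c) {w. (\<lambda>l\<in>{1..d}. count_list w l) \<in> B}"
    proof (cases "s dvd n")
      case True
      then show ?thesis using sum_law[of "n div s" B] by (simp add: measure_def)
    qed (simp add: fib)
    ultimately show "\<P>(x in \<nu> \<Otimes>\<^sub>M ?Q. (case x of (n, y) \<Rightarrow> s * n) = n \<and>
          (\<lambda>l\<in>{1..d}. case x of (n, y) \<Rightarrow> \<Sum>t=1..n. y t l) \<in> B) =
        \<P>(x in \<nu> \<Otimes>\<^sub>M ?Q. (case x of (n, y) \<Rightarrow> s * n) = n) *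
        measure_pmf.prob (replicate_pmf n c) {w. (\<lambda>l\<in>{1..d}. count_list w l) \<in> B}"
      by simp
  qed
qed

section \<open>Conditioning on the value of a discrete variable\<close>

context prob_space begin

text \<open>
  Dominated convergence for the partition of the space into the fibres of \<open>L\<close>.
\<close>

lemma sums_integral_fibres:
  fixes L :: "'a \<Rightarrow> nat" and g :: "'a \<Rightarrow> real"
  assumes L [measurable]: "L \<in> measurable M (count_space UNIV)" and g: "integrable M g"
  shows "(\<lambda>n. \<integral>\<omega>. g \<omega> * indicator {\<omega> \<in> space M. L \<omega> = n} \<omega> \<partial>M) sums (\<integral>\<omega>. g \<omega> \<partial>M)"
proof -
  let ?i = "\<lambda>n \<omega>. indicator {\<omega> \<in> space M. L \<omega> = n} \<omega> :: real"
  note [measurable] = borel_measurable_integrable[OF g]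
  have pick: "(\<lambda>n. h \<omega> * ?i n \<omega>) sums h \<omega>" if "\<omega> \<in> space M" for h :: "'a \<Rightarrow> real" and \<omega>
    using sums_single[of "L \<omega>" "\<lambda>n. h \<omega>"] that
    by (simp add: indicator_def eq_commute of_bool_def if_distrib[of "\<lambda>x. h \<omega> * x"] cong: if_cong)
  have int: "integrable M (\<lambda>\<omega>. h \<omega> * ?i n \<omega>)" if "integrable M h" for n h
    using that by (intro integrable_real_mult_indicator) auto
  have "(\<lambda>n. \<integral>\<omega>. g \<omega> * ?i n \<omega> \<partial>M) sums (\<integral>\<omega>. (\<Sum>n. g \<omega> * ?i n \<omega>) \<partial>M)"
  proof (rule sums_integral)
    show "integrable M (\<lambda>\<omega>. g \<omega> * ?i n \<omega>)" for n by (rule int[OF g])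
    show "AE \<omega> in M. summable (\<lambda>n. norm (g \<omega> * ?i n \<omega>))"
    proof (intro AE_I2)
      fix \<omega> assume "\<omega> \<in> space M"
      from pick[OF this, of "\<lambda>\<omega>. \<bar>g \<omega>\<bar>"] show "summable (\<lambda>n. norm (g \<omega> * ?i n \<omega>))"
        by (simp add: abs_mult sums_iff)
    qed
    show "summable (\<lambda>n. \<integral>\<omega>. norm (g \<omega> * ?i n \<omega>) \<partial>M)"
    proof (rule summableI_nonneg_bounded)
      fix m
      have "(\<Sum>n<m. \<integral>\<omega>. norm (g \<omega> * ?i n \<omega>) \<partial>M) = (\<integral>\<omega>. (\<Sum>n<m. norm (g \<omega> * ?i n \<omega>)) \<partial>M)"
        by (intro Bochner_Integration.integral_sum[symmetric] integrable_norm int g)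
      also have "\<dots> \<le> (\<integral>\<omega>. \<bar>g \<omega>\<bar> \<partial>M)"
      proof (intro integral_mono Bochner_Integration.integrable_sum integrable_norm integrable_abs int g)
        fix \<omega> assume "\<omega> \<in> space M"
        from pick[OF this, of "\<lambda>\<omega>. \<bar>g \<omega>\<bar>"]
        have s: "(\<lambda>n. norm (g \<omega> * ?i n \<omega>)) sums \<bar>g \<omega>\<bar>" by (simp add: abs_mult)
        show "(\<Sum>n<m. norm (g \<omega> * ?i n \<omega>)) \<le> \<bar>g \<omega>\<bar>"
          unfolding sums_unique[OF s] by (intro sum_le_suminf sums_summable[OF s]) auto
      qed
      finally show "(\<Sum>n<m. \<integral>\<omega>. norm (g \<omega> * ?i n \<omega>) \<partial>M) \<le> (\<integral>\<omega>. \<bar>g \<omega>\<bar> \<partial>M)" .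
    qed simp
  qed
  also have "(\<integral>\<omega>. (\<Sum>n. g \<omega> * ?i n \<omega>) \<partial>M) = (\<integral>\<omega>. g \<omega> \<partial>M)"
    using pick[of _ g] by (intro Bochner_Integration.integral_cong refl) (auto simp: sums_iff)
  finally show ?thesis .
qed

text \<open>
  The function \<open>e(L)\<close> is the conditional expectation of \<open>g\<close> given \<open>L\<close>. Its integrability comes from
  the triangle inequality on each fibre, where \<open>\<bar>e n\<bar> * P(L = n)\<close> is at most the integral of
  \<open>\<bar>g\<bar>\<close>. This is why existence of a generating function of the counts implies existence of the
  generating function of the length.
\<close>

lemma expectation_fibrewise:
  fixes L :: "'a \<Rightarrow> nat" and g :: "'a \<Rightarrow> real" and e :: "nat \<Rightarrow> real"
  assumes L [measurable]: "L \<in> measurable M (count_space UNIV)" and g: "integrable M g"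
    and fib: "\<And>n. (\<integral>\<omega>. g \<omega> * indicator {\<omega> \<in> space M. L \<omega> = n} \<omega> \<partial>M) = e n * \<P>(\<omega> in M. L \<omega> = n)"
  shows "(\<lambda>n. e n * \<P>(\<omega> in M. L \<omega> = n)) sums expectation g"
    and "integrable M (\<lambda>\<omega>. e (L \<omega>))"
    and "expectation g = expectation (\<lambda>\<omega>. e (L \<omega>))"
proof -
  let ?i = "\<lambda>n \<omega>. indicator {\<omega> \<in> space M. L \<omega> = n} \<omega> :: real"
  note [measurable] = borel_measurable_integrable[OF g]
  show *: "(\<lambda>n. e n * \<P>(\<omega> in M. L \<omega> = n)) sums expectation g"
    using sums_integral_fibres[OF L g] by (simp add: fib)
  have fib_e: "(\<integral>\<omega>. e (L \<omega>) * ?i n \<omega> \<partial>M) = e n * \<P>(\<omega> in M. L \<omega> = n)" for n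
  proof -
    have "(\<integral>\<omega>. e (L \<omega>) * ?i n \<omega> \<partial>M) = (\<integral>\<omega>. e n * ?i n \<omega> \<partial>M)"
      by (intro Bochner_Integration.integral_cong refl) (auto simp: indicator_def)
    then show ?thesis by simp
  qed
  show int: "integrable M (\<lambda>\<omega>. e (L \<omega>))"
  proof (rule integrableI_bounded)
    show "(\<lambda>\<omega>. e (L \<omega>)) \<in> borel_measurable M" by measurable
    have "(\<integral>\<^sup>+\<omega>. ennreal (norm (e (L \<omega>))) \<partial>M) = (\<integral>\<^sup>+\<omega>. (\<Sum>n. ennreal \<bar>e n\<bar> * indicator {\<omega> \<in> space M. L \<omega> = n} \<omega>) \<partial>M)"
    proof (intro nn_integral_cong)
      fix \<omega> assume "\<omega> \<in> space M"
      then have "(\<Sum>n. ennreal \<bar>e n\<bar> * indicator {\<omega> \<in> space M. L \<omega> = n} \<omega>) =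
          (\<Sum>n\<in>{L \<omega>}. ennreal \<bar>e n\<bar> * indicator {\<omega> \<in> space M. L \<omega> = n} \<omega>)"
        by (intro suminf_finite) auto
      then show "ennreal (norm (e (L \<omega>))) = (\<Sum>n. ennreal \<bar>e n\<bar> * indicator {\<omega> \<in> space M. L \<omega> = n} \<omega>)"
        using \<open>\<omega> \<in> space M\<close> by simp
    qed
    also have "\<dots> = (\<Sum>n. ennreal \<bar>e n\<bar> * emeasure M {\<omega> \<in> space M. L \<omega> = n})"
      by (subst nn_integral_suminf) (auto simp: nn_integral_cmult_indicator)
    also have "\<dots> = (\<Sum>n. ennreal (norm (e n * \<P>(\<omega> in M. L \<omega> = n))))"
      by (simp add: emeasure_eq_measure abs_mult ennreal_mult')
    also have "\<dots> \<le> (\<Sum>n. \<integral>\<^sup>+\<omega>. ennreal (norm (g \<omega>)) * indicator {\<omega> \<in> space M. L \<omega> = n} \<omega> \<partial>M)"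
    proof (intro suminf_le)
      fix n
      have "ennreal (norm (e n * \<P>(\<omega> in M. L \<omega> = n))) = ennreal (norm (\<integral>\<omega>. g \<omega> * ?i n \<omega> \<partial>M))"
        by (simp add: fib)
      also have "\<dots> \<le> (\<integral>\<^sup>+\<omega>. ennreal (norm (g \<omega> * ?i n \<omega>)) \<partial>M)"
        by (intro integral_norm_bound_ennreal integrable_real_mult_indicator g) auto
      also have "\<dots> = (\<integral>\<^sup>+\<omega>. ennreal (norm (g \<omega>)) * indicator {\<omega> \<in> space M. L \<omega> = n} \<omega> \<partial>M)"
        by (intro nn_integral_cong) (auto simp: indicator_def)
      finally show "ennreal (norm (e n * \<P>(\<omega> in M. L \<omega> = n))) \<le>
          (\<integral>\<^sup>+\<omega>. ennreal (norm (g \<omega>)) * indicator {\<omega> \<in> space M. L \<omega> = n} \<omega> \<partial>M)" .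
    qed auto
    also have "\<dots> = (\<integral>\<^sup>+\<omega>. (\<Sum>n. ennreal (norm (g \<omega>)) * indicator {\<omega> \<in> space M. L \<omega> = n} \<omega>) \<partial>M)"
      by (subst nn_integral_suminf) auto
    also have "\<dots> = (\<integral>\<^sup>+\<omega>. ennreal (norm (g \<omega>)) \<partial>M)"
    proof (intro nn_integral_cong)
      fix \<omega> assume "\<omega> \<in> space M"
      then have "(\<Sum>n. ennreal (norm (g \<omega>)) * indicator {\<omega> \<in> space M. L \<omega> = n} \<omega>) =
          (\<Sum>n\<in>{L \<omega>}. ennreal (norm (g \<omega>)) * indicator {\<omega> \<in> space M. L \<omega> = n} \<omega>)"
        by (intro suminf_finite) auto
      then show "(\<Sum>n. ennreal (norm (g \<omega>)) * indicator {\<omega> \<in> space M. L \<omega> = n} \<omega>) = ennreal (norm (g \<omega>))"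
        using \<open>\<omega> \<in> space M\<close> by simp
    qed
    also have "\<dots> < \<infinity>" using g by (simp add: integrable_iff_bounded)
    finally show "(\<integral>\<^sup>+\<omega>. ennreal (norm (e (L \<omega>))) \<partial>M) < \<infinity>" .
  qed
  show "expectation g = expectation (\<lambda>\<omega>. e (L \<omega>))"
    using sums_integral_fibres[OF L int] * unfolding fib_e by (rule sums_unique2[rotated])
qed

end

lemma (in prob_space) uniform_measure_eq_density:
  assumes "prob S \<noteq> 0"
  shows "uniform_measure M S = density M (\<lambda>\<omega>. ennreal (indicator S \<omega> / prob S))"
  unfolding uniform_measure_def using assms
  by (intro arg_cong[where f="density M"] ext)
     (auto simp: indicator_def emeasure_eq_measure divide_ennreal[symmetric] zero_less_measure_iff)

text \<open>
  Conditioning on \<open>S\<close> only rescales integrals over \<open>S\<close>; this and the next lemma move conditional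
  generating functions and means back to \<open>M\<close>.
\<close>

lemma (in prob_space) integrable_uniform_measure:
  fixes g :: "'a \<Rightarrow> real"
  assumes S: "S \<in> events" "prob S \<noteq> 0" and g: "g \<in> borel_measurable M"
  shows "integrable (uniform_measure M S) g \<longleftrightarrow> integrable M (\<lambda>\<omega>. g \<omega> * indicator S \<omega>)"
proof -
  have "integrable (uniform_measure M S) g \<longleftrightarrow> integrable M (\<lambda>\<omega>. (indicator S \<omega> / prob S) *\<^sub>R g \<omega>)"
    unfolding uniform_measure_eq_density[OF S(2)] using S g
    by (intro integrable_density) auto
  also have "(\<lambda>\<omega>. (indicator S \<omega> / prob S) *\<^sub>R g \<omega>) = (\<lambda>\<omega>. (1 / prob S) * (g \<omega> * indicator S \<omega>))"
    by (simp add: fun_eq_iff)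
  also have "integrable M \<dots> \<longleftrightarrow> integrable M (\<lambda>\<omega>. g \<omega> * indicator S \<omega>)"
    using S by (subst integrable_mult_left_iff) simp
  finally show ?thesis .
qed

lemma (in prob_space) integral_uniform_measure:
  fixes g :: "'a \<Rightarrow> real"
  assumes S: "S \<in> events" "prob S \<noteq> 0" and g: "g \<in> borel_measurable M"
  shows "integral\<^sup>L (uniform_measure M S) g = (\<integral>\<omega>. g \<omega> * indicator S \<omega> \<partial>M) / prob S"
proof -
  have "integral\<^sup>L (uniform_measure M S) g = (\<integral>\<omega>. (indicator S \<omega> / prob S) *\<^sub>R g \<omega> \<partial>M)"
    unfolding uniform_measure_eq_density[OF S(2)] using S g
    by (intro integral_density) auto
  also have "\<dots> = (\<integral>\<omega>. (g \<omega> * indicator S \<omega>) / prob S \<partial>M)"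
    by (intro Bochner_Integration.integral_cong) simp_all
  finally show ?thesis by simp
qed

section \<open>Expectations and probabilities of the counts\<close>

text \<open>
  The terms with \<open>n\<close> below the sum \<open>S\<close> of the prescribed counts vanish; reindexing by \<open>m = n - S\<close> and
  pulling the factor that does not depend on \<open>m\<close> out of the series gives the form in which the
  probabilities are stated.
\<close>

lemma count_weight_series:
  assumes A: "finite A" "(\<Prod>l\<in>A. u l ^ a l) \<noteq> 0"
    and s: "(\<lambda>n. count_weight A u r n a * Q n) sums T"
  shows "(\<lambda>m. fact (m + (\<Sum>l\<in>A. a l)) / fact m * r ^ m * Q (m + (\<Sum>l\<in>A. a l)))
    sums (T / ((\<Prod>l\<in>A. u l ^ a l) / (\<Prod>l\<in>A. fact (a l))))"
proof -
  let ?S = "\<Sum>l\<in>A. a l" and ?K = "(\<Prod>l\<in>A. u l ^ a l) / (\<Prod>l\<in>A. fact (a l))"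
  have K: "?K \<noteq> 0" using A by simp
  have "(\<lambda>m. count_weight A u r (m + ?S) a * Q (m + ?S)) sums T"
    using s by (subst sums_zero_iff_shift) (auto simp: count_weight_def)
  also have "(\<lambda>m. count_weight A u r (m + ?S) a * Q (m + ?S)) =
      (\<lambda>m. ?K * (fact (m + ?S) / fact m * r ^ m * Q (m + ?S)))"
    by (simp add: fun_eq_iff count_weight_def field_simps)
  finally have "(\<lambda>m. (?K * (fact (m + ?S) / fact m * r ^ m * Q (m + ?S))) / ?K) sums (T / ?K)"
    by (rule sums_divide)
  then show ?thesis using K by (simp only: nonzero_mult_div_cancel_left[OF K])
qed

context counts_of_random_word begin

lemma finite_words: "finite (set_pmf (replicate_pmf n c))"
  using finite_subset[OF letters finite_letters] by (rule finite_set_replicate_pmf)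

abbreviation word_expectation :: "nat \<Rightarrow> (nat list \<Rightarrow> real) \<Rightarrow> real" where
  "word_expectation n \<equiv> measure_pmf.expectation (replicate_pmf n c)"

text \<open>
  Any function of the counts is measurable, because the count vectors form a countable set.
\<close>

lemma measurable_counts:
  assumes "f \<in> (I \<rightarrow>\<^sub>E UNIV) \<rightarrow> space K"
  shows "(\<lambda>\<omega>. f (\<lambda>l\<in>I. X l \<omega>)) \<in> measurable M K"
proof -
  note [measurable] = X_measurable
  have countable: "countable (I \<rightarrow>\<^sub>E (UNIV :: nat set))"
    using finite_letters by (intro countable_PiE) auto
  have "(\<lambda>\<omega>. \<lambda>l\<in>I. X l \<omega>) \<in> measurable M (count_space (I \<rightarrow>\<^sub>E UNIV))"
    unfolding measurable_count_space_eq_countable[OF countable]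
  proof safe
    fix x :: "nat \<Rightarrow> nat" assume x: "x \<in> I \<rightarrow>\<^sub>E UNIV"
    have "(\<lambda>\<omega>. \<lambda>l\<in>I. X l \<omega>) -` {x} \<inter> space M = {\<omega> \<in> space M. \<forall>l\<in>I. X l \<omega> = x l}"
      using x by (auto simp: fun_eq_iff PiE_def extensional_def restrict_def)
    also have "\<dots> \<in> sets M" using finite_letters by measurable
    finally show "(\<lambda>\<omega>. \<lambda>l\<in>I. X l \<omega>) -` {x} \<inter> space M \<in> sets M" .
  qed auto
  then show ?thesis
    by (rule measurable_compose) (use assms in simp)
qed

lemma measurable_counts_pred [measurable]: "Measurable.pred M (\<lambda>\<omega>. (\<lambda>l\<in>I. X l \<omega>) \<in> B)"
  by (rule measurable_counts[of "\<lambda>x. x \<in> B"]) simp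

text \<open>
  The counts are almost surely those of some possible word of length \<open>L\<close>. In particular they take
  only finitely many values on each fibre of \<open>L\<close>.
\<close>

lemma AE_counts: "AE \<omega> in M. (\<lambda>l\<in>I. X l \<omega>) \<in> (\<lambda>w. \<lambda>l\<in>I. count_list w l) ` set_pmf (replicate_pmf (L \<omega>) c)"
proof -
  let ?W = "\<lambda>n. (\<lambda>w. \<lambda>l\<in>I. count_list w l) ` set_pmf (replicate_pmf n c)"
  have "AE \<omega> in M. \<not> (L \<omega> = n \<and> (\<lambda>l\<in>I. X l \<omega>) \<in> - ?W n)" for n
  proof -
    have 0: "measure_pmf.prob (replicate_pmf n c) {w. (\<lambda>l\<in>I. count_list w l) \<in> - ?W n} = 0"
      by (subst measure_pmf_zero_iff) auto
    have "\<P>(\<omega> in M. L \<omega> = n \<and> (\<lambda>l\<in>I. X l \<omega>) \<in> - ?W n) = 0"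
      unfolding law 0 by simp
    moreover have "{\<omega> \<in> space M. L \<omega> = n \<and> (\<lambda>l\<in>I. X l \<omega>) \<in> - ?W n} \<in> sets M"
      by measurable
    ultimately have "AE \<omega> in M. \<omega> \<notin> {\<omega> \<in> space M. L \<omega> = n \<and> (\<lambda>l\<in>I. X l \<omega>) \<in> - ?W n}"
      by (simp only: prob_eq_0)
    then show ?thesis using AE_space by eventually_elim blast
  qed
  then have "AE \<omega> in M. \<forall>n. \<not> (L \<omega> = n \<and> (\<lambda>l\<in>I. X l \<omega>) \<in> - ?W n)"
    by (subst AE_all_countable) simp
  then show ?thesis by eventually_elim blast
qed

text \<open>
  On a fibre of \<open>L\<close> the integrand takes finitely many values, so the integral is a finite sum to
  which the locale assumption applies termwise.
\<close>

lemma integral_fibre: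
  fixes f :: "(nat \<Rightarrow> nat) \<Rightarrow> real"
  shows "(\<integral>\<omega>. f (\<lambda>l\<in>I. X l \<omega>) * indicator {\<omega> \<in> space M. L \<omega> = n} \<omega> \<partial>M) =
    word_expectation n (\<lambda>w. f (\<lambda>l\<in>I. count_list w l)) * \<P>(\<omega> in M. L \<omega> = n)"
proof -
  let ?count = "\<lambda>w. \<lambda>l\<in>I. count_list w l"
  define W where "W = ?count ` set_pmf (replicate_pmf n c)"
  have W: "finite W" unfolding W_def by (intro finite_imageI finite_words)
  have sets: "{\<omega> \<in> space M. L \<omega> = n \<and> (\<lambda>l\<in>I. X l \<omega>) \<in> {x}} \<in> sets M" for x
    by measurable
  have "(\<integral>\<omega>. f (\<lambda>l\<in>I. X l \<omega>) * indicator {\<omega> \<in> space M. L \<omega> = n} \<omega> \<partial>M) =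
      (\<integral>\<omega>. (\<Sum>x\<in>W. f x * indicator {\<omega> \<in> space M. L \<omega> = n \<and> (\<lambda>l\<in>I. X l \<omega>) \<in> {x}} \<omega>) \<partial>M)"
  proof (rule integral_cong_AE)
    show "(\<lambda>\<omega>. f (\<lambda>l\<in>I. X l \<omega>) * indicator {\<omega> \<in> space M. L \<omega> = n} \<omega>) \<in> borel_measurable M"
      by (intro borel_measurable_times measurable_counts borel_measurable_indicator) auto
    show "(\<lambda>\<omega>. \<Sum>x\<in>W. f x * indicator {\<omega> \<in> space M. L \<omega> = n \<and> (\<lambda>l\<in>I. X l \<omega>) \<in> {x}} \<omega>)
        \<in> borel_measurable M"
      by (intro borel_measurable_sum borel_measurable_times borel_measurable_indicator sets) auto
    show "AE \<omega> in M. f (\<lambda>l\<in>I. X l \<omega>) * indicator {\<omega> \<in> space M. L \<omega> = n} \<omega> =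
        (\<Sum>x\<in>W. f x * indicator {\<omega> \<in> space M. L \<omega> = n \<and> (\<lambda>l\<in>I. X l \<omega>) \<in> {x}} \<omega>)"
      using AE_counts AE_space
    proof eventually_elim
      case (elim \<omega>)
      define v where "v = (\<lambda>l\<in>I. X l \<omega>)"
      have "(\<Sum>x\<in>W. f x * indicator {\<omega> \<in> space M. L \<omega> = n \<and> (\<lambda>l\<in>I. X l \<omega>) \<in> {x}} \<omega>) =
          (\<Sum>x\<in>W. if x = v then f v * indicator {\<omega> \<in> space M. L \<omega> = n} \<omega> else 0)"
        by (intro sum.cong refl) (auto simp: indicator_def v_def)
      also have "\<dots> = f v * indicator {\<omega> \<in> space M. L \<omega> = n} \<omega>"
        using W elim by (auto simp: W_def v_def indicator_def)
      finally show ?case by (simp only: v_def)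
    qed
  qed
  also have "\<dots> = (\<Sum>x\<in>W. f x * \<P>(\<omega> in M. L \<omega> = n \<and> (\<lambda>l\<in>I. X l \<omega>) \<in> {x}))"
  proof (subst Bochner_Integration.integral_sum)
    show "integrable M (\<lambda>\<omega>. f x * indicator {\<omega> \<in> space M. L \<omega> = n \<and> (\<lambda>l\<in>I. X l \<omega>) \<in> {x}} \<omega>)" for x
      by (intro integrable_mult_right integrable_real_indicator sets) (simp add: emeasure_eq_measure)
  qed (use sets in \<open>simp del: singleton_iff\<close>)
  also have "\<dots> = (\<Sum>x\<in>W. f x * pmf (map_pmf ?count (replicate_pmf n c)) x) * \<P>(\<omega> in M. L \<omega> = n)"
    unfolding law sum_distrib_right
    by (intro sum.cong refl) (auto simp: pmf_map vimage_def intro!: arg_cong2[where f="(*)"])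
  also have "(\<Sum>x\<in>W. f x * pmf (map_pmf ?count (replicate_pmf n c)) x) =
      measure_pmf.expectation (map_pmf ?count (replicate_pmf n c)) f"
    using W by (intro integral_measure_pmf_real[symmetric]) (auto simp: W_def)
  finally show ?thesis unfolding integral_map_pmf .
qed

lemma expectation_by_length:
  fixes f :: "(nat \<Rightarrow> nat) \<Rightarrow> real"
  assumes "integrable M (\<lambda>\<omega>. f (\<lambda>l\<in>I. X l \<omega>))"
    and e: "\<And>n. word_expectation n (\<lambda>w. f (\<lambda>l\<in>I. count_list w l)) = e n"
  shows "(\<lambda>n. e n * \<P>(\<omega> in M. L \<omega> = n)) sums expectation (\<lambda>\<omega>. f (\<lambda>l\<in>I. X l \<omega>))"
    and "integrable M (\<lambda>\<omega>. e (L \<omega>))"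
    and "expectation (\<lambda>\<omega>. f (\<lambda>l\<in>I. X l \<omega>)) = expectation (\<lambda>\<omega>. e (L \<omega>))"
  using expectation_fibrewise[OF L_measurable assms(1), of e] by (simp_all only: integral_fibre e)

lemma letter_sum: "A \<subseteq> I \<Longrightarrow> (\<Sum>l\<in>I - A. pmf c l) = 1 - (\<Sum>l\<in>A. pmf c l)"
  using finite_letters letters by (simp add: sum_diff sum_pmf_eq_1)

lemma prob_counts_and_length:
  assumes A: "A \<subseteq> I"
  shows "\<P>(\<omega> in M. L \<omega> = n \<and> (\<forall>l\<in>A. X l \<omega> = a l)) =
    count_weight A (pmf c) (1 - (\<Sum>l\<in>A. pmf c l)) n a * \<P>(\<omega> in M. L \<omega> = n)"
proof -
  have "(\<forall>l\<in>A. (\<lambda>l\<in>I. x l) l = a l) \<longleftrightarrow> (\<forall>l\<in>A. x l = a l)" for x :: "nat \<Rightarrow> nat"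
    using A by auto
  then show ?thesis
    using law[of n "{x. \<forall>l\<in>A. x l = a l}"] prob_letter_counts[OF finite_letters letters A, of n a]
    by (simp only: mem_Collect_eq mult.commute)
qed

lemma prob_counts_sums:
  assumes A: "A \<subseteq> I"
  shows "(\<lambda>n. count_weight A (pmf c) (1 - (\<Sum>l\<in>A. pmf c l)) n a * \<P>(\<omega> in M. L \<omega> = n))
    sums \<P>(\<omega> in M. \<forall>l\<in>A. X l \<omega> = a l)"
proof -
  have "finite A" using A finite_letters by (rule finite_subset)
  then have [measurable]: "{\<omega> \<in> space M. \<forall>l\<in>A. X l \<omega> = a l} \<in> sets M"
    using A X_measurable by (intro sets.sets_Collect_finite_All) auto
  have "(\<lambda>n. \<integral>\<omega>. indicator {\<omega> \<in> space M. \<forall>l\<in>A. X l \<omega> = a l} \<omega> * indicator {\<omega> \<in> space M. L \<omega> = n} \<omega> \<partial>M)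
      sums (\<integral>\<omega>. (indicator {\<omega> \<in> space M. \<forall>l\<in>A. X l \<omega> = a l} \<omega> :: real) \<partial>M)"
    by (intro sums_integral_fibres) (auto simp: emeasure_eq_measure)
  also have "(\<lambda>n. \<integral>\<omega>. indicator {\<omega> \<in> space M. \<forall>l\<in>A. X l \<omega> = a l} \<omega> * indicator {\<omega> \<in> space M. L \<omega> = n} \<omega> \<partial>M) =
      (\<lambda>n. \<P>(\<omega> in M. L \<omega> = n \<and> (\<forall>l\<in>A. X l \<omega> = a l)))"
  proof
    fix n
    have "(\<lambda>\<omega>. indicator {\<omega> \<in> space M. \<forall>l\<in>A. X l \<omega> = a l} \<omega> * indicator {\<omega> \<in> space M. L \<omega> = n} \<omega> :: real) =
        indicator {\<omega> \<in> space M. L \<omega> = n \<and> (\<forall>l\<in>A. X l \<omega> = a l)}"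
      by (auto simp: fun_eq_iff indicator_def)
    moreover have "{\<omega> \<in> space M. L \<omega> = n \<and> (\<forall>l\<in>A. X l \<omega> = a l)} \<subseteq> space M" by auto
    ultimately show "(\<integral>\<omega>. indicator {\<omega> \<in> space M. \<forall>l\<in>A. X l \<omega> = a l} \<omega> * indicator {\<omega> \<in> space M. L \<omega> = n} \<omega> \<partial>M) =
      \<P>(\<omega> in M. L \<omega> = n \<and> (\<forall>l\<in>A. X l \<omega> = a l))"
      by (simp add: Int_absorb2)
  qed
  finally show ?thesis by (simp add: prob_counts_and_length[OF A] Int_absorb2)
qed

lemma prob_counts_series:
  fixes a :: "nat \<Rightarrow> nat"
  assumes A: "A \<subseteq> I" and pos: "\<And>l. l \<in> A \<Longrightarrow> pmf c l > 0"
  defines "S \<equiv> \<Sum>l\<in>A. a l"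
  defines "b \<equiv> \<lambda>m. fact (m + S) / fact m * (1 - (\<Sum>l\<in>A. pmf c l)) ^ m * \<P>(\<omega> in M. L \<omega> = m + S)"
  shows "summable b"
    and "\<P>(\<omega> in M. \<forall>l\<in>A. X l \<omega> = a l) =
      (\<Prod>l\<in>A. pmf c l ^ a l) / (\<Prod>l\<in>A. fact (a l)) * (\<Sum>m. b m)"
proof -
  have fin: "finite A" using A finite_letters by (rule finite_subset)
  have "pmf c l \<noteq> 0" if "l \<in> A" for l using pos[OF that] by simp
  then have "(\<Prod>l\<in>A. pmf c l ^ a l) \<noteq> 0" using fin by (simp add: set_pmf_eq)
  from count_weight_series[OF fin this prob_counts_sums[OF A]]
  have s: "b sums (\<P>(\<omega> in M. \<forall>l\<in>A. X l \<omega> = a l) / ((\<Prod>l\<in>A. pmf c l ^ a l) / (\<Prod>l\<in>A. fact (a l))))"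
    unfolding b_def S_def .
  then show "summable b" by (rule sums_summable)
  have "(\<Prod>l\<in>A. pmf c l ^ a l) / (\<Prod>l\<in>A. fact (a l)) \<noteq> (0::real)"
    using \<open>(\<Prod>l\<in>A. pmf c l ^ a l) \<noteq> 0\<close> fin by simp
  then show "\<P>(\<omega> in M. \<forall>l\<in>A. X l \<omega> = a l) =
      (\<Prod>l\<in>A. pmf c l ^ a l) / (\<Prod>l\<in>A. fact (a l)) * (\<Sum>m. b m)"
    unfolding sums_unique[OF s, symmetric] by simp
qed

lemma word_pgf:
  assumes A: "A \<subseteq> I"
  shows "word_expectation n (\<lambda>w. \<Prod>l\<in>A. z l ^ count_list w l) =
    ((\<Sum>l\<in>A. pmf c l * z l) + 1 - (\<Sum>l\<in>A. pmf c l)) ^ n"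
proof -
  have fin: "finite A" using A finite_letters by (rule finite_subset)
  let ?\<zeta> = "\<lambda>l. if l \<in> A then z l else 1"
  have "word_expectation n (\<lambda>w. \<Prod>l\<in>A. z l ^ count_list w l) =
      word_expectation n (\<lambda>w. prod_list (map ?\<zeta> w) * of_bool (\<forall>l\<in>{}. count_list w l = 0))"
    by (simp add: prod_power_count_list[OF fin])
  also have "\<dots> = count_weight {} (\<lambda>l. pmf c l * ?\<zeta> l) (\<Sum>l\<in>I - {}. pmf c l * ?\<zeta> l) n (\<lambda>_. 0)"
    using finite_letters letters by (intro expectation_letter_counts) auto
  also have "\<dots> = (\<Sum>l\<in>I. pmf c l * ?\<zeta> l) ^ n" by (simp add: count_weight_def)
  also have "(\<Sum>l\<in>I. pmf c l * ?\<zeta> l) = (\<Sum>l\<in>I - A. pmf c l * ?\<zeta> l) + (\<Sum>l\<in>A. pmf c l * ?\<zeta> l)"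
    using A finite_letters by (rule sum.subset_diff)
  also have "\<dots> = (\<Sum>l\<in>I - A. pmf c l) + (\<Sum>l\<in>A. pmf c l * z l)"
    by simp
  finally show ?thesis using letter_sum[OF A] by (simp add: algebra_simps)
qed

text \<open>
  The generating function of the counts of a word of length \<open>n\<close> is \<open>\<theta> ^ n\<close>; averaging over the
  length turns it into the generating function of \<open>L\<close> at \<open>\<theta>\<close>.
\<close>

lemma joint_pgf_counts:
  fixes z :: "nat \<Rightarrow> real"
  assumes A: "A \<subseteq> I" and ex: "joint_pgf_exists M A X z"
  defines "\<theta> \<equiv> (\<Sum>l\<in>A. pmf c l * z l) + 1 - (\<Sum>l\<in>A. pmf c l)"
  shows "pgf_exists M L \<theta>" and "joint_pgf M A X z = pgf M L \<theta>"
proof -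
  have eq: "(\<Prod>l\<in>A. z l ^ (\<lambda>l\<in>I. x l) l) = (\<Prod>l\<in>A. z l ^ x l)" for x :: "nat \<Rightarrow> nat"
    using A by (intro prod.cong) auto
  have "integrable M (\<lambda>\<omega>. (\<lambda>x. \<Prod>l\<in>A. z l ^ x l) (\<lambda>l\<in>I. X l \<omega>))"
    using ex unfolding eq joint_pgf_exists_def .
  note * = expectation_by_length[OF this, of "\<lambda>n. \<theta> ^ n"]
  show "pgf_exists M L \<theta>" "joint_pgf M A X z = pgf M L \<theta>"
    using *(2,3) word_pgf[OF A] unfolding eq pgf_exists_def pgf_def joint_pgf_def \<theta>_def by blast+
qed

lemma AE_sum_counts: "AE \<omega> in M. (\<Sum>l\<in>I. X l \<omega>) = L \<omega>"
  using AE_counts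
proof eventually_elim
  case (elim \<omega>)
  then obtain w where w: "w \<in> set_pmf (replicate_pmf (L \<omega>) c)" "(\<lambda>l\<in>I. X l \<omega>) = (\<lambda>l\<in>I. count_list w l)"
    by blast
  then have len: "length w = L \<omega>" "set w \<subseteq> I"
    using letters by (auto simp: set_replicate_pmf lists_eq_set)
  have "(\<Sum>l\<in>I. X l \<omega>) = (\<Sum>l\<in>I. count_list w l)"
    by (intro sum.cong refl) (use fun_cong[OF w(2)] in \<open>metis restrict_apply'\<close>)
  also have "\<dots> = (\<Sum>l\<in>set w. count_list w l)"
    using finite_letters len by (intro sum.mono_neutral_right) (auto simp: count_list_0_iff)
  also have "\<dots> = L \<omega>" using len by (simp add: sum_count_set)
  finally show ?case .
qed

lemma AE_count_le:
  assumes "l \<in> I"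
  shows "AE \<omega> in M. X l \<omega> \<le> L \<omega>"
  using AE_sum_counts
proof eventually_elim
  case (elim \<omega>)
  have "X l \<omega> \<le> (\<Sum>l\<in>I. X l \<omega>)"
    using assms finite_letters by (intro member_le_sum) auto
  then show ?case using elim by simp
qed

lemma word_mean:
  assumes i: "i \<in> I"
  shows "word_expectation n (\<lambda>w. real (count_list w i)) = real n * pmf c i"
  using expectation_size_bias[OF finite_letters letters i, of n "\<lambda>_. 1"] by simp

lemma word_mean_product:
  assumes i: "i \<in> I" "j \<in> I" "i \<noteq> j"
  shows "word_expectation n (\<lambda>w. real (count_list w i) * real (count_list w j)) =
    real n * real (n - 1) * pmf c i * pmf c j"
  using expectation_size_bias[OF finite_letters letters i(1), of n "\<lambda>x. real (x j)"] i word_mean[OF i(2)]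
  by (simp add: mult_ac)

lemma word_mean_square:
  assumes i: "i \<in> I"
  shows "word_expectation n (\<lambda>w. (real (count_list w i))\<^sup>2) =
    real n * pmf c i * (1 + real (n - 1) * pmf c i)"
proof -
  have "word_expectation n (\<lambda>w. (real (count_list w i))\<^sup>2) =
      real n * pmf c i * word_expectation (n - 1) (\<lambda>w. 1 + real (count_list w i))"
    using expectation_size_bias[OF finite_letters letters i, of n "\<lambda>x. real (x i)"]
    by (simp add: power2_eq_square)
  also have "word_expectation (n - 1) (\<lambda>w. 1 + real (count_list w i)) = 1 + real (n - 1) * pmf c i"
    by (subst Bochner_Integration.integral_add)
       (simp_all add: word_mean[OF i] integrable_measure_pmf_finite[OF finite_words])
  finally show ?thesis .
qed

lemma word_mean_given_count:
  assumes i: "i \<in> I" "j \<in> I" "i \<noteq> j"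
  shows "word_expectation n (\<lambda>w. real (count_list w i) * of_bool (count_list w j = b)) =
    real n * pmf c i * count_weight {j} (pmf c) (1 - pmf c j) (n - 1) (\<lambda>_. b)"
proof -
  have "word_expectation (n - 1) (\<lambda>w. of_bool (count_list w j = b)) =
      word_expectation (n - 1) (indicator {w. \<forall>l\<in>{j}. count_list w l = b})"
    by (intro Bochner_Integration.integral_cong) (auto simp: indicator_def)
  also have "\<dots> = count_weight {j} (pmf c) (1 - pmf c j) (n - 1) (\<lambda>_. b)"
    using prob_letter_counts[OF finite_letters letters, of "{j}" "n - 1" "\<lambda>_. b"] i by simp
  finally show ?thesis
    using expectation_size_bias[OF finite_letters letters i(1), of n "\<lambda>x. of_bool (x j = b)"] i by simp
qed

text \<open>
  Letters \<open>i\<close> carry weight \<open>z\<close>, so the letters other than \<open>j\<close> have total weight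
  \<open>pmf c i * z + 1 - pmf c i - pmf c j\<close>.
\<close>

lemma word_pgf_given_count:
  assumes i: "i \<in> I" "j \<in> I" "i \<noteq> j"
  shows "word_expectation n (\<lambda>w. z ^ count_list w i * of_bool (count_list w j = b)) =
    count_weight {j} (pmf c) (pmf c i * z + 1 - pmf c i - pmf c j) n (\<lambda>_. b)"
proof -
  let ?\<zeta> = "\<lambda>l. if l \<in> {i} then z else 1"
  have "word_expectation n (\<lambda>w. z ^ count_list w i * of_bool (count_list w j = b)) =
      word_expectation n (\<lambda>w. prod_list (map ?\<zeta> w) * of_bool (\<forall>l\<in>{j}. count_list w l = b))"
    using prod_power_count_list[of "{i}" "\<lambda>_. z"] by simp
  also have "\<dots> = count_weight {j} (\<lambda>l. pmf c l * ?\<zeta> l) (\<Sum>l\<in>I - {j}. pmf c l * ?\<zeta> l) n (\<lambda>_. b)"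
    using finite_letters letters i by (intro expectation_letter_counts) auto
  also have "(\<Sum>l\<in>I - {j}. pmf c l * ?\<zeta> l) = (\<Sum>l\<in>I - {j}. pmf c l + (if l = i then pmf c i * (z - 1) else 0))"
    by (intro sum.cong) (auto simp: algebra_simps)
  also have "\<dots> = pmf c i * z + 1 - pmf c i - pmf c j"
    using letter_sum[of "{j}"] i finite_letters by (simp add: sum.distrib algebra_simps)
  finally show ?thesis using i by (simp add: count_weight_def)
qed

lemma prob_sum_counts: "\<P>(\<omega> in M. (\<Sum>l\<in>I. X l \<omega>) = m) = \<P>(\<omega> in M. L \<omega> = m)"
proof (rule measure_eq_AE)
  note [measurable] = X_measurable
  show "{\<omega> \<in> space M. (\<Sum>l\<in>I. X l \<omega>) = m} \<in> sets M" by measurable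
  show "{\<omega> \<in> space M. L \<omega> = m} \<in> sets M" by measurable
  show "AE \<omega> in M. (\<omega> \<in> {\<omega> \<in> space M. (\<Sum>l\<in>I. X l \<omega>) = m}) = (\<omega> \<in> {\<omega> \<in> space M. L \<omega> = m})"
    using AE_sum_counts by eventually_elim auto
qed

text \<open>
  If the counts of all letters are prescribed, the remaining letters have weight \<open>0\<close>, which leaves
  only the length \<open>n = (\<Sum>l\<in>I. x l)\<close> in the series.
\<close>

lemma prob_all_counts:
  "\<P>(\<omega> in M. \<forall>l\<in>I. X l \<omega> = x l) =
    multinomial_coeff I x * (\<Prod>l\<in>I. pmf c l ^ x l) * \<P>(\<omega> in M. L \<omega> = (\<Sum>l\<in>I. x l))"
proof -
  have one: "(\<Sum>l\<in>I. pmf c l) = 1" using finite_letters letters by (rule sum_pmf_eq_1)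
  have "(\<lambda>n. count_weight I (pmf c) 0 n x * \<P>(\<omega> in M. L \<omega> = n)) sums \<P>(\<omega> in M. \<forall>l\<in>I. X l \<omega> = x l)"
    using prob_counts_sums[of I x] by (simp add: one)
  moreover have "(\<lambda>n. count_weight I (pmf c) 0 n x * \<P>(\<omega> in M. L \<omega> = n)) =
      (\<lambda>n. if n = (\<Sum>l\<in>I. x l) then count_weight I (pmf c) 0 (\<Sum>l\<in>I. x l) x * \<P>(\<omega> in M. L \<omega> = (\<Sum>l\<in>I. x l)) else 0)"
    by (auto simp: fun_eq_iff count_weight_full)
  ultimately have "\<P>(\<omega> in M. \<forall>l\<in>I. X l \<omega> = x l) =
      count_weight I (pmf c) 0 (\<Sum>l\<in>I. x l) x * \<P>(\<omega> in M. L \<omega> = (\<Sum>l\<in>I. x l))"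
    using sums_single[of "\<Sum>l\<in>I. x l" "\<lambda>_. count_weight I (pmf c) 0 (\<Sum>l\<in>I. x l) x * \<P>(\<omega> in M. L \<omega> = (\<Sum>l\<in>I. x l))"]
    by (metis (no_types, lifting) sums_unique2)
  then show ?thesis by (simp add: count_weight_full multinomial_coeff_def)
qed

lemma prob_count_series:
  assumes i: "i \<in> I" "pmf c i > 0"
  defines "b \<equiv> \<lambda>n m. fact (m + n) / fact m * (1 - pmf c i) ^ m * \<P>(\<omega> in M. L \<omega> = m + n)"
  shows "summable (b n)" and "\<P>(\<omega> in M. X i \<omega> = n) = pmf c i ^ n / fact n * (\<Sum>m. b n m)"
  using prob_counts_series[of "{i}" "\<lambda>_. n"] i by (simp_all add: b_def)

lemma prob_two_counts_series:
  assumes i: "i \<in> I" "j \<in> I" "i \<noteq> j" "pmf c i > 0" "pmf c j > 0"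
  defines "b \<equiv> \<lambda>x y m. fact (m + x + y) / fact m * (1 - (pmf c i + pmf c j)) ^ m *
    \<P>(\<omega> in M. L \<omega> = m + x + y)"
  shows "summable (b x y)"
    and "\<P>(\<omega> in M. X i \<omega> = x \<and> X j \<omega> = y) =
      pmf c i ^ x * pmf c j ^ y / (fact x * fact y) * (\<Sum>m. b x y m)"
proof -
  let ?a = "\<lambda>l. if l = i then x else y"
  have *: "(\<forall>l\<in>{i, j}. X l \<omega> = ?a l) \<longleftrightarrow> X i \<omega> = x \<and> X j \<omega> = y" for \<omega>
    using i by auto
  have sum: "(\<Sum>l\<in>{i, j}. ?a l) = x + y" using i by simp
  have A: "{i, j} \<subseteq> I" "\<And>l. l \<in> {i, j} \<Longrightarrow> pmf c l > 0" using i by auto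
  show "summable (b x y)"
    using prob_counts_series(1)[OF A, of ?a] i unfolding sum by (simp add: b_def add.assoc)
  show "\<P>(\<omega> in M. X i \<omega> = x \<and> X j \<omega> = y) =
      pmf c i ^ x * pmf c j ^ y / (fact x * fact y) * (\<Sum>m. b x y m)"
    using prob_counts_series(2)[OF A, of ?a] i unfolding sum * by (simp add: b_def add.assoc)
qed

text \<open>
  With \<open>0 ^ 0 = 1\<close> the generating function at \<open>0\<close> is the probability of the value \<open>0\<close>.
\<close>

lemma prob_count_0:
  assumes i: "i \<in> I"
  shows "\<P>(\<omega> in M. X i \<omega> = 0) = pgf M L (1 - pmf c i)"
proof -
  note [measurable] = X_measurable[OF i]
  have eq: "(\<Prod>l\<in>{i}. (0 :: real) ^ X l \<omega>) = indicator {\<omega> \<in> space M. X i \<omega> = 0} \<omega>"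
    if "\<omega> \<in> space M" for \<omega> :: 'a
    using that by (simp add: power_0_left indicator_def)
  have int: "integrable M (indicator {\<omega> \<in> space M. X i \<omega> = 0} :: 'a \<Rightarrow> real)"
    by (intro integrable_real_indicator) (auto simp: emeasure_eq_measure)
  have "joint_pgf_exists M {i} X (\<lambda>_. 0)"
    unfolding joint_pgf_exists_def using int by (subst Bochner_Integration.integrable_cong[OF refl eq]) auto
  then have "joint_pgf M {i} X (\<lambda>_. 0) = pgf M L (1 - pmf c i)"
    using joint_pgf_counts(2)[of "{i}" "\<lambda>_. 0"] i by simp
  moreover have "joint_pgf M {i} X (\<lambda>_. 0) = \<P>(\<omega> in M. X i \<omega> = 0)"
    unfolding joint_pgf_def by (subst Bochner_Integration.integral_cong[OF refl eq]) (auto simp: Int_absorb2)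
  ultimately show ?thesis by simp
qed

end

section \<open>Moments of the counts\<close>

context counts_of_random_word begin

lemma mean_count:
  assumes i: "i \<in> I" and L: "integrable M (\<lambda>\<omega>. real (L \<omega>))"
  shows "integrable M (\<lambda>\<omega>. real (X i \<omega>))" and "mean M (X i) = pmf c i * mean M L"
proof -
  note [measurable] = X_measurable[OF i]
  show int: "integrable M (\<lambda>\<omega>. real (X i \<omega>))"
    by (rule Bochner_Integration.integrable_bound[OF L]) (use AE_count_le[OF i] in auto)
  then have "integrable M (\<lambda>\<omega>. (\<lambda>x. real (x i)) (\<lambda>l\<in>I. X l \<omega>))" using i by simp
  from expectation_by_length(3)[OF this, of "\<lambda>n. real n * pmf c i"]
  show "mean M (X i) = pmf c i * mean M L"
    using i by (simp add: word_mean mult.commute)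
qed

text \<open>
  No count exceeds the length, so the square of the length is a majorant.
\<close>

lemma integrable_product_counts:
  assumes i: "i \<in> I" "j \<in> I" and L: "integrable M (\<lambda>\<omega>. (real (L \<omega>))\<^sup>2)"
  shows "integrable M (\<lambda>\<omega>. real (X i \<omega>) * real (X j \<omega>))"
proof (rule Bochner_Integration.integrable_bound[OF L])
  note [measurable] = X_measurable[OF i(1)] X_measurable[OF i(2)]
  show "(\<lambda>\<omega>. real (X i \<omega>) * real (X j \<omega>)) \<in> borel_measurable M" by measurable
  show "AE \<omega> in M. norm (real (X i \<omega>) * real (X j \<omega>)) \<le> norm ((real (L \<omega>))\<^sup>2)"
    using AE_count_le[OF i(1)] AE_count_le[OF i(2)]
    by eventually_elim (simp add: power2_eq_square mult_mono)
qed

lemma integrable_of_square: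
  assumes L: "integrable M (\<lambda>\<omega>. (real (L \<omega>))\<^sup>2)"
  shows "integrable M (\<lambda>\<omega>. real (L \<omega>))"
  by (rule square_integrable_imp_integrable[OF _ L]) simp

lemma second_moment_length:
  assumes L: "integrable M (\<lambda>\<omega>. (real (L \<omega>))\<^sup>2)"
  shows "expectation (\<lambda>\<omega>. real (L \<omega>) * real (L \<omega> - 1)) = var M L + (mean M L)\<^sup>2 - mean M L"
    and "integrable M (\<lambda>\<omega>. real (L \<omega>) * real (L \<omega> - 1))"
proof -
  have eq: "real (L \<omega>) * real (L \<omega> - 1) = (real (L \<omega>))\<^sup>2 - real (L \<omega>)" for \<omega>
    by (cases "L \<omega>") (simp_all add: power2_eq_square algebra_simps)
  note int = integrable_of_square[OF L]
  show "expectation (\<lambda>\<omega>. real (L \<omega>) * real (L \<omega> - 1)) = var M L + (mean M L)\<^sup>2 - mean M L"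
    unfolding eq using L int by (simp add: variance_eq)
  show "integrable M (\<lambda>\<omega>. real (L \<omega>) * real (L \<omega> - 1))"
    unfolding eq using L int by simp
qed

text \<open>
  The second moment of a binomial count is \<open>n * p + n * (n - 1) * p\<^sup>2\<close>; replacing \<open>n\<close> by the random
  length leaves the first two moments of \<open>L\<close>.
\<close>

lemma var_count:
  assumes i: "i \<in> I" and L: "integrable M (\<lambda>\<omega>. (real (L \<omega>))\<^sup>2)"
  shows "integrable M (\<lambda>\<omega>. (real (X i \<omega>))\<^sup>2)"
    and "var M (X i) = pmf c i * (pmf c i * var M L + (1 - pmf c i) * mean M L)"
proof -
  note int = integrable_of_square[OF L]
  show sq: "integrable M (\<lambda>\<omega>. (real (X i \<omega>))\<^sup>2)"
    using integrable_product_counts[OF i i L] by (simp add: power2_eq_square)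
  then have "integrable M (\<lambda>\<omega>. (\<lambda>x. (real (x i))\<^sup>2) (\<lambda>l\<in>I. X l \<omega>))" using i by simp
  from expectation_by_length(3)[OF this, of "\<lambda>n. real n * pmf c i * (1 + real (n - 1) * pmf c i)"]
  have "expectation (\<lambda>\<omega>. (real (X i \<omega>))\<^sup>2) =
      expectation (\<lambda>\<omega>. real (L \<omega>) * pmf c i * (1 + real (L \<omega> - 1) * pmf c i))"
    using i by (simp add: word_mean_square)
  also have "\<dots> = expectation (\<lambda>\<omega>. pmf c i * real (L \<omega>) + (pmf c i)\<^sup>2 * (real (L \<omega>) * real (L \<omega> - 1)))"
    by (intro Bochner_Integration.integral_cong refl) (simp add: power2_eq_square algebra_simps)
  also have "\<dots> = pmf c i * mean M L + (pmf c i)\<^sup>2 * (var M L + (mean M L)\<^sup>2 - mean M L)"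
    using second_moment_length[OF L] int by simp
  finally show "var M (X i) = pmf c i * (pmf c i * var M L + (1 - pmf c i) * mean M L)"
    using variance_eq[OF mean_count(1)[OF i int] sq] mean_count(2)[OF i int]
    by (simp add: power2_eq_square algebra_simps)
qed

lemma cov_counts:
  assumes i: "i \<in> I" "j \<in> I" "i \<noteq> j" and L: "integrable M (\<lambda>\<omega>. (real (L \<omega>))\<^sup>2)"
  shows "cov M (X i) (X j) = pmf c i * pmf c j * (var M L - mean M L)"
proof -
  note int = integrable_of_square[OF L]
  note ints = mean_count(1)[OF i(1) int] mean_count(1)[OF i(2) int] integrable_product_counts[OF i(1,2) L]
  from ints(3) have "integrable M (\<lambda>\<omega>. (\<lambda>x. real (x i) * real (x j)) (\<lambda>l\<in>I. X l \<omega>))" using i by simp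
  from expectation_by_length(3)[OF this, of "\<lambda>n. real n * real (n - 1) * pmf c i * pmf c j"]
  have "expectation (\<lambda>\<omega>. real (X i \<omega>) * real (X j \<omega>)) =
      expectation (\<lambda>\<omega>. real (L \<omega>) * real (L \<omega> - 1) * pmf c i * pmf c j)"
    using i by (simp add: word_mean_product del: of_nat_diff)
  also have "\<dots> = (var M L + (mean M L)\<^sup>2 - mean M L) * pmf c i * pmf c j"
    using second_moment_length[OF L] by simp
  finally have prod: "expectation (\<lambda>\<omega>. real (X i \<omega>) * real (X j \<omega>)) =
      (var M L + (mean M L)\<^sup>2 - mean M L) * pmf c i * pmf c j" .
  have "cov M (X i) (X j) = expectation (\<lambda>\<omega>. real (X i \<omega>) * real (X j \<omega>) - mean M (X j) * real (X i \<omega>)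
      - mean M (X i) * real (X j \<omega>) + mean M (X i) * mean M (X j))"
    unfolding cov_def by (intro Bochner_Integration.integral_cong) (simp_all add: algebra_simps)
  also have "\<dots> = expectation (\<lambda>\<omega>. real (X i \<omega>) * real (X j \<omega>)) - mean M (X i) * mean M (X j)"
    using ints by (simp add: prob_space)
  finally show ?thesis
    unfolding prod mean_count(2)[OF i(1) int] mean_count(2)[OF i(2) int]
    by (simp add: power2_eq_square algebra_simps)
qed

lemma fisher_index_count:
  assumes i: "i \<in> I" "pmf c i > 0" and L: "integrable M (\<lambda>\<omega>. (real (L \<omega>))\<^sup>2)" and m: "mean M L \<noteq> 0"
  shows "fisher_index M (X i) = 1 + pmf c i * (fisher_index M L - 1)"
proof -
  define v \<mu> where "v = var M L" and "\<mu> = mean M L"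
  have "fisher_index M (X i) = pmf c i * (pmf c i * v + (1 - pmf c i) * \<mu>) / (pmf c i * \<mu>)"
    unfolding fisher_index_def var_count(2)[OF i(1) L] v_def \<mu>_def
    unfolding mean_count(2)[OF i(1) integrable_of_square[OF L]] ..
  also have "\<dots> = 1 + pmf c i * (v / \<mu> - 1)"
    using i m by (simp add: \<mu>_def[symmetric] field_simps)
  finally show ?thesis by (simp only: fisher_index_def v_def \<mu>_def)
qed

text \<open>
  Write \<open>v\<close> and \<open>m\<close> for the variance and the mean of \<open>L\<close>. Then \<open>FI (X l) - 1 = p l * (v - m) / m\<close> for
  both letters, so the radicand of \<open>R\<close> contains \<open>(v - m)\<^sup>2\<close> and \<open>R\<close> recovers the correlation
  only up to the sign of \<open>v - m\<close>.
\<close>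

lemma cor_counts:
  assumes i: "i \<in> I" "j \<in> I" "i \<noteq> j" "pmf c i > 0" "pmf c j > 0"
    and L: "integrable M (\<lambda>\<omega>. (real (L \<omega>))\<^sup>2)" and nz: "var M (X i) \<noteq> 0" "var M (X j) \<noteq> 0"
  defines "R \<equiv> sqrt ((fisher_index M (X i) - 1) * (fisher_index M (X j) - 1) /
      (fisher_index M (X i) * fisher_index M (X j)))"
  shows "cor M (X i) (X j) = sqrt (pmf c i * pmf c j) * (var M L - mean M L) /
      sqrt ((pmf c i * var M L + (1 - pmf c i) * mean M L) * (pmf c j * var M L + (1 - pmf c j) * mean M L))"
    and "var M L \<ge> mean M L \<Longrightarrow> cor M (X i) (X j) = R"
    and "var M L < mean M L \<Longrightarrow> cor M (X i) (X j) = - R"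
proof -
  define v m where "v = var M L" and "m = mean M L"
  define a where "a l = pmf c l * v + (1 - pmf c l) * m" for l
  have var: "var M (X l) = pmf c l * a l" if "l \<in> I" for l
    using var_count(2)[OF that L] by (simp add: a_def v_def m_def)
  have a_pos: "a l > 0" if "l \<in> I" "pmf c l > 0" "var M (X l) \<noteq> 0" for l
  proof -
    have "var M (X l) > 0" using that(3) by (simp add: less_le variance_positive)
    then show ?thesis using that var[OF that(1)] by (simp add: zero_less_mult_iff)
  qed
  have a: "a i > 0" "a j > 0" using a_pos i nz by auto
  \<comment> \<open>A length with mean 0 vanishes almost surely, and then so would the variances of the counts.\<close>
  have m: "m \<noteq> 0"
  proof
    assume 0: "m = 0"
    then have L0: "AE \<omega> in M. real (L \<omega>) = 0"
      unfolding m_def using integrable_of_square[OF L] by (subst (asm) integral_nonneg_eq_0_iff_AE) auto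
    have "v = (\<integral>\<omega>. 0 \<partial>M)"
      unfolding v_def m_def[symmetric] 0 by (intro integral_cong_AE) (use L0 in auto)
    then show False using a 0 by (simp add: a_def)
  qed
  then have m_pos: "m > 0" unfolding m_def by (simp add: less_le)
  have "sqrt (var M (X i) * var M (X j)) = sqrt (pmf c i * pmf c j) * sqrt (a i * a j)"
    using var i by (simp add: real_sqrt_mult)
  moreover have "pmf c i * pmf c j = sqrt (pmf c i * pmf c j) * sqrt (pmf c i * pmf c j)"
    using i by simp
  moreover have "cov M (X i) (X j) = pmf c i * pmf c j * (v - m)"
    unfolding v_def m_def by (rule cov_counts[OF i(1-3) L])
  moreover have "sqrt (pmf c i * pmf c j) \<noteq> 0" using i by simp
  ultimately have main: "cor M (X i) (X j) = sqrt (pmf c i * pmf c j) * (v - m) / sqrt (a i * a j)"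
    unfolding cor_def by (metis (no_types, lifting) mult.assoc mult_divide_mult_cancel_left)
  then show "cor M (X i) (X j) = sqrt (pmf c i * pmf c j) * (var M L - mean M L) /
      sqrt ((pmf c i * var M L + (1 - pmf c i) * mean M L) * (pmf c j * var M L + (1 - pmf c j) * mean M L))"
    by (simp only: a_def v_def m_def)
  have F: "fisher_index M (X l) = a l / m" if "l \<in> I" "pmf c l > 0" for l
    unfolding fisher_index_def var[OF that(1)]
    unfolding mean_count(2)[OF that(1) integrable_of_square[OF L]]
    using that by (simp add: m_def)
  have F1: "fisher_index M (X l) - 1 = pmf c l * (v - m) / m" if "l \<in> I" "pmf c l > 0" for l
    unfolding F[OF that] using m by (simp add: a_def field_simps)
  have "(fisher_index M (X i) - 1) * (fisher_index M (X j) - 1) / (fisher_index M (X i) * fisher_index M (X j)) =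
      pmf c i * pmf c j * (v - m)\<^sup>2 / (a i * a j)"
    unfolding F1[OF i(1,4)] F1[OF i(2,5)]
    unfolding F[OF i(1,4)] F[OF i(2,5)]
    using m a by (simp add: field_simps power2_eq_square)
  then have R: "R = sqrt (pmf c i * pmf c j) * \<bar>v - m\<bar> / sqrt (a i * a j)"
    unfolding R_def by (simp add: real_sqrt_mult real_sqrt_divide)
  show "cor M (X i) (X j) = R" if "var M L \<ge> mean M L"
  proof -
    have "v \<ge> m" unfolding v_def m_def by (rule that)
    then show ?thesis unfolding main R by simp
  qed
  show "cor M (X i) (X j) = - R" if "var M L < mean M L"
  proof -
    have "v < m" unfolding v_def m_def by (rule that)
    then have "\<bar>v - m\<bar> = - (v - m)" by simp
    then show ?thesis unfolding main R by (simp only: mult_minus_right minus_divide_left minus_minus)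
  qed
qed

end

section \<open>Conditional distributions\<close>

context counts_of_random_word begin

lemma cond_prob_counts:
  assumes i: "i \<in> I" "j \<in> I" "i \<noteq> j" "pmf c i > 0" "pmf c j > 0"
  shows "\<P>(\<omega> in M. X i \<omega> = x \<bar> X j \<omega> = y) = pmf c i ^ x / fact x *
    ((\<Sum>m. fact (m + x + y) / fact m * (1 - (pmf c i + pmf c j)) ^ m * \<P>(\<omega> in M. L \<omega> = m + x + y)) /
     (\<Sum>m. fact (m + y) / fact m * (1 - pmf c j) ^ m * \<P>(\<omega> in M. L \<omega> = m + y)))"
  unfolding cond_prob_def prob_two_counts_series(2)[OF i] prob_count_series(2)[OF i(2,5)]
  using i by simp

text \<open>
  The numerator of the conditional expectation is \<open>z ^ X i\<close> integrated over the event \<open>X j = y\<close>. Its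
  series is absolutely convergent whenever the conditional generating function exists, by
  \<open>expectation_by_length\<close>. The factor \<open>pmf c j ^ y / fact y\<close> cancels against the denominator.
\<close>

lemma pgf_given_count:
  assumes i: "i \<in> I" "j \<in> I" "i \<noteq> j" "pmf c j > 0" and nz: "\<P>(\<omega> in M. X j \<omega> = y) \<noteq> 0"
  defines "C \<equiv> uniform_measure M {\<omega> \<in> space M. X j \<omega> = y}"
  assumes ex: "pgf_exists C (X i) z"
  defines "a \<equiv> \<lambda>m. fact (m + y) / fact m * (pmf c i * z + 1 - pmf c i - pmf c j) ^ m * \<P>(\<omega> in M. L \<omega> = m + y)"
  shows "summable a"
    and "pgf C (X i) z =
      (\<Sum>m. a m) / (\<Sum>m. fact (m + y) / fact m * (1 - pmf c j) ^ m * \<P>(\<omega> in M. L \<omega> = m + y))"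
proof -
  note [measurable] = X_measurable[OF i(1)] X_measurable[OF i(2)]
  let ?S = "{\<omega> \<in> space M. X j \<omega> = y}"
  have S: "?S \<in> events" by measurable
  have meas: "(\<lambda>\<omega>. z ^ X i \<omega>) \<in> borel_measurable M" by measurable
  have eq: "z ^ X i \<omega> * indicator ?S \<omega> = (\<lambda>x. z ^ x i * of_bool (x j = y)) (\<lambda>l\<in>I. X l \<omega>)"
    if "\<omega> \<in> space M" for \<omega>
    using that i by (simp add: indicator_def)
  have "integrable M (\<lambda>\<omega>. z ^ X i \<omega> * indicator ?S \<omega>)"
    using ex integrable_uniform_measure[OF S nz meas] by (simp add: C_def pgf_exists_def)
  then have "integrable M (\<lambda>\<omega>. (\<lambda>x. z ^ x i * of_bool (x j = y)) (\<lambda>l\<in>I. X l \<omega>))"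
    by (subst (asm) Bochner_Integration.integrable_cong[OF refl eq]) auto
  from expectation_by_length(1)[OF this, of "\<lambda>n. count_weight {j} (pmf c) (pmf c i * z + 1 - pmf c i - pmf c j) n (\<lambda>_. y)"]
  have "(\<lambda>n. count_weight {j} (pmf c) (pmf c i * z + 1 - pmf c i - pmf c j) n (\<lambda>_. y) * \<P>(\<omega> in M. L \<omega> = n))
      sums expectation (\<lambda>\<omega>. z ^ X i \<omega> * indicator ?S \<omega>)"
    using i by (simp add: word_pgf_given_count Bochner_Integration.integral_cong[OF refl eq])
  from count_weight_series[OF _ _ this] i
  have s: "a sums (expectation (\<lambda>\<omega>. z ^ X i \<omega> * indicator ?S \<omega>) / (pmf c j ^ y / fact y))"
    by (simp add: a_def)
  show "summable a" using s by (rule sums_summable)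
  show "pgf C (X i) z =
      (\<Sum>m. a m) / (\<Sum>m. fact (m + y) / fact m * (1 - pmf c j) ^ m * \<P>(\<omega> in M. L \<omega> = m + y))"
    unfolding pgf_def C_def integral_uniform_measure[OF S nz meas] sums_unique[OF s, symmetric]
    unfolding prob_count_series(2)[OF i(2,4)] using i by simp
qed

text \<open>
  Size biasing removes one letter \<open>i\<close>, leaving a word of length \<open>n - 1\<close> with \<open>y\<close> letters \<open>j\<close>. Hence the
  series starts at length \<open>y + 1\<close> instead of \<open>y\<close>.
\<close>

lemma mean_given_count:
  assumes i: "i \<in> I" "j \<in> I" "i \<noteq> j" "pmf c i > 0" "pmf c j > 0"
    and nz: "\<P>(\<omega> in M. X j \<omega> = y) \<noteq> 0"
  defines "C \<equiv> uniform_measure M {\<omega> \<in> space M. X j \<omega> = y}"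
  assumes ex: "integrable C (\<lambda>\<omega>. real (X i \<omega>))"
  defines "a \<equiv> \<lambda>m. fact (m + (y + 1)) / fact m * (1 - pmf c j) ^ m * \<P>(\<omega> in M. L \<omega> = m + (y + 1))"
  shows "summable a"
    and "mean C (X i) =
      pmf c i * ((\<Sum>m. a m) / (\<Sum>m. fact (m + y) / fact m * (1 - pmf c j) ^ m * \<P>(\<omega> in M. L \<omega> = m + y)))"
proof -
  note [measurable] = X_measurable[OF i(1)] X_measurable[OF i(2)]
  let ?S = "{\<omega> \<in> space M. X j \<omega> = y}"
  have S: "?S \<in> events" by measurable
  have meas: "(\<lambda>\<omega>. real (X i \<omega>)) \<in> borel_measurable M" by measurable
  have eq: "real (X i \<omega>) * indicator ?S \<omega> = (\<lambda>x. real (x i) * of_bool (x j = y)) (\<lambda>l\<in>I. X l \<omega>)"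
    if "\<omega> \<in> space M" for \<omega>
    using that i by (simp add: indicator_def)
  let ?w = "\<lambda>n. count_weight {j} (pmf c) (1 - pmf c j) n (\<lambda>_. y)"
  let ?T = "expectation (\<lambda>\<omega>. real (X i \<omega>) * indicator ?S \<omega>)"
  have "integrable M (\<lambda>\<omega>. real (X i \<omega>) * indicator ?S \<omega>)"
    using ex integrable_uniform_measure[OF S nz meas] by (simp add: C_def)
  then have "integrable M (\<lambda>\<omega>. (\<lambda>x. real (x i) * of_bool (x j = y)) (\<lambda>l\<in>I. X l \<omega>))"
    by (subst (asm) Bochner_Integration.integrable_cong[OF refl eq]) auto
  from expectation_by_length(1)[OF this, of "\<lambda>n. real n * pmf c i * ?w (n - 1)"]
  have "(\<lambda>n. real n * pmf c i * ?w (n - 1) * \<P>(\<omega> in M. L \<omega> = n)) sums ?T"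
    using i by (simp add: word_mean_given_count Bochner_Integration.integral_cong[OF refl eq])
  then have "(\<lambda>n. real (n + 1) * pmf c i * ?w (n + 1 - 1) * \<P>(\<omega> in M. L \<omega> = n + 1)) sums ?T"
    by (subst sums_zero_iff_shift) auto
  then have "(\<lambda>n. ?w n * (real (n + 1) * pmf c i * \<P>(\<omega> in M. L \<omega> = n + 1))) sums ?T"
    by (simp add: mult_ac)
  from count_weight_series[OF _ _ this] i
  have "(\<lambda>m. fact (m + y) / fact m * (1 - pmf c j) ^ m *
      (real (m + y + 1) * pmf c i * \<P>(\<omega> in M. L \<omega> = m + y + 1))) sums (?T / (pmf c j ^ y / fact y))"
    by simp
  then have "(\<lambda>m. fact (m + y) / fact m * (1 - pmf c j) ^ m *
      (real (m + y + 1) * pmf c i * \<P>(\<omega> in M. L \<omega> = m + y + 1)) / pmf c i) sums (?T / (pmf c j ^ y / fact y) / pmf c i)"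
    by (rule sums_divide)
  then have s: "a sums (?T / (pmf c j ^ y / fact y) / pmf c i)"
    using i by (simp add: a_def mult_ac)
  show "summable a" using s by (rule sums_summable)
  show "mean C (X i) =
      pmf c i * ((\<Sum>m. a m) / (\<Sum>m. fact (m + y) / fact m * (1 - pmf c j) ^ m * \<P>(\<omega> in M. L \<omega> = m + y)))"
    unfolding C_def integral_uniform_measure[OF S nz meas] sums_unique[OF s, symmetric]
    unfolding prob_count_series(2)[OF i(2,5)] using i by simp
qed

text \<open>
  The numerator series of the conditional mean is the series that gives \<open>P(X j = y + 1)\<close>, up to its
  prefactor.
\<close>

lemma mean_given_count_ratio:
  assumes i: "i \<in> I" "j \<in> I" "i \<noteq> j" "pmf c i > 0" "pmf c j > 0"
    and nz: "\<P>(\<omega> in M. X j \<omega> = y) \<noteq> 0"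
  defines "C \<equiv> uniform_measure M {\<omega> \<in> space M. X j \<omega> = y}"
  assumes ex: "integrable C (\<lambda>\<omega>. real (X i \<omega>))"
  shows "mean C (X i) = pmf c i / pmf c j * (real y + 1) *
    (\<P>(\<omega> in M. X j \<omega> = y + 1) / \<P>(\<omega> in M. X j \<omega> = y))"
proof -
  define b where "b n = (\<Sum>m. fact (m + n) / fact m * (1 - pmf c j) ^ m * \<P>(\<omega> in M. L \<omega> = m + n))" for n
  have P: "\<P>(\<omega> in M. X j \<omega> = n) = pmf c j ^ n / fact n * b n" for n
    unfolding b_def by (rule prob_count_series(2)[OF i(2,5)])
  have "mean C (X i) = pmf c i * (b (y + 1) / b y)"
    unfolding C_def b_def by (rule mean_given_count(2)[OF i nz ex[unfolded C_def]])
  moreover have "\<P>(\<omega> in M. X j \<omega> = y + 1) / \<P>(\<omega> in M. X j \<omega> = y) = pmf c j / (real y + 1) * (b (y + 1) / b y)"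
  proof -
    define q where "q = real y + 1"
    have "q \<noteq> 0" "fact (y + 1) = q * fact y" by (simp_all add: q_def add.commute)
    moreover have "b y \<noteq> 0" using nz unfolding P by auto
    ultimately show ?thesis unfolding P q_def[symmetric] using i by (simp add: field_simps del: fact_Suc)
  qed
  moreover have "pmf c j \<noteq> 0" "real y + 1 \<noteq> 0" using i by simp_all
  ultimately show ?thesis by simp
qed

text \<open>
  The counts sum to the length almost surely, so conditioning on their sum fixes the length and makes
  the count of \<open>i\<close> binomial.
\<close>

lemma count_given_length_binomial:
  assumes i: "i \<in> I" and nz: "\<P>(\<omega> in M. (\<Sum>l\<in>I. X l \<omega>) = n) \<noteq> 0"
  shows "distr (uniform_measure M {\<omega> \<in> space M. (\<Sum>l\<in>I. X l \<omega>) = n}) (count_space UNIV) (X i) =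
    measure_pmf (binomial_pmf n (pmf c i))" (is "?D = _")
proof (rule measure_eqI_countable[where A=UNIV])
  note [measurable] = X_measurable
  let ?S = "{\<omega> \<in> space M. (\<Sum>l\<in>I. X l \<omega>) = n}"
  have S: "?S \<in> events" by measurable
  fix x
  have "emeasure ?D {x} = emeasure (uniform_measure M ?S) {\<omega> \<in> space M. X i \<omega> = x}"
  proof (subst emeasure_distr)
    have "X i -` {x} \<inter> space M = {\<omega> \<in> space M. X i \<omega> = x}" by auto
    then show "emeasure (uniform_measure M ?S) (X i -` {x} \<inter> space (uniform_measure M ?S)) =
        emeasure (uniform_measure M ?S) {\<omega> \<in> space M. X i \<omega> = x}"
      by (simp only: space_uniform_measure)
  qed (use i in \<open>simp_all add: X_measurable\<close>)
  also have "\<dots> = emeasure M (?S \<inter> {\<omega> \<in> space M. X i \<omega> = x}) / emeasure M ?S"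
    using i by (intro emeasure_uniform_measure S) measurable
  also have "emeasure M (?S \<inter> {\<omega> \<in> space M. X i \<omega> = x}) = emeasure M {\<omega> \<in> space M. L \<omega> = n \<and> (\<forall>l\<in>{i}. X l \<omega> = x)}"
  proof (rule emeasure_eq_AE)
    show "?S \<inter> {\<omega> \<in> space M. X i \<omega> = x} \<in> sets M" using i S by measurable
    show "{\<omega> \<in> space M. L \<omega> = n \<and> (\<forall>l\<in>{i}. X l \<omega> = x)} \<in> sets M"
      using X_measurable[OF i] by simp
    show "AE \<omega> in M. (\<omega> \<in> ?S \<inter> {\<omega> \<in> space M. X i \<omega> = x}) =
        (\<omega> \<in> {\<omega> \<in> space M. L \<omega> = n \<and> (\<forall>l\<in>{i}. X l \<omega> = x)})"
      using AE_sum_counts by eventually_elim auto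
  qed
  also have "\<dots> = ennreal (count_weight {i} (pmf c) (1 - pmf c i) n (\<lambda>_. x) * \<P>(\<omega> in M. L \<omega> = n))"
    using prob_counts_and_length[of "{i}" n "\<lambda>_. x"] i by (simp add: emeasure_eq_measure)
  also have "emeasure M ?S = ennreal (\<P>(\<omega> in M. L \<omega> = n))"
    by (simp add: emeasure_eq_measure prob_sum_counts)
  also have "ennreal (count_weight {i} (pmf c) (1 - pmf c i) n (\<lambda>_. x) * \<P>(\<omega> in M. L \<omega> = n)) /
      ennreal (\<P>(\<omega> in M. L \<omega> = n)) = ennreal (count_weight {i} (pmf c) (1 - pmf c i) n (\<lambda>_. x))"
    using nz unfolding prob_sum_counts
    by (subst divide_ennreal) (auto simp: count_weight_single pmf_le_1 zero_less_measure_iff)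
  also have "count_weight {i} (pmf c) (1 - pmf c i) n (\<lambda>_. x) = pmf (binomial_pmf n (pmf c i)) x"
    by (simp add: count_weight_single pmf_le_1)
  finally show "emeasure ?D {x} = emeasure (measure_pmf (binomial_pmf n (pmf c i))) {x}"
    by (simp add: emeasure_pmf_single)
qed simp_all

end

section \<open>The counts of several letters together with the remaining length\<close>

context counts_of_random_word begin

text \<open>
  Since the counts of letters in \<open>A\<close> never add up to more than the length, the truncated difference is
  the true number of remaining letters, and prescribing it amounts to prescribing the length.
\<close>

lemma prob_counts_and_rest:
  assumes A: "A \<subseteq> I"
  shows "\<P>(\<omega> in M. (\<forall>l\<in>A. X l \<omega> = a l) \<and> L \<omega> - (\<Sum>l\<in>A. X l \<omega>) = m) =
    fact ((\<Sum>l\<in>A. a l) + m) / ((\<Prod>l\<in>A. fact (a l)) * fact m) *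
    ((\<Prod>l\<in>A. pmf c l ^ a l) * (1 - (\<Sum>l\<in>A. pmf c l)) ^ m) *
    \<P>(\<omega> in M. L \<omega> = (\<Sum>l\<in>A. a l) + m)"
proof -
  note [measurable] = X_measurable
  have fin: "finite A" using A finite_letters by (rule finite_subset)
  have AX: "X l \<in> measurable M (count_space UNIV)" if "l \<in> A" for l
    using A that X_measurable by auto
  have all: "{\<omega> \<in> space M. \<forall>l\<in>A. X l \<omega> = a l} \<in> sets M"
    using fin AX by (intro sets.sets_Collect_finite_All) auto
  have [measurable]: "(\<lambda>\<omega>. \<Sum>l\<in>A. X l \<omega>) \<in> measurable M (count_space UNIV)"
    using AX by (rule measurable_sum_nat)
  have "\<P>(\<omega> in M. (\<forall>l\<in>A. X l \<omega> = a l) \<and> L \<omega> - (\<Sum>l\<in>A. X l \<omega>) = m) =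
      \<P>(\<omega> in M. L \<omega> = (\<Sum>l\<in>A. a l) + m \<and> (\<forall>l\<in>A. X l \<omega> = a l))"
  proof (rule measure_eq_AE)
    show "AE \<omega> in M. (\<omega> \<in> {\<omega> \<in> space M. (\<forall>l\<in>A. X l \<omega> = a l) \<and> L \<omega> - (\<Sum>l\<in>A. X l \<omega>) = m}) =
        (\<omega> \<in> {\<omega> \<in> space M. L \<omega> = (\<Sum>l\<in>A. a l) + m \<and> (\<forall>l\<in>A. X l \<omega> = a l)})"
      using AE_sum_counts
    proof eventually_elim
      case (elim \<omega>)
      have "(\<Sum>l\<in>A. X l \<omega>) \<le> L \<omega>"
        using sum_mono2[OF finite_letters A, of "\<lambda>l. X l \<omega>"] elim by simp
      then show ?case by auto
    qed
    show "{\<omega> \<in> space M. (\<forall>l\<in>A. X l \<omega> = a l) \<and> L \<omega> - (\<Sum>l\<in>A. X l \<omega>) = m} \<in> sets M"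
      by (intro sets.sets_Collect_conj all) measurable
    show "{\<omega> \<in> space M. L \<omega> = (\<Sum>l\<in>A. a l) + m \<and> (\<forall>l\<in>A. X l \<omega> = a l)} \<in> sets M"
      by (intro sets.sets_Collect_conj all) measurable
  qed
  also have "\<dots> = count_weight A (pmf c) (1 - (\<Sum>l\<in>A. pmf c l)) ((\<Sum>l\<in>A. a l) + m) a *
      \<P>(\<omega> in M. L \<omega> = (\<Sum>l\<in>A. a l) + m)"
    by (rule prob_counts_and_length[OF A])
  finally show ?thesis by (simp add: count_weight_def)
qed

end

text \<open>
  Merging all letters outside the chosen ones into one letter again yields a word with independent
  letters and the same length. Both sides are laws on a countable set, so it suffices to compare
  points; there both reduce to the multinomial formula for the merged alphabet. When all letters
  are chosen, the merged letter has probability \<open>0\<close>.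
\<close>

lemma (in prob_space) counts_and_rest_law:
  fixes N :: "'a \<Rightarrow> nat" and i :: "nat \<Rightarrow> nat"
  assumes W: "counts_of_random_word M (\<lambda>\<omega>. s * N \<omega>) I c X"
    and s: "s \<ge> 1" and N: "N \<in> measurable M (count_space UNIV)"
    and i: "inj_on i {1..r}" "i ` {1..r} \<subseteq> I"
    and q: "\<And>l. l \<in> {1..r} \<Longrightarrow> q l = pmf c (i l)" "q (r + 1) = 1 - (\<Sum>l=1..r. pmf c (i l))"
  shows "distr M (count_space (nat_vectors (r + 1)))
      (\<lambda>\<omega>. \<lambda>l\<in>{1..r + 1}. if l \<le> r then X (i l) \<omega> else N \<omega> * s - (\<Sum>l=1..r. X (i l) \<omega>)) =
    compound_multinomial (distr M (count_space UNIV) N) s (r + 1) q"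
proof -
  interpret W: counts_of_random_word M "\<lambda>\<omega>. s * N \<omega>" I c X by fact
  let ?V = "nat_vectors (r + 1)" and ?A = "i ` {1..r}"
  let ?Z = "\<lambda>\<omega>. \<lambda>l\<in>{1..r + 1}. if l \<le> r then X (i l) \<omega> else N \<omega> * s - (\<Sum>l=1..r. X (i l) \<omega>)"
  let ?\<nu> = "distr M (count_space UNIV) N"
  let ?P = "?\<nu> \<Otimes>\<^sub>M (\<Pi>\<^sub>M t\<in>{1::nat..}. multinomial s (r + 1) q)"
  have split: "{1..r + 1} = insert (r + 1) {1..r}" by auto
  have rest: "(\<Sum>l\<in>?A. f l) = (\<Sum>l=1..r. f (i l))" for f :: "nat \<Rightarrow> 'b :: comm_monoid_add"
    using i by (simp add: sum.reindex)
  have rest': "(\<Prod>l\<in>?A. f l) = (\<Prod>l=1..r. f (i l))" for f :: "nat \<Rightarrow> 'b :: comm_monoid_mult"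
    using i by (simp add: prod.reindex)
  have "(\<Sum>l\<in>?A. pmf c l) \<le> (\<Sum>l\<in>I. pmf c l)"
    using i W.finite_letters by (intro sum_mono2) auto
  also have "\<dots> = 1" using W.finite_letters W.letters by (rule sum_pmf_eq_1)
  finally have le1: "(\<Sum>l=1..r. pmf c (i l)) \<le> 1" unfolding rest .
  have q_nonneg: "0 \<le> q l" if "l \<in> {1..r + 1}" for l
    using that le1 q by (cases "l = r + 1") auto
  have "(\<Sum>l=1..r + 1. q l) = 1"
    unfolding split using q by simp
  then obtain c' where c': "\<And>l. l \<in> {1..r + 1} \<Longrightarrow> pmf c' l = q l" "set_pmf c' \<subseteq> {1..r + 1}"
    using exists_pmf_finite_support[of "{1..r + 1}" q] q_nonneg by auto
  have "prob_space ?\<nu>" "sets ?\<nu> = UNIV" using N by (auto intro!: prob_space_distr)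
  with s c' interpret K: counts_of_random_word ?P "\<lambda>(n, y). s * n" "{1..r + 1}" c' "\<lambda>l (n, y). \<Sum>t=1..n. y t l"
    by (rule compound_multinomial_law)
  have vec: "(\<lambda>(n, y). \<lambda>l\<in>{1..r + 1}. \<Sum>t=1..n. y t l) =
      (\<lambda>\<omega>. (\<lambda>x. x) (\<lambda>l\<in>{1..r + 1}. case \<omega> of (n, y) \<Rightarrow> \<Sum>t=1..n. y t l))"
    by (simp add: fun_eq_iff split_beta)
  have vec_measurable: "(\<lambda>(n, y). \<lambda>l\<in>{1..r + 1}. \<Sum>t=1..n. y t l) \<in> measurable ?P (count_space ?V)"
    unfolding vec by (rule K.measurable_counts) (simp add: nat_vectors_def)
  have Zset: "?Z -` {x} \<inter> space M =
      {\<omega> \<in> space M. (\<forall>l\<in>?A. X l \<omega> = x (the_inv_into {1..r} i l)) \<and> s * N \<omega> - (\<Sum>l\<in>?A. X l \<omega>) = x (r + 1)}"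
    if "x \<in> ?V" for x
  proof -
    have "?Z \<omega> = x \<longleftrightarrow> (\<forall>l\<in>{1..r}. X (i l) \<omega> = x l) \<and> N \<omega> * s - (\<Sum>l=1..r. X (i l) \<omega>) = x (r + 1)" for \<omega>
    proof -
      have "?Z \<omega> = x \<longleftrightarrow> (\<forall>l\<in>{1..r + 1}. ?Z \<omega> l = x l)"
        using that by (intro iffI ballI extensionalityI[of _ "{1..r + 1}"]) (auto simp: nat_vectors_def PiE_def)
      then show ?thesis unfolding split by auto
    qed
    moreover have "(\<forall>l\<in>?A. X l \<omega> = x (the_inv_into {1..r} i l)) \<longleftrightarrow> (\<forall>l\<in>{1..r}. X (i l) \<omega> = x l)" for \<omega>
      using i(1) by (simp add: the_inv_into_f_f)
    ultimately show ?thesis unfolding rest by (auto simp: mult.commute)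
  qed
  have AX: "X l \<in> measurable M (count_space UNIV)" if "l \<in> ?A" for l
    using i that W.X_measurable by auto
  have Z_measurable: "?Z \<in> measurable M (count_space ?V)"
    unfolding measurable_count_space_eq_countable[OF countable_nat_vectors]
  proof (intro conjI ballI)
    fix x assume x: "x \<in> ?V"
    have [measurable]: "(\<lambda>\<omega>. \<Sum>l\<in>?A. X l \<omega>) \<in> measurable M (count_space UNIV)"
      using AX by (rule measurable_sum_nat)
    show "?Z -` {x} \<inter> space M \<in> sets M"
      unfolding Zset[OF x]
    proof (intro sets.sets_Collect_conj sets.sets_Collect_finite_All)
      show "{\<omega> \<in> space M. s * N \<omega> - (\<Sum>l\<in>?A. X l \<omega>) = x (r + 1)} \<in> sets M" using N by measurable
    qed (use AX in auto)
  qed (auto simp: nat_vectors_def)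
  show ?thesis
  proof (rule measure_eqI_countable[OF _ _ countable_nat_vectors])
    show "sets (distr M (count_space ?V) ?Z) = Pow ?V"
      "sets (compound_multinomial ?\<nu> s (r + 1) q) = Pow ?V"
      by (simp_all add: compound_multinomial_def)
    fix x assume x: "x \<in> ?V"
    let ?a = "\<lambda>l. x (the_inv_into {1..r} i l)"
    have a: "?a (i l) = x l" if "l \<in> {1..r}" for l
      using i(1) that by (simp add: the_inv_into_f_f)
    have len: "measure ?P {\<omega> \<in> space ?P. (case \<omega> of (n, y) \<Rightarrow> s * n) = m} = \<P>(\<omega> in M. s * N \<omega> = m)" for m
    proof -
      have "prob_space (multinomial s (r + 1) q)" using c' by (rule prob_space_multinomial)
      then interpret Q: prob_space "\<Pi>\<^sub>M t\<in>{1::nat..}. multinomial s (r + 1) q"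
        by (intro prob_space_PiM)
      have "{\<omega> \<in> space ?P. (case \<omega> of (n, y) \<Rightarrow> s * n) = m} = fst -` {n. s * n = m} \<inter> space ?P"
        by auto
      moreover have "measure ?P (fst -` {n. s * n = m} \<inter> space ?P) = measure (distr ?P ?\<nu> fst) {n. s * n = m}"
        by (subst measure_distr) auto
      moreover have "measure ?\<nu> {n. s * n = m} = prob (N -` {n. s * n = m} \<inter> space M)"
        using N by (rule measure_distr) simp
      moreover have "N -` {n. s * n = m} \<inter> space M = {\<omega> \<in> space M. s * N \<omega> = m}" by auto
      ultimately show ?thesis unfolding Q.distr_pair_fst by simp
    qed
    have "emeasure (distr M (count_space ?V) ?Z) {x} =
        ennreal (\<P>(\<omega> in M. (\<forall>l\<in>?A. X l \<omega> = ?a l) \<and> s * N \<omega> - (\<Sum>l\<in>?A. X l \<omega>) = x (r + 1)))"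
      using x by (subst emeasure_distr[OF Z_measurable]) (simp_all only: Zset[OF x] emeasure_eq_measure, simp_all)
    also have "\<P>(\<omega> in M. (\<forall>l\<in>?A. X l \<omega> = ?a l) \<and> s * N \<omega> - (\<Sum>l\<in>?A. X l \<omega>) = x (r + 1)) =
        fact ((\<Sum>l=1..r. x l) + x (r + 1)) / ((\<Prod>l=1..r. fact (x l)) * fact (x (r + 1))) *
        ((\<Prod>l=1..r. q l ^ x l) * q (r + 1) ^ x (r + 1)) *
        \<P>(\<omega> in M. s * N \<omega> = (\<Sum>l=1..r. x l) + x (r + 1))"
      unfolding W.prob_counts_and_rest[OF i(2)] using q by (simp add: rest rest' a del: One_nat_def)
    also have "\<dots> = measure ?P {\<omega> \<in> space ?P. \<forall>l\<in>{1..r + 1}. (case \<omega> of (n, y) \<Rightarrow> \<Sum>t=1..n. y t l) = x l}"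
      unfolding K.prob_all_counts len multinomial_coeff_def
      by (simp add: c' mult_ac)
    also have "{\<omega> \<in> space ?P. \<forall>l\<in>{1..r + 1}. (case \<omega> of (n, y) \<Rightarrow> \<Sum>t=1..n. y t l) = x l} =
        (\<lambda>(n, y). \<lambda>l\<in>{1..r + 1}. \<Sum>t=1..n. y t l) -` {x} \<inter> space ?P"
      using x by (auto simp: nat_vectors_def fun_eq_iff PiE_def extensional_def restrict_def)
    also have "ennreal (measure ?P \<dots>) = emeasure (compound_multinomial ?\<nu> s (r + 1) q) {x}"
      unfolding compound_multinomial_def using x
      by (subst emeasure_distr[OF vec_measurable]) (simp_all only: K.emeasure_eq_measure, simp_all)
    finally show "emeasure (distr M (count_space ?V) ?Z) {x} =
        emeasure (compound_multinomial ?\<nu> s (r + 1) q) {x}" .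
  qed
qed

section \<open>The random sum of multinomial vectors\<close>

text \<open>
  The locale assumption concerns a joint law only, hence it can be pulled back along \<open>T\<close>.
\<close>

lemma (in prob_space) counts_of_random_word_distr:
  assumes T: "T \<in> measurable M P"
    and law: "counts_of_random_word (distr M P T) L I c X"
  shows "counts_of_random_word M (\<lambda>\<omega>. L (T \<omega>)) I c (\<lambda>l \<omega>. X l (T \<omega>))"
proof -
  interpret D: counts_of_random_word "distr M P T" L I c X by fact
  show ?thesis
  proof (unfold_locales)
    show "finite I" "set_pmf c \<subseteq> I" by (fact D.finite_letters D.letters)+
    show "(\<lambda>\<omega>. L (T \<omega>)) \<in> measurable M (count_space UNIV)"
      using D.L_measurable unfolding measurable_distr_eq1 by (rule measurable_compose[OF T])
    show "(\<lambda>\<omega>. X l (T \<omega>)) \<in> measurable M (count_space UNIV)" if "l \<in> I" for l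
      using D.X_measurable[OF that] unfolding measurable_distr_eq1 by (rule measurable_compose[OF T])
    fix n :: nat and B :: "(nat \<Rightarrow> nat) set"
    have pull: "\<P>(\<omega> in distr M P T. Q \<omega>) = \<P>(\<omega> in M. Q (T \<omega>))" if "Measurable.pred (distr M P T) Q" for Q
    proof -
      have "{x \<in> space P. Q x} \<in> sets P" using that by (simp add: pred_def)
      then have "\<P>(\<omega> in distr M P T. Q \<omega>) = prob (T -` {x \<in> space P. Q x} \<inter> space M)"
        using T by (simp add: measure_distr)
      also have "T -` {x \<in> space P. Q x} \<inter> space M = {\<omega> \<in> space M. Q (T \<omega>)}"
        using measurable_space[OF T] by auto
      finally show ?thesis .
    qed
    have "Measurable.pred (distr M P T) (\<lambda>\<omega>. L \<omega> = n \<and> (\<lambda>l\<in>I. X l \<omega>) \<in> B)"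
      "Measurable.pred (distr M P T) (\<lambda>\<omega>. L \<omega> = n)"
      by measurable
    then show "\<P>(\<omega> in M. L (T \<omega>) = n \<and> (\<lambda>l\<in>I. X l (T \<omega>)) \<in> B) =
        \<P>(\<omega> in M. L (T \<omega>) = n) * measure_pmf.prob (replicate_pmf n c) {w. (\<lambda>l\<in>I. count_list w l) \<in> B}"
      using D.law[of n B] pull by (simp only:)
  qed
qed

text \<open>
  The product law of an independent pair, for target spaces of different types.
\<close>

lemma (in prob_space) distr_indep_pair:
  assumes indep: "indep_rvs M S \<xi> T \<eta>"
  shows "distr M (S \<Otimes>\<^sub>M T) (\<lambda>\<omega>. (\<xi> \<omega>, \<eta> \<omega>)) = distr M S \<xi> \<Otimes>\<^sub>M distr M T \<eta>"
proof (rule pair_measure_eqI[symmetric])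
  have [measurable]: "\<xi> \<in> measurable M S" "\<eta> \<in> measurable M T"
    using indep by (auto simp: indep_rvs_def)
  show "sigma_finite_measure (distr M S \<xi>)" "sigma_finite_measure (distr M T \<eta>)"
    by (auto intro!: prob_space_imp_sigma_finite prob_space_distr)
  show "sets (distr M S \<xi> \<Otimes>\<^sub>M distr M T \<eta>) = sets (distr M (S \<Otimes>\<^sub>M T) (\<lambda>\<omega>. (\<xi> \<omega>, \<eta> \<omega>)))"
    by (simp cong: sets_pair_measure_cong)
  fix A B assume AB: "A \<in> sets (distr M S \<xi>)" "B \<in> sets (distr M T \<eta>)"
  then have [measurable]: "A \<in> sets S" "B \<in> sets T" by auto
  have "prob (\<xi> -` A \<inter> space M \<inter> (\<eta> -` B \<inter> space M)) = prob (\<xi> -` A \<inter> space M) * prob (\<eta> -` B \<inter> space M)"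
    using indep AB by (intro indep_setD[of "{\<xi> -` A \<inter> space M |A. A \<in> sets S}" "{\<eta> -` B \<inter> space M |B. B \<in> sets T}"])
      (auto simp: indep_rvs_def)
  moreover have "(\<lambda>\<omega>. (\<xi> \<omega>, \<eta> \<omega>)) -` (A \<times> B) \<inter> space M = \<xi> -` A \<inter> space M \<inter> (\<eta> -` B \<inter> space M)"
    by auto
  ultimately show "emeasure (distr M S \<xi>) A * emeasure (distr M T \<eta>) B =
      emeasure (distr M (S \<Otimes>\<^sub>M T) (\<lambda>\<omega>. (\<xi> \<omega>, \<eta> \<omega>))) (A \<times> B)"
    by (simp add: emeasure_distr emeasure_eq_measure ennreal_mult')
qed

text \<open>
  The joint law of \<open>N\<close> and the sequence of summands is the canonical product measure, by
  independence of \<open>N\<close> from the sequence and independence within the sequence.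
\<close>

lemma (in prob_space) random_multinomial_sum_law:
  fixes N :: "'a \<Rightarrow> nat"
  assumes s: "s \<ge> 1" and c: "\<And>l. l \<in> {1..k} \<Longrightarrow> pmf c l = p l" "set_pmf c \<subseteq> {1..k}"
    and Y_indep: "indep_vars (\<lambda>_. count_space (nat_vectors k)) (\<lambda>t \<omega>. \<lambda>l\<in>{1..k}. Y l t \<omega>) {1..}"
    and Y_law: "\<And>t. t \<ge> 1 \<Longrightarrow>
          distr M (count_space (nat_vectors k)) (\<lambda>\<omega>. \<lambda>l\<in>{1..k}. Y l t \<omega>) = multinomial s k p"
    and N_indep: "indep_rvs M (count_space UNIV) N
          (\<Pi>\<^sub>M t\<in>{1..}. count_space (nat_vectors k)) (\<lambda>\<omega>. \<lambda>t\<in>{1..}. \<lambda>l\<in>{1..k}. Y l t \<omega>)"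
  shows "counts_of_random_word M (\<lambda>\<omega>. s * N \<omega>) {1..k} c (\<lambda>l \<omega>. if N \<omega> > 0 then \<Sum>t=1..N \<omega>. Y l t \<omega> else 0)"
proof -
  let ?V = "count_space (nat_vectors k)"
  let ?seq = "\<lambda>\<omega>. \<lambda>t\<in>{1..}. \<lambda>l\<in>{1..k}. Y l t \<omega>"
  let ?T = "\<lambda>\<omega>. (N \<omega>, ?seq \<omega>)"
  let ?P = "count_space UNIV \<Otimes>\<^sub>M (\<Pi>\<^sub>M t\<in>{1::nat..}. ?V)"
  have meas: "N \<in> measurable M (count_space UNIV)" "?seq \<in> measurable M (\<Pi>\<^sub>M t\<in>{1::nat..}. ?V)"
    using N_indep by (auto simp: indep_rvs_def)
  then have T: "?T \<in> measurable M ?P" by (rule measurable_Pair)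
  have rv: "(\<lambda>\<omega>. \<lambda>l\<in>{1..k}. Y l t \<omega>) \<in> measurable M ?V" if "t \<in> {1..}" for t
    using Y_indep that by (auto simp: indep_vars_def)
  have "distr M (\<Pi>\<^sub>M t\<in>{1::nat..}. ?V) ?seq =
      (\<Pi>\<^sub>M t\<in>{1::nat..}. distr M ?V (\<lambda>\<omega>. \<lambda>l\<in>{1..k}. Y l t \<omega>))"
    using Y_indep by (subst (asm) indep_vars_iff_distr_eq_PiM'[OF _ rv]) auto
  also have "\<dots> = (\<Pi>\<^sub>M t\<in>{1::nat..}. multinomial s k p)"
    by (intro PiM_cong refl) (simp only: Y_law atLeast_iff)
  finally have seq: "distr M (\<Pi>\<^sub>M t\<in>{1::nat..}. ?V) ?seq = (\<Pi>\<^sub>M t\<in>{1::nat..}. multinomial s k p)" .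
  have "prob_space (distr M (count_space UNIV) N)" "sets (distr M (count_space UNIV) N) = UNIV"
    using meas(1) by (auto intro!: prob_space_distr)
  with s c have "counts_of_random_word (distr M (count_space UNIV) N \<Otimes>\<^sub>M (\<Pi>\<^sub>M t\<in>{1..}. multinomial s k p))
      (\<lambda>(n, y). s * n) {1..k} c (\<lambda>l (n, y). \<Sum>t=1..n. y t l)"
    by (rule compound_multinomial_law)
  then have "counts_of_random_word (distr M ?P ?T) (\<lambda>(n, y). s * n) {1..k} c (\<lambda>l (n, y). \<Sum>t=1..n. y t l)"
    unfolding distr_indep_pair[OF N_indep] seq .
  from counts_of_random_word_distr[OF T this]
  interpret W: counts_of_random_word M "\<lambda>\<omega>. s * N \<omega>" "{1..k}" c "\<lambda>l \<omega>. \<Sum>t=1..N \<omega>. ?seq \<omega> t l"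
    by (simp only: case_prod_conv)
  have X: "(if N \<omega> > 0 then \<Sum>t=1..N \<omega>. Y l t \<omega> else 0) = (\<Sum>t=1..N \<omega>. ?seq \<omega> t l)" if "l \<in> {1..k}" for l \<omega>
    using that by auto
  have vec: "(\<lambda>l\<in>{1..k}. if N \<omega> > 0 then \<Sum>t=1..N \<omega>. Y l t \<omega> else 0) =
      (\<lambda>l\<in>{1..k}. \<Sum>t=1..N \<omega>. ?seq \<omega> t l)" for \<omega>
    using X by (intro restrict_ext)
  show ?thesis
  proof unfold_locales
    show "(\<lambda>\<omega>. if N \<omega> > 0 then \<Sum>t=1..N \<omega>. Y l t \<omega> else 0) \<in> measurable M (count_space UNIV)"
      if "l \<in> {1..k}" for l
      unfolding X[OF that] by (rule W.X_measurable[OF that])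
  qed (unfold vec, (rule W.finite_letters W.letters W.L_measurable W.law)+)
qed

text \<open>
  Turns a series over lengths, supported on the multiples of \<open>s\<close>, into a sum over the number of
  summands.
\<close>

lemma sum_up_to_mult:
  fixes f :: "nat \<Rightarrow> real"
  assumes s: "s \<ge> 1" and f: "\<And>n. f n \<ge> 0" "f 0 = 0" "\<And>n. \<not> s dvd n \<Longrightarrow> f n = 0" and T: "f sums T"
  shows "((\<lambda>n. f (n * s)) has_sum T) {1..}"
proof -
  have "(f has_sum T) UNIV" using T f(1) by (intro sums_nonneg_imp_has_sum)
  also have "(f has_sum T) UNIV \<longleftrightarrow> (f has_sum T) ((\<lambda>n. n * s) ` {1..})"
  proof (intro has_sum_cong_neutral)
    fix n assume n: "n \<in> UNIV - (\<lambda>n. n * s) ` {1..}"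
    show "f n = 0"
    proof (rule ccontr)
      assume "f n \<noteq> 0"
      then obtain m where "n = m * s" "m \<noteq> 0" using f by (metis dvd_div_mult_self mult_0)
      then show False using n by auto
    qed
  qed auto
  also have "\<dots> \<longleftrightarrow> ((f \<circ> (\<lambda>n. n * s)) has_sum T) {1..}"
    using s by (intro has_sum_reindex) (auto simp: inj_on_def)
  finally show ?thesis by (simp add: o_def)
qed

theorem theorem2:
  fixes M :: "'a measure" and k s :: nat and p :: "nat \<Rightarrow> real"
    and Y :: "nat \<Rightarrow> nat \<Rightarrow> 'a \<Rightarrow> nat" and N :: "'a \<Rightarrow> nat" and X :: "nat \<Rightarrow> 'a \<Rightarrow> nat"
  assumes prob_space: "prob_space M"
    and k_pos: "k \<ge> 1" and s_pos: "s \<ge> 1"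
    and p_pos: "\<And>l. l \<in> {1..k} \<Longrightarrow> p l > 0" and p_sum: "(\<Sum>l=1..k. p l) = 1"
    and Y_indep: "prob_space.indep_vars M (\<lambda>_. count_space (nat_vectors k))
          (\<lambda>t \<omega>. \<lambda>l\<in>{1..k}. Y l t \<omega>) {1..}"
    and Y_law: "\<And>t. t \<ge> 1 \<Longrightarrow>
          distr M (count_space (nat_vectors k)) (\<lambda>\<omega>. \<lambda>l\<in>{1..k}. Y l t \<omega>) = multinomial s k p"
    and N_indep: "indep_rvs M (count_space UNIV) N
          (\<Pi>\<^sub>M t\<in>{1..}. count_space (nat_vectors k)) (\<lambda>\<omega>. \<lambda>t\<in>{1..}. \<lambda>l\<in>{1..k}. Y l t \<omega>)"
    and X_def: "X = (\<lambda>l \<omega>. if N \<omega> > 0 then \<Sum>t=1..N \<omega>. Y l t \<omega> else 0)"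
  shows
    \<comment> \<open>1\<close>
    "(\<forall>z. joint_pgf_exists M {1..k} X z \<longrightarrow>
        pgf_exists M (\<lambda>\<omega>. s * N \<omega>) (\<Sum>l=1..k. p l * z l) \<and>
        joint_pgf M {1..k} X z = pgf M (\<lambda>\<omega>. s * N \<omega>) (\<Sum>l=1..k. p l * z l))
   \<and> \<comment> \<open>2\<close>
     (\<forall>x :: nat \<Rightarrow> nat. s dvd (\<Sum>l=1..k. x l) \<longrightarrow>
        \<P>(\<omega> in M. \<forall>l\<in>{1..k}. X l \<omega> = x l) =
          multinomial_coeff {1..k} x * (\<Prod>l=1..k. p l ^ x l)
            * \<P>(\<omega> in M. N \<omega> * s = (\<Sum>l=1..k. x l)))
   \<and> \<P>(\<omega> in M. \<forall>l\<in>{1..k}. X l \<omega> = 0) = \<P>(\<omega> in M. N \<omega> = 0)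
   \<and> \<comment> \<open>3\<close>
     (\<forall>r\<in>{1..k}. \<forall>i. inj_on i {1..r} \<and> i ` {1..r} \<subseteq> {1..k} \<longrightarrow>
        (\<forall>z. joint_pgf_exists M {1..r} (\<lambda>l. X (i l)) (\<lambda>l. z (i l)) \<longrightarrow>
           pgf_exists M (\<lambda>\<omega>. s * N \<omega>)
             ((\<Sum>l=1..r. p (i l) * z (i l)) + 1 - (\<Sum>l=1..r. p (i l))) \<and>
           joint_pgf M {1..r} (\<lambda>l. X (i l)) (\<lambda>l. z (i l)) =
             pgf M (\<lambda>\<omega>. s * N \<omega>)
               ((\<Sum>l=1..r. p (i l) * z (i l)) + 1 - (\<Sum>l=1..r. p (i l))))
      \<and> (\<forall>x :: nat \<Rightarrow> nat.
           let a = (\<lambda>m. fact (m + (\<Sum>l=1..r. x (i l))) / fact m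
                        * (1 - (\<Sum>l=1..r. p (i l))) ^ m
                        * \<P>(\<omega> in M. s * N \<omega> = m + (\<Sum>l=1..r. x (i l))))
           in summable a \<and>
              \<P>(\<omega> in M. \<forall>l\<in>{1..r}. X (i l) \<omega> = x (i l)) =
                (\<Prod>l=1..r. p (i l) ^ x (i l)) / (\<Prod>l=1..r. fact (x (i l))) * (\<Sum>m. a m))
      \<and> distr M (count_space (nat_vectors (r + 1)))
          (\<lambda>\<omega>. \<lambda>l\<in>{1..r + 1}. if l \<le> r then X (i l) \<omega> else N \<omega> * s - (\<Sum>l=1..r. X (i l) \<omega>)) =
        compound_multinomial (distr M (count_space UNIV) N) s (r + 1)
          (\<lambda>l. if l \<le> r then p (i l) else 1 - (\<Sum>l=1..r. p (i l))))
   \<and> \<comment> \<open>4\<close>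
     (\<forall>i\<in>{1..k}.
        (\<forall>m. let a = (\<lambda>j. fact (j + m) / fact j * (1 - p i) ^ j * \<P>(\<omega> in M. s * N \<omega> = j + m))
             in summable a \<and>
                \<P>(\<omega> in M. X i \<omega> = m) = p i ^ m / fact m * (\<Sum>j. a j))
      \<and> \<P>(\<omega> in M. X i \<omega> = 0) = pgf M (\<lambda>\<omega>. s * N \<omega>) (1 - p i)
      \<and> (\<forall>m\<ge>1. ((\<lambda>n. real (n * s choose m) * p i ^ m * (1 - p i) ^ (n * s - m)
                       * \<P>(\<omega> in M. N \<omega> = n)) has_sum \<P>(\<omega> in M. X i \<omega> = m)) {1..})
      \<and> (integrable M (\<lambda>\<omega>. real (N \<omega>)) \<longrightarrow>
           integrable M (\<lambda>\<omega>. real (X i \<omega>)) \<and> mean M (X i) = real s * p i * mean M N)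
      \<and> (integrable M (\<lambda>\<omega>. (real (N \<omega>))\<^sup>2) \<longrightarrow>
           integrable M (\<lambda>\<omega>. (real (X i \<omega>))\<^sup>2) \<and>
           var M (X i) = real s * p i * (real s * p i * var M N + (1 - p i) * mean M N) \<and>
           (mean M N \<noteq> 0 \<longrightarrow>
              fisher_index M (X i) = 1 + p i * (real s * fisher_index M N - 1))))
   \<and> \<comment> \<open>5 and 6\<close>
     (\<forall>i\<in>{1..k}. \<forall>j\<in>{1..k}. i \<noteq> j \<longrightarrow>
        (\<forall>xj. \<P>(\<omega> in M. X j \<omega> = xj) \<noteq> 0 \<longrightarrow>
          (let C = uniform_measure M {\<omega> \<in> space M. X j \<omega> = xj};
               b = (\<lambda>m. fact (xj + m) / fact m * (1 - p j) ^ m * \<P>(\<omega> in M. s * N \<omega> = xj + m))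
           in summable b
            \<and> (\<forall>xi.
                let a = (\<lambda>m. fact (m + xi + xj) / fact m * (1 - (p i + p j)) ^ m
                             * \<P>(\<omega> in M. s * N \<omega> = m + xi + xj))
                in summable a \<and>
                   \<P>(\<omega> in M. X i \<omega> = xi \<bar> X j \<omega> = xj) =
                     p i ^ xi / fact xi * ((\<Sum>m. a m) / (\<Sum>m. b m)))
            \<and> (\<forall>z. pgf_exists C (X i) z \<longrightarrow>
                (let a = (\<lambda>m. fact (xj + m) / fact m * (p i * z + 1 - p i - p j) ^ m
                              * \<P>(\<omega> in M. s * N \<omega> = xj + m))
                 in summable a \<and> pgf C (X i) z = (\<Sum>m. a m) / (\<Sum>m. b m)))
            \<and> (integrable C (\<lambda>\<omega>. real (X i \<omega>)) \<longrightarrow>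
                (let a = (\<lambda>m. fact (xj + m + 1) / fact m * (1 - p j) ^ m
                              * \<P>(\<omega> in M. s * N \<omega> = xj + m + 1))
                 in summable a \<and> mean C (X i) = p i * ((\<Sum>m. a m) / (\<Sum>m. b m))))
            \<and> (integrable C (\<lambda>\<omega>. real (X i \<omega>)) \<longrightarrow>
                mean C (X i) = p i / p j * (real xj + 1)
                  * (\<P>(\<omega> in M. X j \<omega> = xj + 1) / \<P>(\<omega> in M. X j \<omega> = xj)))))
      \<and> (integrable M (\<lambda>\<omega>. (real (N \<omega>))\<^sup>2) \<longrightarrow>
           cov M (X i) (X j) = real s * p i * p j * (- mean M N + real s * var M N)
         \<and> (var M (X i) \<noteq> 0 \<and> var M (X j) \<noteq> 0 \<longrightarrow>
              cor M (X i) (X j) =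
                sqrt (p i * p j) * (real s * var M N - mean M N)
                / sqrt ((real s * p i * var M N + mean M N * (1 - p i))
                        * (real s * p j * var M N + mean M N * (1 - p j)))
            \<and> (let R = sqrt ((fisher_index M (X i) - 1) * (fisher_index M (X j) - 1)
                              / (fisher_index M (X i) * fisher_index M (X j)))
               in (real s * var M N \<ge> mean M N \<longrightarrow> cor M (X i) (X j) = R)
                \<and> (real s * var M N < mean M N \<longrightarrow> cor M (X i) (X j) = - R)))))
   \<and> \<comment> \<open>7\<close>
     (\<forall>z. pgf_exists M (\<lambda>\<omega>. \<Sum>l=1..k. X l \<omega>) z \<longrightarrow>
        pgf_exists M (\<lambda>\<omega>. s * N \<omega>) z \<and>
        pgf M (\<lambda>\<omega>. \<Sum>l=1..k. X l \<omega>) z = pgf M (\<lambda>\<omega>. s * N \<omega>) z)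
   \<and> (\<forall>m. \<P>(\<omega> in M. (\<Sum>l=1..k. X l \<omega>) = m) = \<P>(\<omega> in M. s * N \<omega> = m))
   \<and> \<comment> \<open>8\<close>
     (\<forall>j\<ge>1. \<forall>i\<in>{1..k}. \<P>(\<omega> in M. (\<Sum>l=1..k. X l \<omega>) = j) \<noteq> 0 \<longrightarrow>
        distr (uniform_measure M {\<omega> \<in> space M. (\<Sum>l=1..k. X l \<omega>) = j}) (count_space UNIV) (X i) =
        measure_pmf (binomial_pmf j (p i)))"
proof -
  interpret prob_space M by (rule prob_space)
  define L where "L = (\<lambda>\<omega>. s * N \<omega>)"
  obtain c where c: "\<And>l. l \<in> {1..k} \<Longrightarrow> pmf c l = p l" "set_pmf c \<subseteq> {1..k}"
    using exists_pmf_finite_support[OF _ less_imp_le[OF p_pos] p_sum] by auto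
  have W: "counts_of_random_word M (\<lambda>\<omega>. s * N \<omega>) {1..k} c X"
    unfolding X_def using s_pos c Y_indep Y_law N_indep by (rule random_multinomial_sum_law)
  then interpret W: counts_of_random_word M L "{1..k}" c X by (simp only: L_def)
  have N [measurable]: "N \<in> measurable M (count_space UNIV)"
    using N_indep by (simp add: indep_rvs_def)
  have pos: "pmf c l > 0" if "l \<in> {1..k}" for l using c(1)[OF that] p_pos[OF that] by simp
  have s_real: "real s \<noteq> 0" using s_pos by simp
  have L_eq: "L \<omega> = n \<longleftrightarrow> s * N \<omega> = n" for \<omega> n by (simp add: L_def)
  have mean_L: "mean M L = real s * mean M N" by (simp add: L_def)
  have var_L: "var M L = (real s)\<^sup>2 * var M N"
    unfolding mean_L by (simp add: L_def right_diff_distrib[symmetric] power_mult_distrib)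
  have int_L: "integrable M (\<lambda>\<omega>. real (L \<omega>))" if "integrable M (\<lambda>\<omega>. real (N \<omega>))"
    using that by (simp add: L_def)
  have int_L2: "integrable M (\<lambda>\<omega>. (real (L \<omega>))\<^sup>2)" if "integrable M (\<lambda>\<omega>. (real (N \<omega>))\<^sup>2)"
    using that by (simp add: L_def power_mult_distrib)
  have fisher_L: "fisher_index M L = real s * fisher_index M N" if "mean M N \<noteq> 0"
    unfolding fisher_index_def var_L unfolding mean_L using s_real that by (simp add: power2_eq_square)
  have joint_law: "\<P>(\<omega> in M. \<forall>l\<in>{1..k}. X l \<omega> = x l) =
      multinomial_coeff {1..k} x * (\<Prod>l=1..k. p l ^ x l) * \<P>(\<omega> in M. N \<omega> * s = (\<Sum>l=1..k. x l))"
    for x :: "nat \<Rightarrow> nat"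
    using W.prob_all_counts[of x] c(1) by (simp add: L_def mult.commute)
  have subsets: "\<forall>r\<in>{1..k}. \<forall>i. inj_on i {1..r} \<and> i ` {1..r} \<subseteq> {1..k} \<longrightarrow>
        (\<forall>z. joint_pgf_exists M {1..r} (\<lambda>l. X (i l)) (\<lambda>l. z (i l)) \<longrightarrow>
           pgf_exists M (\<lambda>\<omega>. s * N \<omega>)
             ((\<Sum>l=1..r. p (i l) * z (i l)) + 1 - (\<Sum>l=1..r. p (i l))) \<and>
           joint_pgf M {1..r} (\<lambda>l. X (i l)) (\<lambda>l. z (i l)) =
             pgf M (\<lambda>\<omega>. s * N \<omega>)
               ((\<Sum>l=1..r. p (i l) * z (i l)) + 1 - (\<Sum>l=1..r. p (i l))))
      \<and> (\<forall>x :: nat \<Rightarrow> nat.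
           let a = (\<lambda>m. fact (m + (\<Sum>l=1..r. x (i l))) / fact m
                        * (1 - (\<Sum>l=1..r. p (i l))) ^ m
                        * \<P>(\<omega> in M. s * N \<omega> = m + (\<Sum>l=1..r. x (i l))))
           in summable a \<and>
              \<P>(\<omega> in M. \<forall>l\<in>{1..r}. X (i l) \<omega> = x (i l)) =
                (\<Prod>l=1..r. p (i l) ^ x (i l)) / (\<Prod>l=1..r. fact (x (i l))) * (\<Sum>m. a m))
      \<and> distr M (count_space (nat_vectors (r + 1)))
          (\<lambda>\<omega>. \<lambda>l\<in>{1..r + 1}. if l \<le> r then X (i l) \<omega> else N \<omega> * s - (\<Sum>l=1..r. X (i l) \<omega>)) =
        compound_multinomial (distr M (count_space UNIV) N) s (r + 1)
          (\<lambda>l. if l \<le> r then p (i l) else 1 - (\<Sum>l=1..r. p (i l)))"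
  proof (intro ballI allI impI)
    fix r and i :: "nat \<Rightarrow> nat" assume r: "r \<in> {1..k}" and "inj_on i {1..r} \<and> i ` {1..r} \<subseteq> {1..k}"
    then have i: "inj_on i {1..r}" "i ` {1..r} \<subseteq> {1..k}" by auto
    let ?A = "i ` {1..r}"
    have sum_A: "(\<Sum>l\<in>?A. f l) = (\<Sum>l=1..r. f (i l))" for f :: "nat \<Rightarrow> 'b :: comm_monoid_add"
      using i by (simp add: sum.reindex)
    have prod_A: "(\<Prod>l\<in>?A. f l) = (\<Prod>l=1..r. f (i l))" for f :: "nat \<Rightarrow> 'b :: comm_monoid_mult"
      using i by (simp add: prod.reindex)
    have p: "p (i l) = pmf c (i l)" if "l \<in> {1..r}" for l
    proof -
      have "i l \<in> {1..k}" using i(2) that by blast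
      then show ?thesis by (simp only: c(1))
    qed
    have sum_p: "(\<Sum>l=1..r. p (i l)) = (\<Sum>l=1..r. pmf c (i l))"
      by (intro sum.cong refl p)
    have sum_pz: "(\<Sum>l=1..r. p (i l) * z (i l)) = (\<Sum>l=1..r. pmf c (i l) * z (i l))" for z
      by (intro sum.cong refl) (simp only: p)
    have prod_p: "(\<Prod>l=1..r. p (i l) ^ x (i l)) = (\<Prod>l=1..r. pmf c (i l) ^ x (i l))" for x
      by (intro prod.cong refl) (simp only: p)
    have A_pos: "pmf c l > 0" if "l \<in> ?A" for l using pos i(2) that by auto
    show "(\<forall>z. joint_pgf_exists M {1..r} (\<lambda>l. X (i l)) (\<lambda>l. z (i l)) \<longrightarrow>
           pgf_exists M (\<lambda>\<omega>. s * N \<omega>)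
             ((\<Sum>l=1..r. p (i l) * z (i l)) + 1 - (\<Sum>l=1..r. p (i l))) \<and>
           joint_pgf M {1..r} (\<lambda>l. X (i l)) (\<lambda>l. z (i l)) =
             pgf M (\<lambda>\<omega>. s * N \<omega>)
               ((\<Sum>l=1..r. p (i l) * z (i l)) + 1 - (\<Sum>l=1..r. p (i l))))
      \<and> (\<forall>x :: nat \<Rightarrow> nat.
           let a = (\<lambda>m. fact (m + (\<Sum>l=1..r. x (i l))) / fact m
                        * (1 - (\<Sum>l=1..r. p (i l))) ^ m
                        * \<P>(\<omega> in M. s * N \<omega> = m + (\<Sum>l=1..r. x (i l))))
           in summable a \<and>
              \<P>(\<omega> in M. \<forall>l\<in>{1..r}. X (i l) \<omega> = x (i l)) =
                (\<Prod>l=1..r. p (i l) ^ x (i l)) / (\<Prod>l=1..r. fact (x (i l))) * (\<Sum>m. a m))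
      \<and> distr M (count_space (nat_vectors (r + 1)))
          (\<lambda>\<omega>. \<lambda>l\<in>{1..r + 1}. if l \<le> r then X (i l) \<omega> else N \<omega> * s - (\<Sum>l=1..r. X (i l) \<omega>)) =
        compound_multinomial (distr M (count_space UNIV) N) s (r + 1)
          (\<lambda>l. if l \<le> r then p (i l) else 1 - (\<Sum>l=1..r. p (i l)))"
    proof (intro conjI allI)
      fix z :: "nat \<Rightarrow> real"
      show "joint_pgf_exists M {1..r} (\<lambda>l. X (i l)) (\<lambda>l. z (i l)) \<longrightarrow>
           pgf_exists M (\<lambda>\<omega>. s * N \<omega>)
             ((\<Sum>l=1..r. p (i l) * z (i l)) + 1 - (\<Sum>l=1..r. p (i l))) \<and>
           joint_pgf M {1..r} (\<lambda>l. X (i l)) (\<lambda>l. z (i l)) =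
             pgf M (\<lambda>\<omega>. s * N \<omega>)
               ((\<Sum>l=1..r. p (i l) * z (i l)) + 1 - (\<Sum>l=1..r. p (i l)))"
        using W.joint_pgf_counts[OF i(2), of z]
        unfolding joint_pgf_exists_def joint_pgf_def sum_A prod_A sum_p sum_pz L_def by blast
    next
      fix x :: "nat \<Rightarrow> nat"
      show "
           let a = (\<lambda>m. fact (m + (\<Sum>l=1..r. x (i l))) / fact m
                        * (1 - (\<Sum>l=1..r. p (i l))) ^ m
                        * \<P>(\<omega> in M. s * N \<omega> = m + (\<Sum>l=1..r. x (i l))))
           in summable a \<and>
              \<P>(\<omega> in M. \<forall>l\<in>{1..r}. X (i l) \<omega> = x (i l)) =
                (\<Prod>l=1..r. p (i l) ^ x (i l)) / (\<Prod>l=1..r. fact (x (i l))) * (\<Sum>m. a m)"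
        using W.prob_counts_series[OF i(2) A_pos, of x]
        unfolding sum_A prod_A sum_p prod_p L_def Let_def by simp
    next
      show "distr M (count_space (nat_vectors (r + 1)))
          (\<lambda>\<omega>. \<lambda>l\<in>{1..r + 1}. if l \<le> r then X (i l) \<omega> else N \<omega> * s - (\<Sum>l=1..r. X (i l) \<omega>)) =
        compound_multinomial (distr M (count_space UNIV) N) s (r + 1)
          (\<lambda>l. if l \<le> r then p (i l) else 1 - (\<Sum>l=1..r. p (i l)))"
        by (rule counts_and_rest_law[OF W s_pos N i]) (use p sum_p in simp_all)
    qed
  qed
  have single: "\<forall>i\<in>{1..k}.
        (\<forall>m. let a = (\<lambda>j. fact (j + m) / fact j * (1 - p i) ^ j * \<P>(\<omega> in M. s * N \<omega> = j + m))
             in summable a \<and>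
                \<P>(\<omega> in M. X i \<omega> = m) = p i ^ m / fact m * (\<Sum>j. a j))
      \<and> \<P>(\<omega> in M. X i \<omega> = 0) = pgf M (\<lambda>\<omega>. s * N \<omega>) (1 - p i)
      \<and> (\<forall>m\<ge>1. ((\<lambda>n. real (n * s choose m) * p i ^ m * (1 - p i) ^ (n * s - m)
                       * \<P>(\<omega> in M. N \<omega> = n)) has_sum \<P>(\<omega> in M. X i \<omega> = m)) {1..})
      \<and> (integrable M (\<lambda>\<omega>. real (N \<omega>)) \<longrightarrow>
           integrable M (\<lambda>\<omega>. real (X i \<omega>)) \<and> mean M (X i) = real s * p i * mean M N)
      \<and> (integrable M (\<lambda>\<omega>. (real (N \<omega>))\<^sup>2) \<longrightarrow>
           integrable M (\<lambda>\<omega>. (real (X i \<omega>))\<^sup>2) \<and>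
           var M (X i) = real s * p i * (real s * p i * var M N + (1 - p i) * mean M N) \<and>
           (mean M N \<noteq> 0 \<longrightarrow>
              fisher_index M (X i) = 1 + p i * (real s * fisher_index M N - 1)))"
  proof
    fix i assume i: "i \<in> {1..k}"
    note p = c(1)[OF i, symmetric]
    show "(\<forall>m. let a = (\<lambda>j. fact (j + m) / fact j * (1 - p i) ^ j * \<P>(\<omega> in M. s * N \<omega> = j + m))
             in summable a \<and>
                \<P>(\<omega> in M. X i \<omega> = m) = p i ^ m / fact m * (\<Sum>j. a j))
      \<and> \<P>(\<omega> in M. X i \<omega> = 0) = pgf M (\<lambda>\<omega>. s * N \<omega>) (1 - p i)
      \<and> (\<forall>m\<ge>1. ((\<lambda>n. real (n * s choose m) * p i ^ m * (1 - p i) ^ (n * s - m)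
                       * \<P>(\<omega> in M. N \<omega> = n)) has_sum \<P>(\<omega> in M. X i \<omega> = m)) {1..})
      \<and> (integrable M (\<lambda>\<omega>. real (N \<omega>)) \<longrightarrow>
           integrable M (\<lambda>\<omega>. real (X i \<omega>)) \<and> mean M (X i) = real s * p i * mean M N)
      \<and> (integrable M (\<lambda>\<omega>. (real (N \<omega>))\<^sup>2) \<longrightarrow>
           integrable M (\<lambda>\<omega>. (real (X i \<omega>))\<^sup>2) \<and>
           var M (X i) = real s * p i * (real s * p i * var M N + (1 - p i) * mean M N) \<and>
           (mean M N \<noteq> 0 \<longrightarrow>
              fisher_index M (X i) = 1 + p i * (real s * fisher_index M N - 1)))"
    proof (intro conjI allI impI)
      fix m :: nat
      show "let a = (\<lambda>j. fact (j + m) / fact j * (1 - p i) ^ j * \<P>(\<omega> in M. s * N \<omega> = j + m))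
             in summable a \<and>
                \<P>(\<omega> in M. X i \<omega> = m) = p i ^ m / fact m * (\<Sum>j. a j)"
        using W.prob_count_series[OF i pos[OF i], of m] unfolding p L_def Let_def by simp
    next
      show "\<P>(\<omega> in M. X i \<omega> = 0) = pgf M (\<lambda>\<omega>. s * N \<omega>) (1 - p i)"
        using W.prob_count_0[OF i] unfolding p L_def .
    next
      fix m :: nat assume m: "m \<ge> 1"
      define f where "f n = count_weight {i} (pmf c) (1 - pmf c i) n (\<lambda>_. m) * \<P>(\<omega> in M. s * N \<omega> = n)" for n
      have "((\<lambda>n. f (n * s)) has_sum \<P>(\<omega> in M. X i \<omega> = m)) {1..}"
      proof (rule sum_up_to_mult[OF s_pos])
        show "f n \<ge> 0" for n by (simp add: f_def count_weight_single pmf_le_1)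
        show "f 0 = 0" using m by (simp add: f_def count_weight_single)
        show "f n = 0" if "\<not> s dvd n" for n
        proof -
          have "s * N \<omega> \<noteq> n" for \<omega> using that by auto
          then show ?thesis by (simp add: f_def)
        qed
        show "f sums \<P>(\<omega> in M. X i \<omega> = m)"
          using W.prob_counts_sums[of "{i}" "\<lambda>_. m"] i by (simp add: f_def[abs_def] L_def)
      qed
      also have "(\<lambda>n. f (n * s)) = (\<lambda>n. real (n * s choose m) * pmf c i ^ m * (1 - pmf c i) ^ (n * s - m) *
          \<P>(\<omega> in M. N \<omega> = n))"
      proof
        fix n
        have "s * N \<omega> = n * s \<longleftrightarrow> N \<omega> = n" for \<omega> using s_pos by (simp add: mult.commute[of n])
        then show "f (n * s) = real (n * s choose m) * pmf c i ^ m * (1 - pmf c i) ^ (n * s - m) *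
          \<P>(\<omega> in M. N \<omega> = n)"
          by (simp add: f_def count_weight_single)
      qed
      finally show "((\<lambda>n. real (n * s choose m) * p i ^ m * (1 - p i) ^ (n * s - m)
                       * \<P>(\<omega> in M. N \<omega> = n)) has_sum \<P>(\<omega> in M. X i \<omega> = m)) {1..}" unfolding p .
    next
      assume int: "integrable M (\<lambda>\<omega>. real (N \<omega>))"
      show "integrable M (\<lambda>\<omega>. real (X i \<omega>))" by (rule W.mean_count(1)[OF i int_L[OF int]])
      show "mean M (X i) = real s * p i * mean M N"
        unfolding W.mean_count(2)[OF i int_L[OF int]] mean_L p by simp
    next
      assume int: "integrable M (\<lambda>\<omega>. (real (N \<omega>))\<^sup>2)"
      show "integrable M (\<lambda>\<omega>. (real (X i \<omega>))\<^sup>2)" by (rule W.var_count(1)[OF i int_L2[OF int]])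
      show "var M (X i) = real s * p i * (real s * p i * var M N + (1 - p i) * mean M N)"
        unfolding W.var_count(2)[OF i int_L2[OF int]] var_L
        unfolding mean_L p by (simp add: power2_eq_square algebra_simps)
      assume nz: "mean M N \<noteq> 0"
      then have "mean M L \<noteq> 0" unfolding mean_L using s_real by simp
      then show "fisher_index M (X i) = 1 + p i * (real s * fisher_index M N - 1)"
        unfolding p fisher_L[OF nz, symmetric] by (rule W.fisher_index_count[OF i pos[OF i] int_L2[OF int]])
    qed
  qed
  have pairs: "\<forall>i\<in>{1..k}. \<forall>j\<in>{1..k}. i \<noteq> j \<longrightarrow>
        (\<forall>xj. \<P>(\<omega> in M. X j \<omega> = xj) \<noteq> 0 \<longrightarrow>
          (let C = uniform_measure M {\<omega> \<in> space M. X j \<omega> = xj};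
               b = (\<lambda>m. fact (xj + m) / fact m * (1 - p j) ^ m * \<P>(\<omega> in M. s * N \<omega> = xj + m))
           in summable b
            \<and> (\<forall>xi.
                let a = (\<lambda>m. fact (m + xi + xj) / fact m * (1 - (p i + p j)) ^ m
                             * \<P>(\<omega> in M. s * N \<omega> = m + xi + xj))
                in summable a \<and>
                   \<P>(\<omega> in M. X i \<omega> = xi \<bar> X j \<omega> = xj) =
                     p i ^ xi / fact xi * ((\<Sum>m. a m) / (\<Sum>m. b m)))
            \<and> (\<forall>z. pgf_exists C (X i) z \<longrightarrow>
                (let a = (\<lambda>m. fact (xj + m) / fact m * (p i * z + 1 - p i - p j) ^ m
                              * \<P>(\<omega> in M. s * N \<omega> = xj + m))
                 in summable a \<and> pgf C (X i) z = (\<Sum>m. a m) / (\<Sum>m. b m)))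
            \<and> (integrable C (\<lambda>\<omega>. real (X i \<omega>)) \<longrightarrow>
                (let a = (\<lambda>m. fact (xj + m + 1) / fact m * (1 - p j) ^ m
                              * \<P>(\<omega> in M. s * N \<omega> = xj + m + 1))
                 in summable a \<and> mean C (X i) = p i * ((\<Sum>m. a m) / (\<Sum>m. b m))))
            \<and> (integrable C (\<lambda>\<omega>. real (X i \<omega>)) \<longrightarrow>
                mean C (X i) = p i / p j * (real xj + 1)
                  * (\<P>(\<omega> in M. X j \<omega> = xj + 1) / \<P>(\<omega> in M. X j \<omega> = xj)))))
      \<and> (integrable M (\<lambda>\<omega>. (real (N \<omega>))\<^sup>2) \<longrightarrow>
           cov M (X i) (X j) = real s * p i * p j * (- mean M N + real s * var M N)
         \<and> (var M (X i) \<noteq> 0 \<and> var M (X j) \<noteq> 0 \<longrightarrow>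
              cor M (X i) (X j) =
                sqrt (p i * p j) * (real s * var M N - mean M N)
                / sqrt ((real s * p i * var M N + mean M N * (1 - p i))
                        * (real s * p j * var M N + mean M N * (1 - p j)))
            \<and> (let R = sqrt ((fisher_index M (X i) - 1) * (fisher_index M (X j) - 1)
                              / (fisher_index M (X i) * fisher_index M (X j)))
               in (real s * var M N \<ge> mean M N \<longrightarrow> cor M (X i) (X j) = R)
                \<and> (real s * var M N < mean M N \<longrightarrow> cor M (X i) (X j) = - R))))"
  proof (intro ballI impI)
    fix i j assume i: "i \<in> {1..k}" and j: "j \<in> {1..k}" and ij: "i \<noteq> j"
    note p = c(1)[OF i, symmetric] c(1)[OF j, symmetric]
    note idx = i j ij pos[OF i] pos[OF j]
    show "(\<forall>xj. \<P>(\<omega> in M. X j \<omega> = xj) \<noteq> 0 \<longrightarrow>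
          (let C = uniform_measure M {\<omega> \<in> space M. X j \<omega> = xj};
               b = (\<lambda>m. fact (xj + m) / fact m * (1 - p j) ^ m * \<P>(\<omega> in M. s * N \<omega> = xj + m))
           in summable b
            \<and> (\<forall>xi.
                let a = (\<lambda>m. fact (m + xi + xj) / fact m * (1 - (p i + p j)) ^ m
                             * \<P>(\<omega> in M. s * N \<omega> = m + xi + xj))
                in summable a \<and>
                   \<P>(\<omega> in M. X i \<omega> = xi \<bar> X j \<omega> = xj) =
                     p i ^ xi / fact xi * ((\<Sum>m. a m) / (\<Sum>m. b m)))
            \<and> (\<forall>z. pgf_exists C (X i) z \<longrightarrow>
                (let a = (\<lambda>m. fact (xj + m) / fact m * (p i * z + 1 - p i - p j) ^ m
                              * \<P>(\<omega> in M. s * N \<omega> = xj + m))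
                 in summable a \<and> pgf C (X i) z = (\<Sum>m. a m) / (\<Sum>m. b m)))
            \<and> (integrable C (\<lambda>\<omega>. real (X i \<omega>)) \<longrightarrow>
                (let a = (\<lambda>m. fact (xj + m + 1) / fact m * (1 - p j) ^ m
                              * \<P>(\<omega> in M. s * N \<omega> = xj + m + 1))
                 in summable a \<and> mean C (X i) = p i * ((\<Sum>m. a m) / (\<Sum>m. b m))))
            \<and> (integrable C (\<lambda>\<omega>. real (X i \<omega>)) \<longrightarrow>
                mean C (X i) = p i / p j * (real xj + 1)
                  * (\<P>(\<omega> in M. X j \<omega> = xj + 1) / \<P>(\<omega> in M. X j \<omega> = xj)))))
      \<and> (integrable M (\<lambda>\<omega>. (real (N \<omega>))\<^sup>2) \<longrightarrow>
           cov M (X i) (X j) = real s * p i * p j * (- mean M N + real s * var M N)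
         \<and> (var M (X i) \<noteq> 0 \<and> var M (X j) \<noteq> 0 \<longrightarrow>
              cor M (X i) (X j) =
                sqrt (p i * p j) * (real s * var M N - mean M N)
                / sqrt ((real s * p i * var M N + mean M N * (1 - p i))
                        * (real s * p j * var M N + mean M N * (1 - p j)))
            \<and> (let R = sqrt ((fisher_index M (X i) - 1) * (fisher_index M (X j) - 1)
                              / (fisher_index M (X i) * fisher_index M (X j)))
               in (real s * var M N \<ge> mean M N \<longrightarrow> cor M (X i) (X j) = R)
                \<and> (real s * var M N < mean M N \<longrightarrow> cor M (X i) (X j) = - R))))"
    proof (intro conjI allI impI)
      fix xj assume nz: "\<P>(\<omega> in M. X j \<omega> = xj) \<noteq> 0"
      have comm: "xj + m = m + xj" for m by simp
      let ?C = "uniform_measure M {\<omega> \<in> space M. X j \<omega> = xj}"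
      show "
          (let C = uniform_measure M {\<omega> \<in> space M. X j \<omega> = xj};
               b = (\<lambda>m. fact (xj + m) / fact m * (1 - p j) ^ m * \<P>(\<omega> in M. s * N \<omega> = xj + m))
           in summable b
            \<and> (\<forall>xi.
                let a = (\<lambda>m. fact (m + xi + xj) / fact m * (1 - (p i + p j)) ^ m
                             * \<P>(\<omega> in M. s * N \<omega> = m + xi + xj))
                in summable a \<and>
                   \<P>(\<omega> in M. X i \<omega> = xi \<bar> X j \<omega> = xj) =
                     p i ^ xi / fact xi * ((\<Sum>m. a m) / (\<Sum>m. b m)))
            \<and> (\<forall>z. pgf_exists C (X i) z \<longrightarrow>
                (let a = (\<lambda>m. fact (xj + m) / fact m * (p i * z + 1 - p i - p j) ^ m
                              * \<P>(\<omega> in M. s * N \<omega> = xj + m))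
                 in summable a \<and> pgf C (X i) z = (\<Sum>m. a m) / (\<Sum>m. b m)))
            \<and> (integrable C (\<lambda>\<omega>. real (X i \<omega>)) \<longrightarrow>
                (let a = (\<lambda>m. fact (xj + m + 1) / fact m * (1 - p j) ^ m
                              * \<P>(\<omega> in M. s * N \<omega> = xj + m + 1))
                 in summable a \<and> mean C (X i) = p i * ((\<Sum>m. a m) / (\<Sum>m. b m))))
            \<and> (integrable C (\<lambda>\<omega>. real (X i \<omega>)) \<longrightarrow>
                mean C (X i) = p i / p j * (real xj + 1)
                  * (\<P>(\<omega> in M. X j \<omega> = xj + 1) / \<P>(\<omega> in M. X j \<omega> = xj))))"
        unfolding Let_def p comm L_eq[symmetric]
      proof (intro conjI allI impI)
        show "summable (\<lambda>m. fact (m + xj) / fact m * (1 - pmf c j) ^ m * \<P>(\<omega> in M. L \<omega> = m + xj))"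
          by (rule W.prob_count_series(1)[OF j pos[OF j]])
      next
        fix xi :: nat
        show "summable (\<lambda>m. fact (m + xi + xj) / fact m * (1 - (pmf c i + pmf c j)) ^ m *
            \<P>(\<omega> in M. L \<omega> = m + xi + xj))"
          by (rule W.prob_two_counts_series(1)[OF idx])
      next
        fix xi :: nat
        show "\<P>(\<omega> in M. X i \<omega> = xi \<bar> X j \<omega> = xj) = pmf c i ^ xi / fact xi *
          ((\<Sum>m. fact (m + xi + xj) / fact m * (1 - (pmf c i + pmf c j)) ^ m * \<P>(\<omega> in M. L \<omega> = m + xi + xj)) /
           (\<Sum>m. fact (m + xj) / fact m * (1 - pmf c j) ^ m * \<P>(\<omega> in M. L \<omega> = m + xj)))"
          by (rule W.cond_prob_counts[OF idx])
      next
        fix z assume ex: "pgf_exists ?C (X i) z"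
        show "summable (\<lambda>m. fact (m + xj) / fact m * (pmf c i * z + 1 - pmf c i - pmf c j) ^ m *
            \<P>(\<omega> in M. L \<omega> = m + xj))"
          by (rule W.pgf_given_count(1)[OF i j ij pos[OF j] nz ex])
        show "pgf ?C (X i) z =
            (\<Sum>m. fact (m + xj) / fact m * (pmf c i * z + 1 - pmf c i - pmf c j) ^ m * \<P>(\<omega> in M. L \<omega> = m + xj)) /
            (\<Sum>m. fact (m + xj) / fact m * (1 - pmf c j) ^ m * \<P>(\<omega> in M. L \<omega> = m + xj))"
          by (rule W.pgf_given_count(2)[OF i j ij pos[OF j] nz ex])
      next
        assume ex: "integrable ?C (\<lambda>\<omega>. real (X i \<omega>))"
        show "summable (\<lambda>m. fact (m + xj + 1) / fact m * (1 - pmf c j) ^ m * \<P>(\<omega> in M. L \<omega> = m + xj + 1))"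
          unfolding add.assoc by (rule W.mean_given_count(1)[OF idx nz ex])
        show "mean ?C (X i) = pmf c i *
            ((\<Sum>m. fact (m + xj + 1) / fact m * (1 - pmf c j) ^ m * \<P>(\<omega> in M. L \<omega> = m + xj + 1)) /
             (\<Sum>m. fact (m + xj) / fact m * (1 - pmf c j) ^ m * \<P>(\<omega> in M. L \<omega> = m + xj)))"
          unfolding add.assoc by (rule W.mean_given_count(2)[OF idx nz ex])
        show "mean ?C (X i) = pmf c i / pmf c j * (real xj + 1) *
            (\<P>(\<omega> in M. X j \<omega> = 1 + xj) / \<P>(\<omega> in M. X j \<omega> = xj))"
          unfolding add.commute[of 1 xj] by (rule W.mean_given_count_ratio[OF idx nz ex])
      qed
    next
      assume int: "integrable M (\<lambda>\<omega>. (real (N \<omega>))\<^sup>2)"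
      note L2 = int_L2[OF int]
      show "cov M (X i) (X j) = real s * p i * p j * (- mean M N + real s * var M N)"
        unfolding W.cov_counts[OF i j ij L2] var_L
        unfolding mean_L p by (simp add: power2_eq_square algebra_simps)
      assume "var M (X i) \<noteq> 0 \<and> var M (X j) \<noteq> 0"
      then have nz: "var M (X i) \<noteq> 0" "var M (X j) \<noteq> 0" by auto
      have diff: "var M L - mean M L = real s * (real s * var M N - mean M N)"
        unfolding var_L unfolding mean_L by (simp add: power2_eq_square algebra_simps)
      have fac: "pmf c l * var M L + (1 - pmf c l) * mean M L =
          real s * (real s * pmf c l * var M N + mean M N * (1 - pmf c l))" for l
        unfolding var_L unfolding mean_L by (simp add: power2_eq_square algebra_simps)
      \<comment> \<open>Passing from the length L = s N to N produces a factor s in the numerator and its square under the root.\<close>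
      have cancel: "sqrt q * (real s * d) / sqrt ((real s * a) * (real s * b)) = sqrt q * d / sqrt (a * b)" for q d a b
      proof -
        have "sqrt ((real s * a) * (real s * b)) = real s * sqrt (a * b)"
          by (simp add: real_sqrt_mult mult_ac)
        then show ?thesis using s_real by simp
      qed
      show "cor M (X i) (X j) = sqrt (p i * p j) * (real s * var M N - mean M N)
                / sqrt ((real s * p i * var M N + mean M N * (1 - p i))
                        * (real s * p j * var M N + mean M N * (1 - p j)))"
        unfolding W.cor_counts(1)[OF idx L2 nz] diff fac cancel p ..
      have "mean M L \<le> var M L \<longleftrightarrow> 0 \<le> var M L - mean M L" by (rule diff_ge_0_iff_ge[symmetric])
      also have "\<dots> \<longleftrightarrow> mean M N \<le> real s * var M N"
        unfolding diff using s_pos by (simp only: zero_le_mult_iff) auto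
      finally have le: "mean M L \<le> var M L \<longleftrightarrow> mean M N \<le> real s * var M N" .
      show "let R = sqrt ((fisher_index M (X i) - 1) * (fisher_index M (X j) - 1)
                              / (fisher_index M (X i) * fisher_index M (X j)))
               in (real s * var M N \<ge> mean M N \<longrightarrow> cor M (X i) (X j) = R)
                \<and> (real s * var M N < mean M N \<longrightarrow> cor M (X i) (X j) = - R)"
        unfolding Let_def not_le[symmetric] le[symmetric]
        using W.cor_counts(2,3)[OF idx L2 nz] unfolding not_le[symmetric] by blast
    qed
  qed
  show ?thesis
  proof (intro conjI)
    show "\<forall>z. joint_pgf_exists M {1..k} X z \<longrightarrow>
        pgf_exists M (\<lambda>\<omega>. s * N \<omega>) (\<Sum>l=1..k. p l * z l) \<and>
        joint_pgf M {1..k} X z = pgf M (\<lambda>\<omega>. s * N \<omega>) (\<Sum>l=1..k. p l * z l)"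
      using W.joint_pgf_counts[of "{1..k}"] c(1) p_sum by (simp add: L_def)
    show "\<forall>x :: nat \<Rightarrow> nat. s dvd (\<Sum>l=1..k. x l) \<longrightarrow>
        \<P>(\<omega> in M. \<forall>l\<in>{1..k}. X l \<omega> = x l) =
          multinomial_coeff {1..k} x * (\<Prod>l=1..k. p l ^ x l)
            * \<P>(\<omega> in M. N \<omega> * s = (\<Sum>l=1..k. x l))"
      using joint_law by blast
    show "\<P>(\<omega> in M. \<forall>l\<in>{1..k}. X l \<omega> = 0) = \<P>(\<omega> in M. N \<omega> = 0)"
      using joint_law[of "\<lambda>_. 0"] s_pos by (simp add: multinomial_coeff_def)
    show "\<forall>z. pgf_exists M (\<lambda>\<omega>. \<Sum>l=1..k. X l \<omega>) z \<longrightarrow>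
        pgf_exists M (\<lambda>\<omega>. s * N \<omega>) z \<and>
        pgf M (\<lambda>\<omega>. \<Sum>l=1..k. X l \<omega>) z = pgf M (\<lambda>\<omega>. s * N \<omega>) z"
    proof (intro allI impI conjI)
      fix z assume ex: "pgf_exists M (\<lambda>\<omega>. \<Sum>l=1..k. X l \<omega>) z"
      have [measurable]: "(\<lambda>\<omega>. \<Sum>l=1..k. X l \<omega>) \<in> measurable M (count_space UNIV)"
        using W.X_measurable by (rule measurable_sum_nat)
      have ae: "AE \<omega> in M. z ^ (\<Sum>l=1..k. X l \<omega>) = z ^ (s * N \<omega>)"
        using W.AE_sum_counts by eventually_elim (simp add: L_def)
      have m: "(\<lambda>\<omega>. z ^ (\<Sum>l=1..k. X l \<omega>)) \<in> borel_measurable M"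
        "(\<lambda>\<omega>. z ^ (s * N \<omega>)) \<in> borel_measurable M" by measurable
      show "pgf_exists M (\<lambda>\<omega>. s * N \<omega>) z"
        using ex integrable_cong_AE[OF m ae] by (simp add: pgf_exists_def)
      show "pgf M (\<lambda>\<omega>. \<Sum>l=1..k. X l \<omega>) z = pgf M (\<lambda>\<omega>. s * N \<omega>) z"
        unfolding pgf_def by (rule integral_cong_AE[OF m ae])
    qed
    show "\<forall>m. \<P>(\<omega> in M. (\<Sum>l=1..k. X l \<omega>) = m) = \<P>(\<omega> in M. s * N \<omega> = m)"
      using W.prob_sum_counts by (simp add: L_def)
    show "\<forall>j\<ge>1. \<forall>i\<in>{1..k}. \<P>(\<omega> in M. (\<Sum>l=1..k. X l \<omega>) = j) \<noteq> 0 \<longrightarrow>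
        distr (uniform_measure M {\<omega> \<in> space M. (\<Sum>l=1..k. X l \<omega>) = j}) (count_space UNIV) (X i) =
        measure_pmf (binomial_pmf j (p i))"
    proof (intro allI ballI impI)
      fix j i assume i: "i \<in> {1..k}" and nz: "\<P>(\<omega> in M. (\<Sum>l=1..k. X l \<omega>) = j) \<noteq> 0"
      show "distr (uniform_measure M {\<omega> \<in> space M. (\<Sum>l=1..k. X l \<omega>) = j}) (count_space UNIV) (X i) =
          measure_pmf (binomial_pmf j (p i))"
        unfolding c(1)[OF i, symmetric] by (rule W.count_given_length_binomial[OF i nz])
    qed
  qed (fact subsets single pairs)+
qed

end
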